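(* Let $n\ge2$, $p,q\in[1,\infty)$, $s,t>0$, $k\in(n,n+p]$ and $l\in(1,1+q]$. Let $f:\mathbb R^n\to\mathbb C$ be a measurable function such that (i) $\displaystyle\int_{\mathbb R^n}\frac{|f(x)|^p\,e^{\frac p{4s}|x|^2}}{(1+|x|)^k}\,dx<\infty$, and (ii) for each non-negative integer $m$ and each $S_m\in\mathcal H_m$, $\displaystyle\int_{\mathbb R^+}\frac{|F_m(\lambda)|^q\,e^{qt\lambda^2}}{(1+\lambda)^l}\,d\lambda<\infty$. Then: (a) if $s<t$, then $f\equiv0$ (almost everywhere); (b) if $s=t$, then $f$ is (almost everywhere) a constant multiple of $p_t$; (c) if $s>t$, then there exist infinitely many linearly independent functions satisfying (i) and (ii).
   Context: $\mathcal H_m$ is the space of spherical harmonics of degree $m$ on the unit sphere $S^{n-1}\subset\mathbb R^n$. For $f\in L^1(\mathbb R^n)$ (which condition (i) guarantees), the Fourier transform in polar coordinates is $\widehat f(\lambda,\omega)=(2\pi)^{-n/2}\int_{\mathbb R^n}f(x)e^{-i\lambda x\cdot\omega}\,dx$ for $\lambda>0$, $\omega\in S^{n-1}$. For $S_m\in\mathcal H_m$, $$F_m(\lambda)=\lambda^{-m}\int_{S^{n-1}}\widehat f(\lambda,\omega)S_m(\omega)\,d\omega,\qquad\lambda>0,$$ ($F_m$ depends on $f$ and on $S_m$). $p_t(x)=(4\pi t)^{-n/2}e^{-|x|^2/4t}$ is the heat kernel of the Laplacian on $\mathbb R^n$. *)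

theory Defs
  imports "HOL-Analysis.Analysis"
begin

text \<open>
  Surface measure on the unit sphere, via polar coordinates: the surface measure of \<open>A\<close> is
  \<open>n\<close> times the Lebesgue measure of the truncated cone over \<open>A\<close>, i.e. of the set of all
  \<open>r \<cdot> \<omega>\<close> with \<open>0 < r \<le> 1\<close> and \<open>\<omega> \<in> A\<close>.
\<close>

definition sphere_measure :: "'a::euclidean_space measure" where
  "sphere_measure =
     scale_measure (of_nat DIM('a))
       (distr (restrict_space lborel (cball 0 1 - {0})) (restrict_space borel (sphere 0 1))
         (\<lambda>x. x /\<^sub>R norm x))"

lemma space_sphere_measure [simp]: "space sphere_measure = sphere 0 1"
  by (simp add: sphere_measure_def space_restrict_space space_scale_measure)

lemma sets_sphere_measure [simp]:
  "sets sphere_measure = sets (restrict_space borel (sphere 0 1))"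
  by (simp add: sphere_measure_def)

lemma emeasure_sphere_measure:
  assumes "A \<in> sets (restrict_space borel (sphere (0::'a::euclidean_space) 1))"
  shows "emeasure sphere_measure A =
    of_nat DIM('a) * emeasure lborel {x \<in> cball 0 1 - {0}. x /\<^sub>R norm x \<in> A}"
proof -
  let ?R = "restrict_space lborel (cball 0 1 - {0::'a})"
  have meas: "(\<lambda>x. x /\<^sub>R norm x) \<in> measurable ?R (restrict_space borel (sphere 0 1))"
  proof (rule measurable_restrict_space2)
    show "(\<lambda>x. x /\<^sub>R norm x) \<in> space ?R \<rightarrow> sphere 0 1"
      by (auto simp: space_restrict_space)
    have "(\<lambda>x::'a. x /\<^sub>R norm x) \<in> borel_measurable lborel"
      by measurable
    then show "(\<lambda>x. x /\<^sub>R norm x) \<in> borel_measurable ?R"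
      by (rule measurable_restrict_space1)
  qed
  have eq: "(\<lambda>x. x /\<^sub>R norm x) -` A \<inter> space ?R = {x \<in> cball 0 1 - {0}. x /\<^sub>R norm x \<in> A}"
    by (auto simp: space_restrict_space)
  have "emeasure sphere_measure A =
      of_nat DIM('a) * emeasure ?R ((\<lambda>x. x /\<^sub>R norm x) -` A \<inter> space ?R)"
    using assms by (simp add: sphere_measure_def emeasure_distr[OF meas])
  also have "emeasure ?R ((\<lambda>x. x /\<^sub>R norm x) -` A \<inter> space ?R) =
      emeasure lborel {x \<in> cball 0 1 - {0}. x /\<^sub>R norm x \<in> A}"
    unfolding eq by (rule emeasure_restrict_space) auto
  finally show ?thesis .
qed

definition laplacian :: "('a::euclidean_space \<Rightarrow> complex) \<Rightarrow> 'a \<Rightarrow> complex" where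
  "laplacian u x =
     (\<Sum>b\<in>Basis. vector_derivative
        (\<lambda>h. vector_derivative (\<lambda>h'. u (x + h' *\<^sub>R b)) (at h)) (at 0))"

text \<open>
  Spherical harmonics of degree \<open>m\<close>: restrictions to the unit sphere of harmonic homogeneous
  polynomials of degree \<open>m\<close> with complex coefficients. For a polynomial function, being homogeneous
  of degree \<open>m\<close> as a polynomial is the scaling identity below.
\<close>

definition spherical_harmonics :: "nat \<Rightarrow> ('a::euclidean_space \<Rightarrow> complex) set" where
  "spherical_harmonics m =
     {restrict P (sphere 0 1) | P.
        polynomial_function P \<and> (\<forall>c x. P (c *\<^sub>R x) = of_real (c ^ m) * P x) \<and>
        (\<forall>x. laplacian P x = 0)}"

definition fourier_polar :: "('a::euclidean_space \<Rightarrow> complex) \<Rightarrow> real \<Rightarrow> 'a \<Rightarrow> complex" where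
  "fourier_polar f r \<omega> =
     of_real ((2 * pi) powr (- real DIM('a) / 2)) *
     (LINT x|lebesgue. f x * exp (- \<i> * of_real (r * (x \<bullet> \<omega>))))"

definition harmonic_coeff ::
    "('a::euclidean_space \<Rightarrow> complex) \<Rightarrow> nat \<Rightarrow> ('a \<Rightarrow> complex) \<Rightarrow> real \<Rightarrow> complex" where
  "harmonic_coeff f m S r =
     of_real (r powi (- int m)) * (LINT \<omega>|sphere_measure. fourier_polar f r \<omega> * S \<omega>)"

definition heat_kernel :: "real \<Rightarrow> 'a::euclidean_space \<Rightarrow> real" where
  "heat_kernel t x = (4 * pi * t) powr (- real DIM('a) / 2) * exp (- (norm x)\<^sup>2 / (4 * t))"

definition gaussian_decay ::
    "real \<Rightarrow> real \<Rightarrow> real \<Rightarrow> ('a::euclidean_space \<Rightarrow> complex) \<Rightarrow> bool" where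
  "gaussian_decay p s k f \<longleftrightarrow>
     (\<integral>\<^sup>+x. ennreal (norm (f x) powr p * exp (p / (4 * s) * (norm x)\<^sup>2) / (1 + norm x) powr k)
        \<partial>lebesgue) < \<infinity>"

definition fourier_gaussian_decay ::
    "real \<Rightarrow> real \<Rightarrow> real \<Rightarrow> ('a::euclidean_space \<Rightarrow> complex) \<Rightarrow> bool" where
  "fourier_gaussian_decay q t l f \<longleftrightarrow>
     (\<forall>m. \<forall>S\<in>spherical_harmonics m.
        (\<integral>\<^sup>+r\<in>{0<..}. ennreal (norm (harmonic_coeff f m S r) powr q * exp (q * t * r\<^sup>2)
             / (1 + r) powr l) \<partial>lborel) < \<infinity>)"

text \<open>
  Linear independence over the complex numbers, modulo equality almost everywhere. (Pointwise
  linear independence would be too weak a notion for functions that are identified when they agree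
  almost everywhere: indicator functions of distinct points are pointwise independent.)
\<close>

definition ae_independent_seq :: "(nat \<Rightarrow> 'a::euclidean_space \<Rightarrow> complex) \<Rightarrow> bool" where
  "ae_independent_seq g \<longleftrightarrow>
     (\<forall>N c. (AE x in lebesgue. (\<Sum>j<N. c j * g j x) = 0) \<longrightarrow> (\<forall>j<N. c j = 0))"

end

theory Submission
  imports Defs "HOL-Complex_Analysis.Complex_Analysis" "HOL-Probability.Probability"
    "HOL-Real_Asymp.Real_Asymp" "HOL-Computational_Algebra.Fundamental_Theorem_Algebra"
begin

text \<open>
  By (i), \<open>f\<close> has exponential moments of all orders, so for a spherical harmonic \<open>S\<close> of degree \<open>m\<close>
  the function \<open>G(z) = \<integral>\<integral> f(x) S(\<omega>) exp (-\<i> z (x \<bullet> \<omega>)) dx d\<omega>\<close> is entire and grows at most like a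
  polynomial times \<open>exp (t (Im z)\<^sup>2)\<close>; condition (ii) bounds the primitive of \<open>h(z) = G(z) exp (t z\<^sup>2)\<close>
  polynomially on the real axis. A Phragmen-Lindelof argument shows that \<open>h\<close> is a polynomial.
  On the imaginary axis (i) gives more: after Young's inequality \<open>A \<le> a + a powr (1 - p) * A powr p\<close> with \<open>a\<close>
  proportional to \<open>\<bar>z\<bar>\<close> and integration in polar coordinates, a nonconstant \<open>h\<close> would force
  integrability of \<open>y powr (n - 1 - k + p)\<close> at infinity, contradicting \<open>k \<le> n + p\<close>. So \<open>h\<close> is constant, and for
  \<open>m \<ge> 1\<close> it vanishes because \<open>r powr (- m q)\<close> is not integrable at 0. Since spherical harmonics span the
  polynomials on the sphere, \<open>f\<close> has the Fourier transform of a multiple of \<open>p\<^sub>t\<close>. The case \<open>s < t\<close>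
  reduces to \<open>s = t\<close>, and for \<open>s > t\<close> the kernels \<open>p\<^sub>u\<close> with \<open>t < u < s\<close> satisfy (i) and (ii).
\<close>

section \<open>Phragmen-Lindelof\<close>

text \<open>Condition (ii) controls only a weighted L^q mean of \<open>G\<close> on the positive
  half-line. It gives no pointwise bound for h there, but it does give one for a primitive of h;
  hence the integration before Phragmen-Lindelof is applied. The growth of h has order 2 and a
  quadrant has opening pi/2, which is exactly the critical pair for which the barrier alone fails.
  Each quadrant is therefore exhausted by smaller sectors, with a correction that vanishes in the
  limit. The resulting polynomial may still have positive degree, since pointwise use of (i) costs
  powers of |z|. Only an averaged bound is sharp enough: the square in y (x . \<omega>) - |x|^2 /
  (4t) is completed, and the integrand of (i) is smoothed by a Gaussian centred at 2 t y \<omega>.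
  The Young parameter is a small multiple of |z| because its term must be absorbed by the linear
  lower bound of a nonconstant polynomial. The exponent n - 1 - k + p is then at least -1, the
  threshold of divergence at infinity; m q \<ge> 1 is the same threshold at 0.\<close>

lemma partial_exp_le:
  fixes x :: real
  assumes "0 \<le> x"
  shows "(\<Sum>k\<in>I. x ^ k / fact k) \<le> exp x"
proof (cases "finite I")
  case True
  have "(\<lambda>k. x ^ k / fact k) sums exp x"
    using exp_converges[of x] by (simp add: divide_inverse mult.commute)
  with True show ?thesis using assms by (intro sum_le_suminf[THEN order_trans]) (auto simp: sums_iff)
qed simp

text \<open>Expanding the exponential gives a power series in z. The hypothesis with R = |z|
  dominates the partial sums of the norms, so sum and integral can be exchanged for every z and the
  series converges on all balls.\<close>

lemma entire_exp_integral:
  fixes F :: "'x \<Rightarrow> complex" and u :: "'x \<Rightarrow> real"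
  assumes [measurable]: "F \<in> borel_measurable M" "u \<in> borel_measurable M"
    and int: "\<And>R. 0 \<le> R \<Longrightarrow> integrable M (\<lambda>x. norm (F x) * exp (R * \<bar>u x\<bar>))"
  shows "(\<lambda>z. LINT x|M. F x * exp (- \<i> * (z * of_real (u x)))) holomorphic_on UNIV"
proof -
  define a where "a n = (LINT x|M. F x * (- \<i> * of_real (u x)) ^ n / fact n)" for n
  have "(\<lambda>n. a n * (z - 0) ^ n) sums (LINT x|M. F x * exp (- \<i> * (z * of_real (u x))))" for z
  proof -
    let ?f = "\<lambda>n x. F x * (- \<i> * of_real (u x)) ^ n / fact n * z ^ n"
    have nf: "norm (?f n x) = norm (F x) * ((norm z * \<bar>u x\<bar>) ^ n / fact n)" for n x
      by (simp add: norm_mult norm_power norm_divide power_mult_distrib)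
    have bnd: "norm (F x) * ((norm z * \<bar>u x\<bar>) ^ n / fact n) \<le> norm (F x) * exp (norm z * \<bar>u x\<bar>)" for n x
      using partial_exp_le[of "norm z * \<bar>u x\<bar>" "{n}"] by (intro mult_left_mono) auto
    have i0: "integrable M (\<lambda>x. norm (F x) * exp (norm z * \<bar>u x\<bar>))" by (rule int) simp
    have i1: "integrable M (?f n)" for n
    proof (rule Bochner_Integration.integrable_bound[OF i0])
      show "AE x in M. norm (?f n x) \<le> norm (norm (F x) * exp (norm z * \<bar>u x\<bar>))"
        unfolding nf using bnd[of _ n] by simp
    qed simp
    have s: "(\<lambda>n. ?f n x) sums (F x * exp (- \<i> * (z * of_real (u x))))" for x
    proof -
      have "(\<lambda>n. F x * ((- \<i> * (z * of_real (u x))) ^ n /\<^sub>R fact n)) sums (F x * exp (- \<i> * (z * of_real (u x))))"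
        by (intro sums_mult exp_converges)
      moreover have "F x * ((- \<i> * (z * of_real (u x))) ^ n /\<^sub>R fact n) = ?f n x" for n
        by (simp add: scaleR_conv_of_real power_mult_distrib divide_inverse mult_ac power_minus[of "_ * _"] power_minus[of \<i>])
      ultimately show ?thesis by simp
    qed
    have "(\<lambda>n. integral\<^sup>L M (?f n)) sums (LINT x|M. (\<Sum>n. ?f n x))"
    proof (rule sums_integral[OF i1])
      show "AE x in M. summable (\<lambda>n. norm (?f n x))"
      proof (rule AE_I2)
        fix x
        show "summable (\<lambda>n. norm (?f n x))" unfolding nf
          by (intro summable_mult) (use summable_exp[of "norm z * \<bar>u x\<bar>"] in \<open>simp add: divide_inverse mult.commute\<close>)
      qed
      \<comment> \<open>The terms are nonnegative, and their partial sums stay below the integral of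
        the dominating function in \<open>i0\<close>.\<close>
      show "summable (\<lambda>n. LINT x|M. norm (?f n x))"
      proof (rule bounded_imp_summable)
        fix n
        have "(\<Sum>k\<le>n. LINT x|M. norm (?f k x)) = (LINT x|M. (\<Sum>k\<le>n. norm (?f k x)))"
          using i1 by (subst Bochner_Integration.integral_sum) auto
        also have "\<dots> \<le> (LINT x|M. norm (F x) * exp (norm z * \<bar>u x\<bar>))"
          unfolding nf sum_distrib_left[symmetric]
        proof (rule integral_mono)
          show "integrable M (\<lambda>x. norm (F x) * (\<Sum>k\<le>n. (norm z * \<bar>u x\<bar>) ^ k / fact k))"
            unfolding sum_distrib_left nf[symmetric] using i1 by (intro Bochner_Integration.integrable_sum integrable_norm)
        qed (auto intro!: mult_left_mono partial_exp_le i0)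
        finally show "(\<Sum>k\<le>n. LINT x|M. norm (?f k x)) \<le> (LINT x|M. norm (F x) * exp (norm z * \<bar>u x\<bar>))" .
      qed simp
    qed
    moreover have "(\<Sum>n. ?f n x) = F x * exp (- \<i> * (z * of_real (u x)))" for x
      using s[of x] by (simp add: sums_iff)
    moreover have "integral\<^sup>L M (?f n) = a n * (z - 0) ^ n" for n
      by (simp add: a_def)
    ultimately show ?thesis by simp
  qed
  then have "(\<lambda>z. LINT x|M. F x * exp (- \<i> * (z * of_real (u x)))) holomorphic_on ball 0 r" for r
    by (rule power_series_holomorphic)
  then have "(\<lambda>z. LINT x|M. F x * exp (- \<i> * (z * of_real (u x)))) field_differentiable at z" for z
    using holomorphic_on_imp_differentiable_at[OF _ open_ball, of _ 0 "norm z + 1" z] by simp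
  then show ?thesis by (simp add: holomorphic_on_def)
qed

text \<open>Removes auxiliary exponential factors: once the barrier as its coefficient tends to 0,
  once the correction of the sectors as their opening tends to pi/2.\<close>

lemma exp_limit_bound:
  fixes A B D :: real
  assumes "(g \<longlongrightarrow> 0) F" "F \<noteq> bot" "\<forall>\<^sub>F e in F. A * exp (- g e * B) \<le> D"
  shows "A \<le> D"
proof (rule tendsto_upperbound[OF _ assms(3,2)])
  have "((\<lambda>e. A * exp (- g e * B)) \<longlongrightarrow> A * exp (- 0 * B)) F"
    by (intro tendsto_intros assms(1))
  then show "((\<lambda>e. A * exp (- g e * B)) \<longlongrightarrow> A) F" by simp
qed

text \<open>In the coordinate \<open>z = e\<^sup>w\<close> the sector \<open>0 \<le> arg z \<le> \<psi>\<close> is a half strip. The factor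
  \<open>exp (\<i> \<delta> z\<^sup>2)\<close> has modulus 1 on the real axis and compensates the growth of \<open>K\<close> on the ray
  \<open>arg z = \<psi>\<close>; the factor with exponent \<open>\<alpha> > 2\<close> is the usual Phragmen-Lindelof barrier.\<close>

lemma Phragmen_Lindelof_sector:
  fixes K :: "complex \<Rightarrow> complex" and t C \<psi> :: real
  assumes hol: "K holomorphic_on {z. 0 < Re z}"
    and bnd: "\<And>z. 0 < Re z \<Longrightarrow> 0 \<le> Im z \<Longrightarrow> norm (K z) \<le> C * exp (t * (Re z)\<^sup>2)"
    and real: "\<And>x. 0 < x \<Longrightarrow> norm (K (of_real x)) \<le> C"
    and t: "0 < t" and C: "0 \<le> C"
    and \<psi>: "0 < \<psi>" "\<psi> < pi / 2"
    and w: "0 \<le> Re w" "0 \<le> Im w" "Im w \<le> \<psi>"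
  shows "norm (K (exp w)) * exp (- (t * cos \<psi> / (2 * sin \<psi>)) * (exp (2 * Re w) * sin (2 * Im w))) \<le> C * exp t"
proof -
  \<comment> \<open>Chosen so that \<delta> |z|^2 sin (2 \<psi>) = t (Re z)^2 on the ray arg z =
    \<psi>: growth and compensation cancel exactly there.\<close>
  define \<delta> where "\<delta> = t * cos \<psi> / (2 * sin \<psi>)"
  \<comment> \<open>The midpoint of 2 and pi/\<psi>. Being above 2 it beats the growth of
    \<open>K\<close>; being below pi/\<psi> it keeps the cosine in the barrier above the positive
    constant \<open>b\<close> on the whole sector.\<close>
  define \<alpha> where "\<alpha> = (2 + pi / \<psi>) / 2"
  define b where "b = cos (\<alpha> * \<psi> / 2)"
  let ?d = "\<lambda>w. exp (- \<delta> * (exp (2 * Re w) * sin (2 * Im w)))"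
  let ?e = "\<lambda>\<epsilon> w. exp (- \<epsilon> * (exp (\<alpha> * Re w) * cos (\<alpha> * (Im w - \<psi> / 2))))"
  have sc: "0 < sin \<psi>" "0 < cos \<psi>" using \<psi> by (auto intro!: sin_gt_zero cos_gt_zero_pi)
  have \<delta>: "0 < \<delta>" unfolding \<delta>_def using t sc by auto
  have \<alpha>: "2 < \<alpha>" using \<psi> by (simp add: \<alpha>_def field_simps)
  have a\<psi>: "\<alpha> * \<psi> / 2 = (2 * \<psi> + pi) / 4" using \<psi> by (simp add: \<alpha>_def field_simps)
  have b: "0 < b" unfolding b_def a\<psi> using \<psi> by (intro cos_gt_zero_pi) auto
  have cosb: "b \<le> cos (\<alpha> * (y - \<psi> / 2))" if "0 \<le> y" "y \<le> \<psi>" for y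
  proof -
    have "\<bar>\<alpha> * (y - \<psi> / 2)\<bar> \<le> \<alpha> * \<psi> / 2"
    proof -
      have "\<bar>y - \<psi> / 2\<bar> \<le> \<psi> / 2" using that by (auto simp: abs_le_iff field_simps)
      then show ?thesis using \<alpha> mult_left_mono[of "\<bar>y - \<psi> / 2\<bar>" "\<psi> / 2" \<alpha>] by (simp add: abs_mult)
    qed
    moreover have "\<alpha> * \<psi> / 2 \<le> pi" unfolding a\<psi> using \<psi> by simp
    ultimately have "cos (\<alpha> * \<psi> / 2) \<le> cos \<bar>\<alpha> * (y - \<psi> / 2)\<bar>"
      by (intro cos_monotone_0_pi_le) auto
    then show ?thesis by (simp add: b_def)
  qed
  have eps: "norm (K (exp w)) * ?d w *
      exp (- \<epsilon> * (exp (\<alpha> * Re w) * cos (\<alpha> * (Im w - \<psi> / 2)))) \<le> C * exp t" (is "?A * exp (- \<epsilon> * ?B) \<le> _")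
    if \<epsilon>: "0 < \<epsilon>" for \<epsilon>
  proof -
    define L where "L w = K (exp w) * exp (\<i> * of_real \<delta> * exp (2 * w)) *
        exp (- of_real \<epsilon> * exp (of_real \<alpha> * (w - \<i> * of_real (\<psi> / 2))))" for w
    have nL: "norm (L w) = norm (K (exp w)) * ?d w *
      exp (- \<epsilon> * (exp (\<alpha> * Re w) * cos (\<alpha> * (Im w - \<psi> / 2))))" for w
      by (simp add: L_def norm_mult Re_exp Im_exp)
    \<comment> \<open>The right edge of the rectangle is placed so far out that the barrier exponent
      \<epsilon> b exp (\<alpha> X) exceeds the growth exponent t exp (2 X).\<close>
    have "filterlim (\<lambda>X. \<epsilon> * b * exp ((\<alpha> - 2) * X)) at_top at_top"
      using \<epsilon> b \<alpha>
      by (intro filterlim_tendsto_pos_mult_at_top[OF tendsto_const] filterlim_compose[OF exp_at_top]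
            filterlim_tendsto_pos_mult_at_top[OF tendsto_const _ filterlim_ident]) auto
    then have "\<forall>\<^sub>F X in at_top. t \<le> \<epsilon> * b * exp ((\<alpha> - 2) * X)"
      by (simp add: filterlim_at_top)
    then have "\<forall>\<^sub>F X in at_top. t \<le> \<epsilon> * b * exp ((\<alpha> - 2) * X) \<and> Re w < X \<and> 0 < X"
      using eventually_gt_at_top[of "Re w"] eventually_gt_at_top[of 0] by eventually_elim auto
    then obtain X where X: "t \<le> \<epsilon> * b * exp ((\<alpha> - 2) * X)" "Re w < X" "0 < X"
      by (auto simp: eventually_at_top_linorder)
    have rp: "0 < Re (exp v)" if "0 \<le> Im v" "Im v \<le> \<psi>" for v
      using that \<psi> by (auto simp: Re_exp intro!: mult_pos_pos cos_gt_zero_pi)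
    have ip: "0 \<le> Im (exp v)" if "0 \<le> Im v" "Im v \<le> \<psi>" for v
      using that \<psi> by (auto simp: Im_exp intro!: mult_nonneg_nonneg sin_ge_zero)
    let ?S = "cbox 0 (Complex X \<psi>)"
    have holL: "L holomorphic_on ?S"
      unfolding L_def
      by (intro holomorphic_intros holomorphic_on_compose_gen[OF _ hol, unfolded o_def])
         (auto simp: in_cbox_complex_iff intro!: rp)
    have "norm (L w) \<le> C * exp t"
    proof (rule maximum_modulus_frontier[of L ?S])
      show "L holomorphic_on interior ?S" using holL interior_subset holomorphic_on_subset by blast
      show "continuous_on (closure ?S) L" using holomorphic_on_imp_continuous_on[OF holL] by simp
      show "w \<in> ?S" using w X by (auto simp: in_cbox_complex_iff)
      show "bounded ?S" by simp
      fix v assume v: "v \<in> frontier ?S"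
      then have "v \<in> ?S - box 0 (Complex X \<psi>)" by (simp add: frontier_cbox)
      then have r: "0 \<le> Re v" "Re v \<le> X" "0 \<le> Im v" "Im v \<le> \<psi>" and
        cs: "Re v = 0 \<or> Re v = X \<or> Im v = 0 \<or> Im v = \<psi>"
        by (auto simp: in_cbox_complex_iff in_box_complex_iff)
      have Kb: "norm (K (exp v)) \<le> C * exp (t * (exp (Re v) * cos (Im v))\<^sup>2)"
        using bnd[OF rp[OF r(3,4)] ip[OF r(3,4)]] by (simp add: Re_exp)
      have sn: "0 \<le> sin (2 * Im v)" using r \<psi> by (intro sin_ge_zero) auto
      have d1: "?d v \<le> 1"
        using sn \<delta> by auto
      have cb: "b \<le> cos (\<alpha> * (Im v - \<psi> / 2))" using cosb r by auto
      then have d2: "?e \<epsilon> v \<le> 1"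
        using b \<epsilon> by auto
      have et: "C \<le> C * exp t" using C t mult_left_mono[of 1 "exp t" C] by simp
      consider "Re v = 0" | "Re v = X" | "Im v = 0" | "Im v = \<psi>" using cs by blast
      then show "norm (L v) \<le> C * exp t"
      proof cases
        \<comment> \<open>On the left edge |z| = 1, so the growth bound is at most C exp t. This is
          the only edge that contributes the factor exp t; the other three give C.\<close>
        case 1
        have "t * (exp (Re v) * cos (Im v))\<^sup>2 \<le> t * 1"
          using 1 t by (intro mult_left_mono) (auto simp: abs_square_le_1)
        then have "C * exp (t * (exp (Re v) * cos (Im v))\<^sup>2) \<le> C * exp t"
          using C by (intro mult_left_mono) auto
        with Kb have "norm (K (exp v)) \<le> C * exp t" by linarith
        then have "norm (L v) \<le> (C * exp t) * 1 * 1" unfolding nL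
          using d1 d2 C by (intro mult_mono) auto
        then show ?thesis by simp
      next
        case 2
        have "(cos (Im v))\<^sup>2 \<le> 1" by (simp add: abs_square_le_1)
        then have "(exp X * cos (Im v))\<^sup>2 \<le> (exp X)\<^sup>2"
          unfolding power_mult_distrib by (intro mult_left_le) auto
        then have "C * exp (t * (exp (Re v) * cos (Im v))\<^sup>2) \<le> C * exp (t * (exp X)\<^sup>2)"
          using C t 2 by (intro mult_left_mono) (auto intro!: mult_left_mono)
        with Kb have "norm (K (exp v)) \<le> C * exp (t * (exp X)\<^sup>2)" by linarith
        moreover have "?e \<epsilon> v \<le> exp (- \<epsilon> * (exp (\<alpha> * X) * b))"
          using cb \<epsilon> 2 by (auto intro!: mult_left_mono)
        ultimately have "norm (L v) \<le> (C * exp (t * (exp X)\<^sup>2)) * 1 * exp (- \<epsilon> * (exp (\<alpha> * X) * b))" unfolding nL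
          using d1 C by (intro mult_mono) auto
        also have "\<dots> = C * exp (t * (exp X)\<^sup>2 - \<epsilon> * (exp (\<alpha> * X) * b))"
          by (simp add: exp_diff exp_minus divide_inverse)
        finally have nLX: "norm (L v) \<le> C * exp (t * (exp X)\<^sup>2 - \<epsilon> * (exp (\<alpha> * X) * b))" .
        have "t * (exp X)\<^sup>2 \<le> (\<epsilon> * b * exp ((\<alpha> - 2) * X)) * (exp X)\<^sup>2"
          using X by (intro mult_right_mono) auto
        then have "t * (exp X)\<^sup>2 - \<epsilon> * (exp (\<alpha> * X) * b) \<le> 0"
          by (simp add: power2_eq_square exp_add[symmetric] algebra_simps)
        then have "C * exp (t * (exp X)\<^sup>2 - \<epsilon> * (exp (\<alpha> * X) * b)) \<le> C * 1"
          using C by (intro mult_left_mono) auto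
        then show ?thesis using et nLX by simp
      next
        case 3
        then have "exp v = of_real (exp (Re v))"
          by (simp add: complex_eq_iff Re_exp Im_exp)
        then have "norm (K (exp v)) \<le> C" using real[of "exp (Re v)"] by simp
        then have "norm (L v) \<le> C * 1 * 1" unfolding nL
          using d1 d2 C by (intro mult_mono) auto
        then show ?thesis using et by simp
      next
        case 4
        have "t * (exp (Re v) * cos \<psi>)\<^sup>2 = \<delta> * (exp (2 * Re v) * sin (2 * \<psi>))"
          unfolding \<delta>_def sin_double exp_double power_mult_distrib using sc by (simp add: power2_eq_square)
        then have "norm (K (exp v)) * ?d v \<le> C"
          using Kb 4 by (simp add: exp_minus field_simps)
        then have "norm (L v) \<le> C * 1" unfolding nL
          using d2 C by (intro mult_mono) auto
        then show ?thesis using et by simp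
      qed
    qed
    then show ?thesis unfolding nL .
  qed
  have "?A \<le> C * exp t"
  proof (rule exp_limit_bound)
    show "((\<lambda>\<epsilon>. \<epsilon>) \<longlongrightarrow> (0::real)) (at_right 0)" by (rule tendsto_ident_at)
    show "\<forall>\<^sub>F \<epsilon> in at_right 0. ?A * exp (- \<epsilon> * ?B) \<le> C * exp t"
      using eventually_at_right_less[of 0] by eventually_elim (rule eps)
  qed simp
  then show ?thesis by (simp add: \<delta>_def)
qed

text \<open>Inside the unit disc the growth bound suffices. Elsewhere \<open>Ln z\<close> lies in
  the half strip of every sector with \<psi> close to pi/2, and the correction disappears as \<psi>
  tends to pi/2 because its coefficient contains cos \<psi>.\<close>

lemma Phragmen_Lindelof_quadrant:
  fixes K :: "complex \<Rightarrow> complex" and t C :: real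
  assumes hol: "K holomorphic_on {z. 0 < Re z}"
    and bnd: "\<And>z. 0 < Re z \<Longrightarrow> 0 \<le> Im z \<Longrightarrow> norm (K z) \<le> C * exp (t * (Re z)\<^sup>2)"
    and real: "\<And>x. 0 < x \<Longrightarrow> norm (K (of_real x)) \<le> C"
    and t: "0 < t" and z: "0 < Re z" "0 \<le> Im z"
  shows "norm (K z) \<le> C * exp t"
proof (cases "norm z \<le> 1")
  case True
  have C: "0 \<le> C" using real[of 1] by (auto intro: order_trans[OF norm_ge_zero])
  have "(Re z)\<^sup>2 \<le> 1" using True complex_Re_le_cmod[of z] z by (simp add: abs_square_le_1)
  then have "t * (Re z)\<^sup>2 \<le> t * 1" using t by (intro mult_left_mono) auto
  then have "C * exp (t * (Re z)\<^sup>2) \<le> C * exp t" using C by (intro mult_left_mono) auto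
  then show ?thesis using bnd[OF z] by linarith
next
  case False
  have C: "0 \<le> C" using real[of 1] by (auto intro: order_trans[OF norm_ge_zero])
  have nz: "z \<noteq> 0" using z by auto
  define w where "w = Ln z"
  have ew: "exp w = z" using nz by (simp add: w_def)
  have w: "0 \<le> Re w" "0 \<le> Im w" "Im w < pi / 2"
  proof -
    show "0 \<le> Re w" using False nz by (simp add: w_def)
    show "0 \<le> Im w" using Im_Ln_pos_le[OF nz] z by (simp add: w_def)
    show "Im w < pi / 2" using Re_Ln_pos_lt[OF nz] z by (simp add: w_def)
  qed
  have "\<forall>\<^sub>F \<psi> in at_left (pi / 2). norm (K z) * exp (- (t * cos \<psi> / (2 * sin \<psi>)) * (exp (2 * Re w) * sin (2 * Im w))) \<le> C * exp t"
    using eventually_at_left_real[OF w(3)]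
  proof eventually_elim
    case (elim \<psi>)
    then show ?case using Phragmen_Lindelof_sector[OF hol bnd real t C, of \<psi> w] w ew by auto
  qed
  moreover have "((\<lambda>\<psi>. t * cos \<psi> / (2 * sin \<psi>)) \<longlongrightarrow> t * cos (pi / 2) / (2 * sin (pi / 2))) (at_left (pi / 2))"
    by (intro tendsto_intros) simp
  then have "((\<lambda>\<psi>. t * cos \<psi> / (2 * sin \<psi>)) \<longlongrightarrow> 0) (at_left (pi / 2))" by simp
  ultimately show ?thesis
    using exp_limit_bound[of "\<lambda>\<psi>. t * cos \<psi> / (2 * sin \<psi>)" "at_left (pi / 2)"] by simp
qed

text \<open>Division by (1 + z)^N reduces to the quadrant: for Re z > 0 the moduli |1 + z| and 1 +
  |z| are comparable, whence the factor 2^N. On the imaginary axis the Gaussian factor is 1 and the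
  growth bound is already enough.\<close>

lemma Phragmen_Lindelof_halfplane:
  fixes H :: "complex \<Rightarrow> complex" and t C :: real
  assumes hol: "H holomorphic_on UNIV"
    and bnd: "\<And>z. norm (H z) \<le> C * (1 + norm z) ^ N * exp (t * (Re z)\<^sup>2)"
    and real: "\<And>x. 0 < x \<Longrightarrow> norm (H (of_real x)) \<le> C * (1 + x) ^ N"
    and t: "0 < t" and z: "0 \<le> Re z"
  shows "norm (H z) \<le> C * 2 ^ N * exp t * (1 + norm z) ^ N"
proof -
  have C: "0 \<le> C" using bnd[of 0] by (auto intro: order_trans[OF norm_ge_zero])
  have le2: "1 + norm v \<le> 2 * norm (1 + v)" if "0 < Re v" for v
  proof -
    have "(1 + norm v)\<^sup>2 \<le> 2 * (1 + (norm v)\<^sup>2)"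
      using sum_squares_bound[of 1 "norm v"] by (simp add: power2_eq_square algebra_simps)
    also have "\<dots> \<le> (2 * norm (1 + v))\<^sup>2" using that
      unfolding power_mult_distrib cmod_power2 by (simp add: power2_eq_square algebra_simps)
    finally show ?thesis by (rule power2_le_imp_le) simp
  qed
  have *: "norm (G z) \<le> C * 2 ^ N * exp t * (1 + norm z) ^ N"
    if "0 < Re z" "0 \<le> Im z" and hol: "G holomorphic_on UNIV"
    and bnd: "\<And>z. norm (G z) \<le> C * (1 + norm z) ^ N * exp (t * (Re z)\<^sup>2)"
    and real: "\<And>x. 0 < x \<Longrightarrow> norm (G (of_real x)) \<le> C * (1 + x) ^ N" for G z
  proof -
    define K where "K z = G z / (1 + z) ^ N" for z
    have K: "norm (K v) \<le> C * 2 ^ N * B" if "0 < Re v" "norm (G v) \<le> C * (1 + norm v) ^ N * B" "0 \<le> B" for v B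
    proof -
      have nz: "norm (1 + v) > 0" using le2[OF that(1)] norm_ge_zero[of v] by linarith
      have "norm (G v) \<le> C * (1 + norm v) ^ N * B" by (rule that)
      also have "\<dots> \<le> C * (2 * norm (1 + v)) ^ N * B"
        using C that(3) le2[OF that(1)] by (intro mult_right_mono mult_left_mono power_mono) auto
      finally have "norm (G v) \<le> (C * 2 ^ N * B) * norm (1 + v) ^ N"
        by (simp add: power_mult_distrib mult_ac)
      then show ?thesis using nz by (simp add: K_def norm_divide norm_power pos_divide_le_eq)
    qed
    have nz1: "1 + v \<noteq> 0" if "0 < Re v" for v using that by (auto simp: complex_eq_iff add_eq_0_iff)
    have "norm (K z) \<le> C * 2 ^ N * exp t"
    proof (rule Phragmen_Lindelof_quadrant[of K])
      show "K holomorphic_on {z. 0 < Re z}" unfolding K_def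
        by (intro holomorphic_intros holomorphic_on_subset[OF hol])
           (use nz1 in auto)
      show "norm (K v) \<le> C * 2 ^ N * exp (t * (Re v)\<^sup>2)" if "0 < Re v" for v
        using K[OF that bnd] by simp
      show "norm (K (of_real x)) \<le> C * 2 ^ N" if "0 < x" for x
        using K[of "of_real x" 1] real[OF that] that by simp
    qed (use that t in auto)
    moreover have "norm (G z) = norm (K z) * norm (1 + z) ^ N"
      using nz1[OF that(1)] by (simp add: K_def norm_divide norm_power)
    moreover have "norm (1 + z) ^ N \<le> (1 + norm z) ^ N"
      using norm_triangle_ineq[of 1 z] by (intro power_mono) auto
    ultimately show ?thesis using C by (simp add: mult_mono)
  qed
  consider "Re z = 0" | "0 < Re z" "0 \<le> Im z" | "0 < Re z" "Im z \<le> 0" using z by linarith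
  then show ?thesis
  proof cases
    case 1
    have "1 \<le> 2 ^ N * exp t" using t mult_mono[of 1 "2 ^ N" 1 "exp t"] by (simp del: exp_le_cancel_iff)
    then have "C * (1 + norm z) ^ N * 1 \<le> C * (1 + norm z) ^ N * (2 ^ N * exp t)"
      using C by (intro mult_left_mono) auto
    then show ?thesis using bnd[of z] 1 by (simp add: mult_ac)
  next
    case 2
    then show ?thesis by (rule *) (use hol bnd real in auto)
  next
    \<comment> \<open>Schwarz reflection z -> cnj (H (cnj z)) carries the lower quadrant to the
      upper one and preserves both bounds.\<close>
    case 3
    have "norm (cnj (H (cnj (cnj z)))) \<le> C * 2 ^ N * exp t * (1 + norm (cnj z)) ^ N"
    proof (rule *[of "cnj z" "\<lambda>z. cnj (H (cnj z))"])
      show "(\<lambda>z. cnj (H (cnj z))) holomorphic_on UNIV"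
        using holomorphic_on_compose_cnj_cnj[of H UNIV] hol by (simp add: o_def holomorphic_on_subset[OF hol])
      show "norm (cnj (H (cnj z))) \<le> C * (1 + norm z) ^ N * exp (t * (Re z)\<^sup>2)" for z
        using bnd[of "cnj z"] by simp
    qed (use 3 real in auto)
    then show ?thesis by simp
  qed
qed

text \<open>The half-plane bound for H(z) and for H(-z) yields polynomial growth in the whole plane,
  and Liouville's theorem applies.\<close>

lemma Phragmen_Lindelof_polynomial:
  fixes H :: "complex \<Rightarrow> complex" and t C :: real
  assumes hol: "H holomorphic_on UNIV"
    and bnd: "\<And>z. norm (H z) \<le> C * (1 + norm z) ^ N * exp (t * (Re z)\<^sup>2)"
    and real: "\<And>x. norm (H (of_real x)) \<le> C * (1 + \<bar>x\<bar>) ^ N"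
    and t: "0 < t"
  shows "\<exists>p. H = poly p"
proof -
  have C: "0 \<le> C" using bnd[of 0] by (auto intro: order_trans[OF norm_ge_zero])
  have *: "norm (H z) \<le> C * 2 ^ N * exp t * (1 + norm z) ^ N" for z
  proof (cases "0 \<le> Re z")
    case True
    have "norm (H (of_real x)) \<le> C * (1 + x) ^ N" if "0 < x" for x
      using real[of x] that by simp
    then show ?thesis by (rule Phragmen_Lindelof_halfplane[OF hol bnd _ t True])
  next
    case False
    have "norm (H (- (- z))) \<le> C * 2 ^ N * exp t * (1 + norm (- z)) ^ N"
    proof (rule Phragmen_Lindelof_halfplane[where H = "\<lambda>z. H (- z)"])
      show "(\<lambda>z. H (- z)) holomorphic_on UNIV"
        by (rule holomorphic_on_compose_gen[OF _ hol, unfolded o_def]) (auto intro!: holomorphic_intros)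
      show "norm (H (- v)) \<le> C * (1 + norm v) ^ N * exp (t * (Re v)\<^sup>2)" for v
        using bnd[of "- v"] by simp
      show "norm (H (- of_real x)) \<le> C * (1 + x) ^ N" if "0 < x" for x
        using real[of "- x"] that by simp
    qed (use False t in auto)
    then show ?thesis by simp
  qed
  have "H z = (\<Sum>k\<le>N. (deriv ^^ k) H 0 / fact k * z ^ k)" for z
  proof (rule Liouville_polynomial[OF hol])
    fix v :: complex assume "1 \<le> norm v"
    then have "(1 + norm v) ^ N \<le> (2 * norm v) ^ N" by (intro power_mono) auto
    then have "C * 2 ^ N * exp t * (1 + norm v) ^ N \<le> C * 2 ^ N * exp t * (2 * norm v) ^ N"
      using C by (intro mult_left_mono) auto
    then show "norm (H v) \<le> (C * 2 ^ N * exp t * 2 ^ N) * norm v ^ N"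
      using *[of v] by (simp add: power_mult_distrib mult_ac)
  qed
  then have "H = poly (\<Sum>k\<le>N. monom ((deriv ^^ k) H 0 / fact k) k)"
    by (simp add: fun_eq_iff poly_sum poly_monom)
  then show ?thesis by blast
qed

text \<open>The primitive \<open>H\<close> of h vanishing at 0 inherits a pointwise bound on the
  real axis from the integral bound, and it grows in the plane only by one factor 1 + |z| more than
  h. Hence \<open>H\<close> is a polynomial, and so is its derivative h.\<close>

lemma Phragmen_Lindelof_polynomial_integral:
  fixes h :: "complex \<Rightarrow> complex" and t C D :: real
  assumes hol: "h holomorphic_on UNIV"
    and bnd: "\<And>z. norm (h z) \<le> C * (1 + norm z) ^ N * exp (t * (Re z)\<^sup>2)"
    and even: "\<And>x. norm (h (- of_real x)) = norm (h (of_real x))"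
    and int: "\<And>x. 0 < x \<Longrightarrow> integral {0..x} (\<lambda>y. norm (h (of_real y))) \<le> D * (1 + x) ^ M"
    and t: "0 < t"
  shows "\<exists>p. h = poly p"
proof -
  have C: "0 \<le> C" using bnd[of 0] by (auto intro: order_trans[OF norm_ge_zero])
  obtain G where G: "\<And>z. (G has_field_derivative h z) (at z)"
    using holomorphic_starlike_primitive[of UNIV h "{}"] hol
    by (auto simp: holomorphic_on_imp_continuous_on holomorphic_on_def)
  define H where "H z = G z - G 0" for z
  have H: "(H has_field_derivative h z) (at z)" for z
    unfolding H_def by (auto intro!: derivative_eq_intros G)
  have H0: "H 0 = 0" by (simp add: H_def)
  have conth: "continuous_on S h" for S
    using hol holomorphic_on_imp_continuous_on holomorphic_on_subset by blast
  have pos: "norm (H' (of_real x)) \<le> integral {0..x} (\<lambda>y. norm (h' (of_real y)))"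
    if "\<And>z. (H' has_field_derivative h' z) (at z)" "H' 0 = 0" "0 < x" "continuous_on UNIV h'"
    for H' h' :: "complex \<Rightarrow> complex" and x :: real
  proof -
    have c: "continuous_on {0..x} (\<lambda>y. h' (of_real y))"
      by (rule continuous_on_compose2[OF that(4)]) (auto intro!: continuous_intros)
    have "((\<lambda>y. h' (of_real y)) has_integral (H' (of_real x) - H' (of_real 0))) {0..x}"
    proof (rule fundamental_theorem_of_calculus)
      show "((\<lambda>y. H' (of_real y)) has_vector_derivative h' (of_real y)) (at y within {0..x})" for y
        by (rule has_vector_derivative_real_field[OF that(1)])
    qed (use that(3) in simp)
    then have "H' (of_real x) = integral {0..x} (\<lambda>y. h' (of_real y))"
      using that(2) by (simp add: integral_unique)
    also have "norm \<dots> \<le> integral {0..x} (\<lambda>y. norm (h' (of_real y)))"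
      using c by (intro integral_norm_bound_integral integrable_continuous_real) (auto intro!: continuous_intros)
    finally show ?thesis .
  qed
  have D: "0 \<le> D"
  proof -
    have "0 \<le> integral {0..1} (\<lambda>y. norm (h (of_real y)))"
      by (rule integral_nonneg) (auto intro!: integrable_continuous_real continuous_intros continuous_on_compose2[OF conth[of UNIV]])
    then have "0 \<le> D * 2 ^ M" using int[of 1] by simp
    then show ?thesis using zero_le_mult_iff[of D "2 ^ M"] zero_less_power[of "2::real" M] by linarith
  qed
  have r1: "norm (H (of_real x)) \<le> D * (1 + \<bar>x\<bar>) ^ M" for x
  proof -
    consider "x = 0" | "0 < x" | "x < 0" by linarith
    then show ?thesis
    proof cases
      case 1 then show ?thesis using H0 D by simp
    next
      case 2 then show ?thesis using pos[OF H H0 _ conth, of x] int[of x] by simp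
    next
      \<comment> \<open>The negative axis is treated through the primitive - H(-z) of h(-z);
        \<open>even\<close> turns the resulting integral into the one that is bounded.\<close>
      case 3
      have "norm (- H (- of_real (- x))) \<le> integral {0..-x} (\<lambda>y. norm (h (- of_real y)))"
      proof (rule pos[of "\<lambda>z. - H (- z)" "\<lambda>z. h (- z)"])
        show "((\<lambda>z. - H (- z)) has_field_derivative h (- z)) (at z)" for z
          by (auto intro!: derivative_eq_intros DERIV_chain2[OF H])
        show "continuous_on UNIV (\<lambda>z. h (- z))"
          by (rule continuous_on_compose2[OF conth]) (auto intro!: continuous_intros)
      qed (use H0 3 in auto)
      then show ?thesis using int[of "- x"] 3 by (simp add: even)
    qed
  qed
  \<comment> \<open>Integration along the segment from 0 to z, on which both |v| and |Re v| are
    largest at the endpoint z.\<close>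
  have b1: "norm (H z) \<le> C * (1 + norm z) ^ Suc N * exp (t * (Re z)\<^sup>2)" for z
  proof -
    have "norm (H z - H 0) \<le> (C * (1 + norm z) ^ N * exp (t * (Re z)\<^sup>2)) * norm (z - 0)"
    proof (rule field_differentiable_bound[of "closed_segment 0 z"])
      show "(H has_field_derivative h v) (at v within closed_segment 0 z)" for v
        by (rule has_field_derivative_at_within[OF H])
      fix v assume "v \<in> closed_segment 0 z"
      then obtain u where u: "0 \<le> u" "u \<le> 1" "v = of_real u * z"
        by (auto simp: in_segment scaleR_conv_of_real)
      have "norm v \<le> norm z" using u by (simp add: norm_mult mult_left_le_one_le)
      moreover have "(Re v)\<^sup>2 \<le> (Re z)\<^sup>2" using u
        by (simp add: power_mult_distrib mult_left_le_one_le power_le_one)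
      ultimately have "C * (1 + norm v) ^ N * exp (t * (Re v)\<^sup>2) \<le> C * (1 + norm z) ^ N * exp (t * (Re z)\<^sup>2)"
        using C t by (intro mult_mono power_mono) auto
      then show "norm (h v) \<le> C * (1 + norm z) ^ N * exp (t * (Re z)\<^sup>2)" using bnd[of v] by linarith
    qed auto
    also have "\<dots> \<le> (C * (1 + norm z) ^ N * exp (t * (Re z)\<^sup>2)) * (1 + norm z)"
      using C by (intro mult_left_mono) auto
    finally show ?thesis by (simp add: H0 mult_ac)
  qed
  have "\<exists>p. H = poly p"
  proof (rule Phragmen_Lindelof_polynomial[of H "C + D" "Suc N + M" t])
    show "H holomorphic_on UNIV" using H by (auto simp: holomorphic_on_def field_differentiable_def)
    show "norm (H z) \<le> (C + D) * (1 + norm z) ^ (Suc N + M) * exp (t * (Re z)\<^sup>2)" for z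
      using C D by (intro order_trans[OF b1] mult_right_mono mult_mono power_increasing) auto
    show "norm (H (of_real x)) \<le> (C + D) * (1 + \<bar>x\<bar>) ^ (Suc N + M)" for x
      using C D by (intro order_trans[OF r1] mult_mono power_increasing) auto
  qed (rule t)
  then obtain p where p: "H = poly p" by blast
  have "h z = poly (pderiv p) z" for z
    using DERIV_unique[OF H[of z]] poly_DERIV[of p z] p by metis
  then show ?thesis by blast
qed

section \<open>Homogeneous harmonic polynomials\<close>

definition dird :: "'a::euclidean_space \<Rightarrow> ('a \<Rightarrow> real) \<Rightarrow> 'a \<Rightarrow> real" where
  "dird b f x = frechet_derivative f (at x) b"

text \<open>The real counterpart of \<open>laplacian\<close>, built on Frechet derivatives so that
  product rule and linearity in the direction are available; \<open>laplacian_eq_lap\<close>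
  connects the two.\<close>

definition lap :: "('a::euclidean_space \<Rightarrow> real) \<Rightarrow> 'a \<Rightarrow> real" where
  "lap f x = (\<Sum>b\<in>Basis. dird b (dird b f) x)"

definition homog :: "nat \<Rightarrow> ('a::euclidean_space \<Rightarrow> real) \<Rightarrow> bool" where
  "homog m f \<longleftrightarrow> real_polynomial_function f \<and> (\<forall>c x. f (c *\<^sub>R x) = c ^ m * f x)"

lemma homogD: "homog m f \<Longrightarrow> real_polynomial_function f" "homog m f \<Longrightarrow> f (c *\<^sub>R x) = c ^ m * f x"
  by (auto simp: homog_def)

lemma rpoly_has_derivative:
  assumes "real_polynomial_function f"
  shows "(f has_derivative (\<lambda>v. dird v f x)) (at x)"
  unfolding dird_def
  using frechet_derivative_works[of f "at x"] differentiable_at_real_polynomial_function[OF assms]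
  by (simp add: eta_contract_eq)

lemma dird_eqI: "(f has_derivative f') (at x) \<Longrightarrow> dird b f x = f' b"
  unfolding dird_def by (metis frechet_derivative_at)

lemma dird_const: "dird b (\<lambda>x. c) = (\<lambda>x. 0)"
  by (intro ext dird_eqI has_derivative_const)

lemma dird_add:
  "real_polynomial_function f \<Longrightarrow> real_polynomial_function g \<Longrightarrow>
   dird b (\<lambda>x. f x + g x) = (\<lambda>x. dird b f x + dird b g x)"
  by (rule ext, rule dird_eqI, (rule derivative_eq_intros rpoly_has_derivative refl | assumption)+)

lemma dird_mult:
  "real_polynomial_function f \<Longrightarrow> real_polynomial_function g \<Longrightarrow>
   dird b (\<lambda>x. f x * g x) = (\<lambda>x. f x * dird b g x + dird b f x * g x)"
  by (rule ext, rule dird_eqI, (rule derivative_eq_intros rpoly_has_derivative refl | assumption)+)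

lemma dird_cmult:
  "real_polynomial_function f \<Longrightarrow> dird b (\<lambda>x. c * f x) = (\<lambda>x. c * dird b f x)"
  using dird_mult[of "\<lambda>x. c" f b] by (simp add: dird_const real_polynomial_function.intros)

lemma dird_linear: "bounded_linear f \<Longrightarrow> dird b f = (\<lambda>x. f b)"
  by (rule ext, rule dird_eqI, rule bounded_linear_imp_has_derivative)

lemma rpoly_dird [intro]: "real_polynomial_function f \<Longrightarrow> real_polynomial_function (dird b f)"
proof (induction rule: real_polynomial_function.induct)
  case (linear f)
  then show ?case by (simp add: dird_linear real_polynomial_function.intros)
next
  case (const c)
  then show ?case by (simp add: dird_const real_polynomial_function.intros)
next
  case (add f g)
  then show ?case by (simp add: dird_add real_polynomial_function.intros)
next
  case (mult f g)
  then show ?case by (simp add: dird_mult real_polynomial_function.intros real_polynomial_function.intros)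
qed

lemma rpoly_inner [intro]: "real_polynomial_function (\<lambda>x. x \<bullet> b)"
  by (rule real_polynomial_function.intros) (rule bounded_linear_inner_left)

lemma rpoly_normsq [intro]: "real_polynomial_function (\<lambda>x::'a::euclidean_space. (norm x)\<^sup>2)"
  unfolding power2_norm_eq_inner euclidean_inner[of x x for x]
  by (intro real_polynomial_function_sum real_polynomial_function.intros rpoly_inner finite_Basis)

lemmas rpoly_add = real_polynomial_function.intros(3)
lemmas rpoly_mult = real_polynomial_function.intros(4)
lemmas rpoly_const = real_polynomial_function.intros(2)

lemma rpoly_cont: "real_polynomial_function f \<Longrightarrow> continuous_on S f"
  by (simp add: continuous_on_polymonial_function real_polynomial_function_eq)

lemma dird_normsq: "dird b (\<lambda>x. (norm x)\<^sup>2) = (\<lambda>x. 2 * (x \<bullet> b))"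
  unfolding power2_norm_eq_inner
  by (rule ext, rule dird_eqI) (auto intro!: derivative_eq_intros simp: inner_commute)

lemma lap_add:
  "real_polynomial_function f \<Longrightarrow> real_polynomial_function g \<Longrightarrow>
   lap (\<lambda>x. f x + g x) = (\<lambda>x. lap f x + lap g x)"
  by (simp add: lap_def dird_add rpoly_dird sum.distrib fun_eq_iff)

lemma lap_cmult:
  "real_polynomial_function f \<Longrightarrow> lap (\<lambda>x. c * f x) = (\<lambda>x. c * lap f x)"
  by (simp add: lap_def dird_cmult rpoly_dird sum_distrib_left fun_eq_iff)

lemma dird_along:
  assumes "real_polynomial_function f"
  shows "((\<lambda>h. f (x + h *\<^sub>R b)) has_real_derivative dird b f (x + h *\<^sub>R b)) (at h)"
proof -
  have "linear (\<lambda>v. dird v f y)" for y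
    using rpoly_has_derivative[OF assms] has_derivative_linear by blast
  then have 1: "dird (c *\<^sub>R v) f y = c * dird v f y" for c v y
    using linear_scale[of "\<lambda>v. dird v f y" c v] by simp
  have "((\<lambda>h. f (x + h *\<^sub>R b)) has_derivative (\<lambda>c. dird (c *\<^sub>R b) f (x + h *\<^sub>R b))) (at h)"
    by (rule has_derivative_compose[of "\<lambda>h. x + h *\<^sub>R b" "\<lambda>c. c *\<^sub>R b", OF _ rpoly_has_derivative[OF assms]])
       (auto intro!: derivative_eq_intros)
  then show ?thesis by (simp add: has_field_derivative_def 1 mult.commute[of _ "dird b f _"])
qed

text \<open>Euler's identity: differentiate f((1 + h) x) = (1 + h)^m f(x) at h = 0.\<close>

lemma euler_homog:
  assumes "homog m f"
  shows "(\<Sum>b\<in>Basis. (x \<bullet> b) * dird b f x) = m * f x"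
proof -
  have f: "real_polynomial_function f" using assms by (rule homogD)
  have lin: "linear (\<lambda>v. dird v f y)" for y
    using rpoly_has_derivative[OF f] has_derivative_linear by blast
  have "dird x f x = dird (\<Sum>b\<in>Basis. (x \<bullet> b) *\<^sub>R b) f x" by (simp add: euclidean_representation)
  also have "\<dots> = (\<Sum>b\<in>Basis. (x \<bullet> b) * dird b f x)"
    by (subst linear_sum[OF lin]) (simp only: linear_scale[OF lin] real_scaleR_def)
  finally have 1: "dird x f x = (\<Sum>b\<in>Basis. (x \<bullet> b) * dird b f x)" .
  have eq: "(\<lambda>h. f (x + h *\<^sub>R x)) = (\<lambda>h. (1 + h) ^ m * f x)"
    using homogD(2)[OF assms, of "1 + _" x] by (simp add: scaleR_add_left)
  have "((\<lambda>h. f (x + h *\<^sub>R x)) has_real_derivative dird x f x) (at 0)"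
    using dird_along[OF f, of x x 0] by simp
  moreover have "((\<lambda>h. f (x + h *\<^sub>R x)) has_real_derivative m * f x) (at 0)"
    unfolding eq by (auto intro!: derivative_eq_intros)
  ultimately show ?thesis using 1 DERIV_unique by metis
qed

text \<open>In the product rule the cross terms add up to 4 times the Euler sum of g, which is 4 d
  g, and the Laplacian of |x|^2 contributes 2 n g with n the dimension.\<close>

lemma lap_normsq_mult:
  fixes g :: "'a::euclidean_space \<Rightarrow> real"
  assumes "homog d g"
  shows "lap (\<lambda>x::'a::euclidean_space. (norm x)\<^sup>2 * g x)
          = (\<lambda>x. (norm x)\<^sup>2 * lap g x + (4 * d + 2 * DIM('a)) * g x)"
proof
  fix x :: 'a
  have g: "real_polynomial_function g" using assms by (rule homogD)
  have 2: "dird b (\<lambda>x. 2 * (x \<bullet> b)) = (\<lambda>x. 2)" if "b \<in> Basis" for b :: 'a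
    using that dird_cmult[OF rpoly_inner, of b 2 b] by (simp add: dird_linear bounded_linear_inner_left)
  have "dird b (dird b (\<lambda>x. (norm x)\<^sup>2 * g x)) x =
      (norm x)\<^sup>2 * dird b (dird b g) x + 4 * ((x \<bullet> b) * dird b g x) + 2 * g x"
    if "b \<in> Basis" for b
  proof -
    have r: "real_polynomial_function (\<lambda>x::'a. 2 * (x \<bullet> b))"
      by (intro rpoly_mult rpoly_const rpoly_inner)
    have "dird b (dird b (\<lambda>x. (norm x)\<^sup>2 * g x)) = dird b (\<lambda>x. (norm x)\<^sup>2 * dird b g x + (2 * (x \<bullet> b)) * g x)"
      by (subst dird_mult[OF rpoly_normsq g]) (simp add: dird_normsq)
    also have "\<dots> = (\<lambda>x. ((norm x)\<^sup>2 * dird b (dird b g) x + 2 * (x \<bullet> b) * dird b g x)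
        + (2 * (x \<bullet> b) * dird b g x + 2 * g x))"
      by (subst dird_add, (intro rpoly_mult rpoly_dird rpoly_normsq g r)+)
         (simp only: dird_mult[OF rpoly_normsq rpoly_dird[OF g]] dird_mult[OF r g] dird_normsq 2[OF that])
    finally show ?thesis by (simp add: algebra_simps)
  qed
  then have "lap (\<lambda>x. (norm x)\<^sup>2 * g x) x = (\<Sum>b\<in>Basis. (norm x)\<^sup>2 * dird b (dird b g) x
       + 4 * ((x \<bullet> b) * dird b g x) + 2 * g x)"
    unfolding lap_def by simp
  also have "\<dots> = (norm x)\<^sup>2 * lap g x + 4 * (\<Sum>b\<in>Basis. (x \<bullet> b) * dird b g x) + 2 * DIM('a) * g x"
    by (simp add: lap_def sum.distrib sum_distrib_left)
  finally show "lap (\<lambda>x. (norm x)\<^sup>2 * g x) x = (norm x)\<^sup>2 * lap g x + (4 * d + 2 * DIM('a)) * g x"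
    by (simp add: euler_homog[OF assms] algebra_simps)
qed

section \<open>Decomposition of homogeneous polynomials into harmonic ones\<close>

lemma homog_mult: "homog m f \<Longrightarrow> homog k g \<Longrightarrow> homog (m + k) (\<lambda>x. f x * g x)"
  by (auto simp: homog_def power_add intro: rpoly_mult)

lemma homog_normsq_mult: "homog d g \<Longrightarrow> homog (2 + d) (\<lambda>x. (norm x)\<^sup>2 * g x)"
  by (rule homog_mult) (auto simp: homog_def power_mult_distrib)

lemma homog_normpow_mult: "homog d g \<Longrightarrow> homog (2 * j + d) (\<lambda>x. (norm x) ^ (2 * j) * g x)"
proof (induction j)
  case (Suc j)
  from homog_normsq_mult[OF Suc.IH[OF Suc.prems]] show ?case
    by (simp add: power2_eq_square mult.assoc)
qed simp

text \<open>Iterating \<open>lap_normsq_mult\<close> adds a positive constant at each stage, so the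
  factor never vanishes. This nonvanishing is what allows the Laplacian to be inverted on such
  products.\<close>

lemma lap_normpow_mult:
  fixes H :: "'a::euclidean_space \<Rightarrow> real"
  assumes "homog d H" "\<And>x. lap H x = 0"
  shows "\<exists>c>0. lap (\<lambda>x. norm x ^ (2 * Suc j) * H x) = (\<lambda>x. c * (norm x ^ (2 * j) * H x))"
proof (induction j)
  case 0
  have "0 < real (4 * d + 2 * DIM('a))" by (subst of_nat_0_less_iff) simp
  moreover have "lap (\<lambda>x. norm x ^ (2 * Suc 0) * H x) = (\<lambda>x. real (4 * d + 2 * DIM('a)) * (norm x ^ (2 * 0) * H x))"
    using lap_normsq_mult[OF assms(1)] assms(2) by simp
  ultimately show ?case by blast
next
  case (Suc j)
  then obtain c where c: "c > 0" "lap (\<lambda>x. norm x ^ (2 * Suc j) * H x) = (\<lambda>x. c * (norm x ^ (2 * j) * H x))"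
    by blast
  have eq: "(\<lambda>x. norm x ^ (2 * Suc (Suc j)) * H x) = (\<lambda>x. (norm x)\<^sup>2 * (norm x ^ (2 * Suc j) * H x))"
    by (simp add: power2_eq_square mult.assoc)
  show ?case unfolding eq lap_normsq_mult[OF homog_normpow_mult[OF assms(1)]] c(2)
    using c(1) by (intro exI[of _ "c + (4 * (2 * Suc j + d) + 2 * DIM('a))"])
      (simp add: algebra_simps power2_eq_square add_pos_nonneg fun_eq_iff)
qed

text \<open>The Fischer decomposition of a homogeneous polynomial of degree m. Adding one summand at
  a time replaces indexed finite sums by rule induction; repeated degrees are harmless.\<close>

inductive harmonic_sum :: "nat \<Rightarrow> ('a::euclidean_space \<Rightarrow> real) \<Rightarrow> bool" where
  zero: "harmonic_sum m (\<lambda>x. 0)"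
| add: "harmonic_sum m f \<Longrightarrow> homog d H \<Longrightarrow> (\<forall>x. lap H x = 0) \<Longrightarrow> d + 2 * j = m \<Longrightarrow>
    harmonic_sum m (\<lambda>x. f x + norm x ^ (2 * j) * H x)"

lemma homog_add: "homog m f \<Longrightarrow> homog m g \<Longrightarrow> homog m (\<lambda>x. f x + g x)"
  by (auto simp: homog_def algebra_simps intro: rpoly_add)

lemma homog_cmult: "homog m f \<Longrightarrow> homog m (\<lambda>x. c * f x)"
  by (auto simp: homog_def algebra_simps intro: rpoly_mult rpoly_const)

lemma harmonic_sum_homog: "harmonic_sum m f \<Longrightarrow> homog m f"
proof (induction rule: harmonic_sum.induct)
  case (zero m)
  then show ?case by (simp add: homog_def rpoly_const)
next
  case (add m f d H j)
  have "homog m (\<lambda>x. norm x ^ (2 * j) * H x)"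
    using homog_normpow_mult[OF add(2), of j] add(4) by (simp add: add.commute)
  then show ?case by (rule homog_add[OF add.IH])
qed

text \<open>Raising the power of |x|^2 in a summand by one and dividing by the constant of
  \<open>lap_normpow_mult\<close> gives a preimage of that summand.\<close>

lemma harmonic_sum_lap_surj:
  "harmonic_sum m f \<Longrightarrow> \<exists>g. harmonic_sum (m + 2) g \<and> lap g = f"
proof (induction rule: harmonic_sum.induct)
  case (zero m)
  have "lap (\<lambda>x::'a. 0::real) = (\<lambda>x. 0)" by (simp add: lap_def dird_const fun_eq_iff)
  then show ?case using harmonic_sum.zero by blast
next
  case (add m f d H j)
  then obtain g where g: "harmonic_sum (m + 2) g" "lap g = f" by blast
  obtain c where c: "c > 0" "lap (\<lambda>x. norm x ^ (2 * Suc j) * H x) = (\<lambda>x. c * (norm x ^ (2 * j) * H x))"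
    using lap_normpow_mult add by blast
  let ?H = "\<lambda>x. inverse c * H x"
  have H: "homog d ?H" using add homog_cmult by blast
  have "lap ?H x = 0" for x using lap_cmult[OF homogD(1)[OF add(2)]] add(3) by simp
  then have 1: "harmonic_sum (m + 2) (\<lambda>x. g x + norm x ^ (2 * Suc j) * ?H x)"
    using add(4) by (intro harmonic_sum.add[OF g(1) H]) auto
  have eq: "(\<lambda>x. g x + norm x ^ (2 * Suc j) * ?H x) = (\<lambda>x. g x + inverse c * (norm x ^ (2 * Suc j) * H x))"
    by (intro ext) (simp only: mult_ac)
  have p: "real_polynomial_function (\<lambda>x. norm x ^ (2 * Suc j) * H x)"
    using homogD(1)[OF homog_normpow_mult[OF add(2)]] .
  have "lap (\<lambda>x. g x + inverse c * (norm x ^ (2 * Suc j) * H x))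
      = (\<lambda>x. lap g x + inverse c * lap (\<lambda>x. norm x ^ (2 * Suc j) * H x) x)"
    by (subst lap_add[OF homogD(1)[OF harmonic_sum_homog[OF g(1)]] rpoly_mult[OF rpoly_const p]])
       (simp only: lap_cmult[OF p])
  also have "\<dots> = (\<lambda>x. f x + norm x ^ (2 * j) * H x)"
    unfolding c(2) g(2) mult.assoc[symmetric] using c(1) by simp
  finally show ?case using 1 unfolding eq by blast
qed

text \<open>Used for the scaling factor 0 in \<open>homog_dird\<close>, where division by the factor
  is impossible.\<close>

lemma continuous_eq_at_0:
  fixes f g :: "real \<Rightarrow> real"
  assumes "continuous_on UNIV f" "continuous_on UNIV g" "\<And>c. c \<noteq> 0 \<Longrightarrow> f c = g c"
  shows "f 0 = g 0"
proof -
  have "f \<midarrow>0\<rightarrow> f 0" "g \<midarrow>0\<rightarrow> g 0" using assms(1,2) by (auto simp: continuous_on_def)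
  moreover have "f \<midarrow>0\<rightarrow> g 0"
    using \<open>g \<midarrow>0\<rightarrow> g 0\<close> by (rule Lim_transform_eventually) (auto simp: eventually_at_filter assms(3))
  ultimately show ?thesis using LIM_unique by blast
qed

text \<open>Differentiating f(c x + h c b) = c^(m+1) f(x + h b) in h produces one factor c on the
  left, which cancels for c \<noteq> 0.\<close>

lemma homog_dird:
  assumes "homog (Suc m) f"
  shows "homog m (dird b f)"
proof -
  have f: "real_polynomial_function f" using assms by (rule homogD)
  have nz: "dird b f (c *\<^sub>R x) = c ^ m * dird b f x" if "c \<noteq> 0" for c x
  proof -
    have "((\<lambda>h. f (c *\<^sub>R x + h *\<^sub>R (c *\<^sub>R b))) has_real_derivative dird (c *\<^sub>R b) f (c *\<^sub>R x)) (at 0)"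
      using dird_along[OF f, of "c *\<^sub>R x" "c *\<^sub>R b" 0] by simp
    also have "(\<lambda>h. f (c *\<^sub>R x + h *\<^sub>R (c *\<^sub>R b))) = (\<lambda>h. c ^ Suc m * f (x + h *\<^sub>R b))"
      using homogD(2)[OF assms, of c "x + _ *\<^sub>R b"] by (simp add: algebra_simps)
    finally have "((\<lambda>h. c ^ Suc m * f (x + h *\<^sub>R b)) has_real_derivative dird (c *\<^sub>R b) f (c *\<^sub>R x)) (at 0)" .
    moreover have "((\<lambda>h. c ^ Suc m * f (x + h *\<^sub>R b)) has_real_derivative c ^ Suc m * dird b f x) (at 0)"
      using dird_along[OF f, of x b 0] by (intro DERIV_cmult) simp
    moreover have "dird (c *\<^sub>R b) f (c *\<^sub>R x) = c * dird b f (c *\<^sub>R x)"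
      using linear_scale[OF has_derivative_linear[OF rpoly_has_derivative[OF f]]] by simp
    ultimately have "c * dird b f (c *\<^sub>R x) = c ^ Suc m * dird b f x"
      using DERIV_unique by metis
    then show ?thesis using that by simp
  qed
  have "dird b f (c *\<^sub>R x) = c ^ m * dird b f x" for c x
  proof (cases "c = 0")
    case True
    have "continuous_on UNIV (\<lambda>c. dird b f (c *\<^sub>R x))"
      by (rule continuous_on_compose2[OF rpoly_cont[OF rpoly_dird[OF f], of UNIV]])
         (auto intro!: continuous_intros)
    moreover have "continuous_on UNIV (\<lambda>c. c ^ m * dird b f x)" by (intro continuous_intros)
    ultimately have "dird b f (0 *\<^sub>R x) = 0 ^ m * dird b f x"
      by (rule continuous_eq_at_0) (rule nz)
    then show ?thesis using True by simp
  qed (rule nz)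
  then show ?thesis using rpoly_dird[OF f] by (auto simp: homog_def)
qed

lemma homog_0_dird:
  assumes "homog 0 f" shows "dird b f = (\<lambda>x. 0)"
proof -
  have "f x = f 0" for x using homogD(2)[OF assms, of 0 x] by simp
  then have "f = (\<lambda>x. f 0)" by blast
  then show ?thesis using dird_const by metis
qed

lemma homog_lap:
  assumes "homog (m + 2) f" shows "homog m (lap f)"
proof -
  have "homog m (dird b (dird b f))" for b
    using assms by (intro homog_dird) simp
  note * = this
  have "homog m (\<lambda>x. \<Sum>b\<in>I. dird b (dird b f) x)" if "finite I" for I
    using that by (induction I rule: finite_induct) (auto intro: homog_add * simp: homog_def[of _ "\<lambda>x. 0"] rpoly_const)
  then show ?thesis unfolding lap_def[abs_def] by simp
qed

text \<open>Induction on the degree: the Laplacian of f has degree m - 2, hence is a harmonic sum,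
  hence equals the Laplacian of some harmonic sum g. Then f - g is harmonic and is itself an
  admissible summand with j = 0. In degrees 0 and 1 the Laplacian vanishes and g = 0 works.\<close>

theorem homog_harmonic_sum:
  "homog m f \<Longrightarrow> harmonic_sum m f"
proof (induction m arbitrary: f rule: less_induct)
  case (less m)
  have *: "harmonic_sum m f" if "harmonic_sum m g" "lap g = lap f" for g
  proof -
    have "homog m (\<lambda>x. f x + (-1) * g x)"
      using harmonic_sum_homog[OF that(1)] less.prems by (intro homog_add homog_cmult)
    moreover have "lap (\<lambda>x. f x + (-1) * g x) = (\<lambda>x. 0)"
      using homogD(1)[OF less.prems] homogD(1)[OF harmonic_sum_homog[OF that(1)]] that(2)
      lap_cmult[of g "-1"]
      by (subst lap_add) (auto intro!: rpoly_mult rpoly_const simp del: mult_minus1)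
    ultimately have "harmonic_sum m (\<lambda>x. g x + norm x ^ (2 * 0) * (f x + (-1) * g x))"
      using that(1) by (intro harmonic_sum.add) (auto simp: fun_eq_iff)
    then show ?thesis by simp
  qed
  consider "m = 0" | "m = Suc 0" | m' where "m = m' + 2"
    by (metis One_nat_def Suc_1 add.commute add_2_eq_Suc old.nat.exhaust)
  then show ?case
  proof cases
    case 3
    then have "harmonic_sum m' (lap f)" using homog_lap[of m' f] less by simp
    then obtain g where "harmonic_sum m g" "lap g = lap f"
      using harmonic_sum_lap_surj 3 by blast
    then show ?thesis by (rule *)
  next
    case 1
    then have "lap f = (\<lambda>x. 0)" using less.prems by (simp add: lap_def[abs_def] homog_0_dird dird_const)
    then show ?thesis by (intro *[OF harmonic_sum.zero]) (simp add: lap_def dird_const fun_eq_iff)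
  next
    case 2
    then have "homog 0 (dird b f)" for b using less.prems homog_dird by blast
    then have "lap f = (\<lambda>x. 0)" by (simp add: lap_def[abs_def] homog_0_dird)
    then show ?thesis by (intro *[OF harmonic_sum.zero]) (simp add: lap_def dird_const fun_eq_iff)
  qed
qed

text \<open>The grading of polynomials by degree. Closure under sums and products matches the
  generation of \<open>real_polynomial_function\<close>, so that every polynomial is
  reached.\<close>

inductive homog_sum :: "('a::euclidean_space \<Rightarrow> real) \<Rightarrow> bool" where
  zero: "homog_sum (\<lambda>x. 0)"
| add: "homog_sum f \<Longrightarrow> homog m h \<Longrightarrow> homog_sum (\<lambda>x. f x + h x)"

lemma homog_sum_add: "homog_sum f \<Longrightarrow> homog_sum g \<Longrightarrow> homog_sum (\<lambda>x. f x + g x)"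
  by (rotate_tac, induction g rule: homog_sum.induct) (auto simp flip: add.assoc intro: homog_sum.add)

lemma homog_homog_sum: "homog m f \<Longrightarrow> homog_sum f"
  using homog_sum.add[OF homog_sum.zero] by simp

lemma homog_sum_mult_homog: "homog_sum f \<Longrightarrow> homog m h \<Longrightarrow> homog_sum (\<lambda>x. f x * h x)"
  by (induction f rule: homog_sum.induct)
     (auto simp: distrib_right intro: homog_sum.intros homog_mult)

lemma homog_sum_mult: "homog_sum f \<Longrightarrow> homog_sum g \<Longrightarrow> homog_sum (\<lambda>x. f x * g x)"
  by (rotate_tac, induction g rule: homog_sum.induct)
     (auto simp: distrib_left intro: homog_sum.intros homog_sum_add homog_sum_mult_homog)

lemma rpoly_homog_sum: "real_polynomial_function f \<Longrightarrow> homog_sum f"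
proof (induction rule: real_polynomial_function.induct)
  case (linear f)
  then have "homog 1 f"
    by (auto simp: homog_def real_polynomial_function.intros linear_scale bounded_linear.linear)
  then show ?case by (rule homog_homog_sum)
next
  case (const c)
  have "homog 0 (\<lambda>x::'a. c)" by (simp add: homog_def rpoly_const)
  then show ?case by (rule homog_homog_sum)
qed (simp_all add: homog_sum_add homog_sum_mult)

section \<open>Polar coordinates\<close>

text \<open>The sigma-algebra of \<open>sphere_measure\<close> is the trace of the Borel sets.
  Through this inclusion, integrands that are Borel on the whole space become measurable on the
  sphere.\<close>

lemma borel_measurable_sphere: "(\<lambda>x. x) \<in> sphere_measure \<rightarrow>\<^sub>M borel"
  by (subst measurable_cong_sets[OF sets_sphere_measure refl]) (rule measurable_restrict_space1, simp)

lemma borel_measurable_sphereI: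
  "f \<in> borel_measurable borel \<Longrightarrow> f \<in> borel_measurable sphere_measure"
  using measurable_compose[OF borel_measurable_sphere] .

lemma measurable_to_sphere: "f \<in> N \<rightarrow>\<^sub>M sphere_measure \<Longrightarrow> f \<in> N \<rightarrow>\<^sub>M borel"
  using measurable_compose[OF _ borel_measurable_sphere] .

lemma nn_integral_sphere:
  fixes u :: "'a::euclidean_space \<Rightarrow> ennreal"
  assumes [measurable]: "u \<in> borel_measurable borel"
  shows "(\<integral>\<^sup>+\<omega>. u \<omega> \<partial>sphere_measure) =
    of_nat DIM('a) * (\<integral>\<^sup>+x. indicator (cball 0 1 - {0}) x * u (x /\<^sub>R norm x) \<partial>lborel)"
proof -
  let ?R = "restrict_space lborel (cball 0 1 - {0::'a})"
  have meas: "(\<lambda>x. x /\<^sub>R norm x) \<in> measurable ?R (restrict_space borel (sphere 0 1))"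
    by (rule measurable_restrict_space2) (auto simp: space_restrict_space intro!: measurable_restrict_space1)
  have u: "u \<in> borel_measurable (restrict_space borel (sphere 0 1))"
    by (rule measurable_restrict_space1) simp
  have "(\<integral>\<^sup>+\<omega>. u \<omega> \<partial>sphere_measure) = of_nat DIM('a) * (\<integral>\<^sup>+x. u (x /\<^sub>R norm x) \<partial>?R)"
    unfolding sphere_measure_def using u
    by (subst nn_integral_scale_measure) (simp_all add: nn_integral_distr[OF meas])
  also have "(\<integral>\<^sup>+x. u (x /\<^sub>R norm x) \<partial>?R) = (\<integral>\<^sup>+x. indicator (cball 0 1 - {0}) x * u (x /\<^sub>R norm x) \<partial>lborel)"
    by (subst nn_integral_restrict_space) (auto simp: mult.commute)
  finally show ?thesis .
qed

lemma finite_measure_sphere: "finite_measure (sphere_measure :: 'a::euclidean_space measure)"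
proof (rule finite_measureI)
  have "emeasure (sphere_measure :: 'a measure) (space sphere_measure) = (\<integral>\<^sup>+x. 1 \<partial>(sphere_measure :: 'a measure))"
    by simp
  also have "\<dots> = of_nat DIM('a) * emeasure lborel (cball 0 1 - {0::'a})"
    by (subst nn_integral_sphere) simp_all
  also have "\<dots> \<le> of_nat DIM('a) * emeasure lborel (cball 0 1 :: 'a set)"
    by (intro mult_left_mono emeasure_mono) auto
  also have "\<dots> < \<infinity>" using emeasure_lborel_cball_finite[of "0::'a" 1]
    by (simp add: ennreal_mult_less_top of_nat_less_top)
  finally show "emeasure (sphere_measure :: 'a measure) (space sphere_measure) \<noteq> \<infinity>" by simp
qed

lemma nn_integral_lborel_affine:
  fixes t :: "'a::euclidean_space"
  assumes [measurable]: "g \<in> borel_measurable borel" and "c \<noteq> 0"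
  shows "(\<integral>\<^sup>+x. g x \<partial>lborel) = ennreal (\<bar>c\<bar> ^ DIM('a)) * (\<integral>\<^sup>+x. g (t + c *\<^sub>R x) \<partial>lborel)"
  by (subst lborel_affine[OF assms(2), of t]) (simp add: nn_integral_density nn_integral_distr nn_integral_cmult)

lemma nn_integral_inverse_power_tail:
  fixes a :: real
  assumes "0 < a" "0 < n"
  shows "(\<integral>\<^sup>+\<rho>. ennreal (indicator {a..} \<rho> * (1 / \<rho> ^ Suc n)) \<partial>lborel) = ennreal (1 / (n * a ^ n))"
proof -
  have "(\<integral>\<^sup>+\<rho>. ennreal (1 / \<rho> ^ Suc n) * indicator {a..} \<rho> \<partial>lborel) = ennreal (0 - (- 1 / (n * a ^ n)))"
  proof (rule nn_integral_FTC_atLeast[where F = "\<lambda>x. - 1 / (n * x ^ n)" and f = "\<lambda>x. 1 / x ^ Suc n"])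
    fix x assume x: "a \<le> x"
    then have "x > 0" using assms by simp
    show "((\<lambda>x. - 1 / (n * x ^ n)) has_real_derivative 1 / x ^ Suc n) (at x)"
      using \<open>x > 0\<close> assms
      by (auto intro!: derivative_eq_intros simp: field_simps power2_eq_square power_add[symmetric] simp flip: power_Suc)
    show "0 \<le> 1 / x ^ Suc n" using \<open>x > 0\<close> by simp
  next
    show "((\<lambda>x::real. - 1 / (n * x ^ n)) \<longlongrightarrow> 0) at_top"
      using assms by real_asymp
  qed simp
  then show ?thesis by (simp add: indicator_mult_ennreal mult.commute)
qed

text \<open>Writing the sphere integral as an integral over the ball, substituting \<open>r = \<rho> \<bar>x\<bar>\<close> and then
  \<open>x = w / \<rho>\<close> leaves an elementary integral over \<open>\<rho>\<close>.\<close>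

theorem nn_integral_polar:
  fixes u :: "'a::euclidean_space \<Rightarrow> ennreal"
  assumes [measurable]: "u \<in> borel_measurable borel"
  shows "(\<integral>\<^sup>+x. u x \<partial>lborel) =
    (\<integral>\<^sup>+r. indicator {0<..} r * ennreal (r ^ (DIM('a) - 1)) * (\<integral>\<^sup>+\<omega>. u (r *\<^sub>R \<omega>) \<partial>sphere_measure) \<partial>lborel)"
proof -
  let ?n = "DIM('a)"
  define B where "B = (indicator (cball 0 1 - {0::'a}) :: 'a \<Rightarrow> ennreal)"
  have [measurable]: "B \<in> borel_measurable borel" unfolding B_def by (rule borel_measurable_indicator) auto
  have n: "?n = Suc (?n - 1)" by simp
  \<comment> \<open>The integrand before, between and after the two substitutions; in
    \<open>?f2\<close> and \<open>?f3\<close> the variable r is the new \<rho>. The ball condition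
    on x turns into |w| \<le> \<rho>, so that the remaining integral runs over a tail.\<close>
  let ?f1 = "\<lambda>(x::'a, r::real). indicator {0<..} r * ennreal (r ^ (?n - 1)) * (B x * u (r *\<^sub>R (x /\<^sub>R norm x)))"
  let ?f2 = "\<lambda>(x::'a, r::real). indicator {0<..} r * ennreal (r ^ (?n - 1)) * (ennreal (norm x ^ ?n) * (B x * u (r *\<^sub>R x)))"
  let ?f3 = "\<lambda>(x::'a, r::real). indicator {norm x..} r * ennreal (norm x ^ ?n / r ^ Suc ?n) * (indicator (- {0}) x * u x)"
  \<comment> \<open>The indicator of the half-line depends on both variables; as a case distinction
    on a measurable comparison it is visibly jointly measurable.\<close>
  have "?f3 = (\<lambda>p. if norm (fst p) \<le> snd p then ennreal (norm (fst p) ^ ?n / snd p ^ Suc ?n) * (indicator (- {0}) (fst p) * u (fst p)) else 0)"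
    by (auto simp: fun_eq_iff indicator_def)
  moreover have "\<dots> \<in> borel_measurable (lborel \<Otimes>\<^sub>M lborel)" by measurable
  ultimately have f3 [measurable]: "?f3 \<in> borel_measurable (lborel \<Otimes>\<^sub>M lborel)" by simp
  have "(\<integral>\<^sup>+r. indicator {0<..} r * ennreal (r ^ (?n - 1)) * (\<integral>\<^sup>+\<omega>. u (r *\<^sub>R \<omega>) \<partial>sphere_measure) \<partial>lborel)
     = (\<integral>\<^sup>+r. of_nat ?n * (\<integral>\<^sup>+x. ?f1 (x, r) \<partial>lborel) \<partial>lborel)"
  proof (rule nn_integral_cong)
    fix r :: real
    have "(\<integral>\<^sup>+x. ?f1 (x, r) \<partial>lborel) = indicator {0<..} r * ennreal (r ^ (?n - 1)) * (\<integral>\<^sup>+x. B x * u (r *\<^sub>R (x /\<^sub>R norm x)) \<partial>lborel)"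
      unfolding case_prod_conv by (rule nn_integral_cmult) measurable
    moreover have "(\<integral>\<^sup>+\<omega>. u (r *\<^sub>R \<omega>) \<partial>sphere_measure) = of_nat ?n * (\<integral>\<^sup>+x. B x * u (r *\<^sub>R (x /\<^sub>R norm x)) \<partial>lborel)"
      unfolding B_def by (rule nn_integral_sphere) measurable
    ultimately show "indicator {0<..} r * ennreal (r ^ (?n - 1)) * (\<integral>\<^sup>+\<omega>. u (r *\<^sub>R \<omega>) \<partial>sphere_measure) = of_nat ?n * (\<integral>\<^sup>+x. ?f1 (x, r) \<partial>lborel)"
      by (simp only: mult_ac)
  qed
  also have "\<dots> = of_nat ?n * (\<integral>\<^sup>+r. (\<integral>\<^sup>+x. ?f1 (x, r) \<partial>lborel) \<partial>lborel)"
    by (rule nn_integral_cmult) measurable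
  also have "(\<integral>\<^sup>+r. (\<integral>\<^sup>+x. ?f1 (x, r) \<partial>lborel) \<partial>lborel) = (\<integral>\<^sup>+x. (\<integral>\<^sup>+r. ?f1 (x, r) \<partial>lborel) \<partial>lborel)"
    by (rule lborel_pair.Fubini') measurable
  also have "\<dots> = (\<integral>\<^sup>+x. (\<integral>\<^sup>+r. ?f2 (x, r) \<partial>lborel) \<partial>lborel)"
  proof (rule nn_integral_cong)
    fix x :: 'a
    show "(\<integral>\<^sup>+r. ?f1 (x, r) \<partial>lborel) = (\<integral>\<^sup>+r. ?f2 (x, r) \<partial>lborel)"
    proof (cases "x = 0")
      case False
      have "(\<integral>\<^sup>+r. ?f1 (x, r) \<partial>lborel) = ennreal \<bar>norm x\<bar> * (\<integral>\<^sup>+r. ?f1 (x, 0 + norm x * r) \<partial>lborel)"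
        by (rule nn_integral_real_affine) (use False in simp_all)
      also have "\<dots> = (\<integral>\<^sup>+r. ennreal (norm x) * ?f1 (x, norm x * r) \<partial>lborel)"
        by (subst nn_integral_cmult) auto
      also have "\<dots> = (\<integral>\<^sup>+r. ?f2 (x, r) \<partial>lborel)"
      proof (rule nn_integral_cong)
        fix r :: real
        have "ennreal (norm x) * ennreal ((norm x * r) ^ (?n - 1)) = ennreal (r ^ (?n - 1)) * ennreal (norm x ^ ?n)" if "0 < r"
        proof -
          have "norm x * (norm x * r) ^ k = r ^ k * norm x ^ Suc k" for k
            by (simp add: power_mult_distrib mult_ac)
          from this[of "?n - 1"] have "norm x * (norm x * r) ^ (?n - 1) = r ^ (?n - 1) * norm x ^ ?n"
            unfolding n[symmetric] .
          then show ?thesis using that by (simp add: ennreal_mult[symmetric])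
        qed
        note e = this
        show "ennreal (norm x) * ?f1 (x, norm x * r) = ?f2 (x, r)"
        proof (cases "0 < r")
          case True
          have arg: "(norm x * r) *\<^sub>R (x /\<^sub>R norm x) = r *\<^sub>R x" using False by simp
          have "ennreal (norm x) * ?f1 (x, norm x * r) =
              (ennreal (norm x) * ennreal ((norm x * r) ^ (?n - 1))) * (B x * u (r *\<^sub>R x))"
            using True False unfolding case_prod_conv arg by (simp add: mult.assoc)
          also have "\<dots> = ?f2 (x, r)" unfolding e[OF True] case_prod_conv using True by (simp add: mult.assoc)
          finally show ?thesis .
        next
          case False
          then have "\<not> 0 < norm x * r" by (simp add: zero_less_mult_iff)
          with False show ?thesis by simp
        qed
      qed
      finally show ?thesis .
    qed (simp add: B_def)
  qed
  also have "\<dots> = (\<integral>\<^sup>+r. (\<integral>\<^sup>+x. ?f2 (x, r) \<partial>lborel) \<partial>lborel)"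
    by (rule lborel_pair.Fubini'[symmetric]) measurable
  also have "\<dots> = (\<integral>\<^sup>+r. (\<integral>\<^sup>+x. ?f3 (x, r) \<partial>lborel) \<partial>lborel)"
  proof (rule nn_integral_cong)
    fix r :: real
    show "(\<integral>\<^sup>+x. ?f2 (x, r) \<partial>lborel) = (\<integral>\<^sup>+x. ?f3 (x, r) \<partial>lborel)"
    proof (cases "0 < r")
      case True
      have "(\<integral>\<^sup>+x. ?f2 (x, r) \<partial>lborel) = ennreal (\<bar>1 / r\<bar> ^ ?n) * (\<integral>\<^sup>+x. ?f2 (0 + (1 / r) *\<^sub>R x, r) \<partial>lborel)"
        by (rule nn_integral_lborel_affine) (use True in simp_all)
      also have "\<dots> = (\<integral>\<^sup>+x. ennreal ((1 / r) ^ ?n) * ?f2 ((1 / r) *\<^sub>R x, r) \<partial>lborel)"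
        using True by (subst nn_integral_cmult) auto
      also have "\<dots> = (\<integral>\<^sup>+x. ?f3 (x, r) \<partial>lborel)"
      proof (rule nn_integral_cong)
        fix x :: 'a
        have "(1 / r) ^ Suc k * (r ^ k * (norm x / r) ^ Suc k) = norm x ^ Suc k / r ^ Suc (Suc k)" for k
          using True by (simp add: power_divide field_simps)
        from this[of "?n - 1"] have "(1 / r) ^ ?n * (r ^ (?n - 1) * (norm x / r) ^ ?n) = norm x ^ ?n / r ^ Suc ?n"
          unfolding n[symmetric] .
        then have e: "ennreal ((1 / r) ^ ?n) * (ennreal (r ^ (?n - 1)) * ennreal ((norm x / r) ^ ?n)) = ennreal (norm x ^ ?n / r ^ Suc ?n)"
          using True by (simp add: ennreal_mult[symmetric])
        have Bx: "B ((1 / r) *\<^sub>R x) = indicator {norm x..} r * indicator (- {0}) x"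
          using True by (auto simp: B_def indicator_def)
        have nx: "norm ((1 / r) *\<^sub>R x) = norm x / r" and rx: "r *\<^sub>R ((1 / r) *\<^sub>R x) = x" using True by auto
        have "ennreal ((1 / r) ^ ?n) * ?f2 ((1 / r) *\<^sub>R x, r) =
          (ennreal ((1 / r) ^ ?n) * (ennreal (r ^ (?n - 1)) * ennreal ((norm x / r) ^ ?n))) * (B ((1 / r) *\<^sub>R x) * u x)"
          unfolding case_prod_conv nx rx using True by (simp add: mult.assoc)
        also have "\<dots> = ?f3 (x, r)" unfolding e Bx case_prod_conv by (simp only: mult_ac)
        finally show "ennreal ((1 / r) ^ ?n) * ?f2 ((1 / r) *\<^sub>R x, r) = ?f3 (x, r)" .
      qed
      finally show ?thesis .
    next
      case False
      have z: "?f2 (x, r) = ?f3 (x, r)" for x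
        using False order_less_le_trans[of 0 "norm x" r] by (auto simp: indicator_def)
      show ?thesis by (rule nn_integral_cong) (rule z)
    qed
  qed
  also have "\<dots> = (\<integral>\<^sup>+x. (\<integral>\<^sup>+r. ?f3 (x, r) \<partial>lborel) \<partial>lborel)"
    using lborel_pair.Fubini'[OF f3] by simp
  also have "of_nat ?n * \<dots> = (\<integral>\<^sup>+x. of_nat ?n * (\<integral>\<^sup>+r. ?f3 (x, r) \<partial>lborel) \<partial>lborel)"
    by (rule nn_integral_cmult[symmetric]) (use lborel.borel_measurable_nn_integral_fst[OF f3] in simp)
  also have "\<dots> = (\<integral>\<^sup>+x. u x \<partial>lborel)"
  proof (rule nn_integral_cong_AE)
    \<comment> \<open>The tail integral equals 1 / (n |x|^n) only away from the origin, a null set;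
      there the factors n, |x|^n and this value cancel.\<close>
    have "AE x in lborel. x \<noteq> (0::'a)" by (rule AE_lborel_singleton)
    then show "AE x in lborel. of_nat ?n * (\<integral>\<^sup>+r. ?f3 (x, r) \<partial>lborel) = u x"
    proof eventually_elim
      case (elim x)
      have "(\<integral>\<^sup>+r. ?f3 (x, r) \<partial>lborel) = (\<integral>\<^sup>+r. ennreal (norm x ^ ?n) * u x * ennreal (indicator {norm x..} r * (1 / r ^ Suc ?n)) \<partial>lborel)"
        using elim by (intro nn_integral_cong) (auto simp: indicator_def ennreal_mult' mult_ac divide_inverse simp del: power_Suc)
      also have "\<dots> = ennreal (norm x ^ ?n) * u x * ennreal (1 / (?n * norm x ^ ?n))"
        using nn_integral_inverse_power_tail[of "norm x" ?n] elim by (subst nn_integral_cmult) auto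
      finally have "of_nat ?n * (\<integral>\<^sup>+r. ?f3 (x, r) \<partial>lborel) = (ennreal ?n * ennreal (norm x ^ ?n) * ennreal (1 / (?n * norm x ^ ?n))) * u x"
        by (simp add: mult_ac ennreal_of_nat_eq_real_of_nat)
      also have "ennreal ?n * ennreal (norm x ^ ?n) * ennreal (1 / (?n * norm x ^ ?n)) = 1"
        using elim by (simp add: ennreal_mult[symmetric])
      finally show ?case by simp
    qed
  qed
  finally show ?thesis by simp
qed

section \<open>Vanishing of the spherical mean of harmonic polynomials\<close>

lemma continuous_compact_support_integrable:
  fixes u :: "'a::euclidean_space \<Rightarrow> real"
  assumes "continuous_on UNIV u" "\<And>x. R < norm x \<Longrightarrow> u x = 0"
  shows "integrable lborel u" "\<exists>C. \<forall>x. \<bar>u x\<bar> \<le> C"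
proof -
  have "compact (u ` cball 0 R)" using assms(1)
    by (intro compact_continuous_image) (auto intro: continuous_on_subset)
  then obtain C where C: "\<And>x. norm x \<le> R \<Longrightarrow> \<bar>u x\<bar> \<le> C"
    using compact_imp_bounded bounded_iff by (metis image_eqI mem_cball_0 real_norm_def)
  have C0: "\<bar>u x\<bar> \<le> max C 0" for x using C[of x] assms(2)[of x] by (cases "norm x \<le> R") auto
  then show "\<exists>C. \<forall>x. \<bar>u x\<bar> \<le> C" by blast
  have "integrable lborel (\<lambda>x. indicator (cball (0::'a) R) x * max C 0)"
    using emeasure_lborel_cball_finite[of "0::'a" R] by (intro integrable_mult_left integrable_real_indicator) (auto simp: top.not_eq_extremum)
  moreover have "u \<in> borel_measurable lborel" using borel_measurable_continuous_onI[OF assms(1)] by simp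
  ultimately show "integrable lborel u"
    by (rule Bochner_Integration.integrable_bound)
       (use C0 assms(2) in \<open>auto simp: indicator_def not_le\<close>)
qed

text \<open>Difference quotients of u integrate to 0 by translation invariance, and dominated
  convergence passes this to the derivative. It replaces the divergence theorem for compact
  supports.\<close>

lemma integral_directional_derivative_0:
  fixes u v :: "'a::euclidean_space \<Rightarrow> real"
  assumes der: "\<And>x h. ((\<lambda>h. u (x + h *\<^sub>R b)) has_real_derivative v (x + h *\<^sub>R b)) (at h)"
    and cont: "continuous_on UNIV u" "continuous_on UNIV v"
    and supp: "\<And>x. R < norm x \<Longrightarrow> u x = 0" "\<And>x. R < norm x \<Longrightarrow> v x = 0"
    and b: "norm b = 1"
  shows "(LINT x|lborel. v x) = 0"
proof -
  obtain C where C: "\<And>x. \<bar>v x\<bar> \<le> C"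
    using continuous_compact_support_integrable(2)[OF cont(2) supp(2)] by blast
  define s where "s k x = real (Suc k) * (u (x + (1 / real (Suc k)) *\<^sub>R b) - u x)" for k :: nat and x
  have iu: "integrable lborel u"
    using continuous_compact_support_integrable(1)[of u R] cont(1) supp(1) by blast
  have [measurable]: "u \<in> borel_measurable borel" "v \<in> borel_measurable borel"
    using cont by (auto intro: borel_measurable_continuous_onI)
  have iu': "integrable lborel (\<lambda>x. u (x + a))" for a
    using iu lborel_distr_plus[of a] integrable_distr_eq[of "(+) a" lborel borel u] by (simp add: add.commute)
  have eq': "(LINT x|lborel. u (x + a)) = (LINT x|lborel. u x)" for a
    using lborel_distr_plus[of a] integral_distr[of "(+) a" lborel borel u] by (simp add: add.commute)
  have s0: "integral\<^sup>L lborel (s k) = 0" for k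
    using iu iu' by (simp add: s_def[abs_def] eq')
  have "(\<lambda>k. integral\<^sup>L lborel (s k)) \<longlonglongrightarrow> integral\<^sup>L lborel v"
  proof (rule integral_dominated_convergence)
    \<comment> \<open>The steps have length at most 1, so the difference quotients are supported in
      the ball enlarged by 1, and there the mean value theorem bounds them by
      \<open>C\<close>.\<close>
    show "integrable lborel (\<lambda>x. indicator (cball (0::'a) (R + 1)) x * C)"
      using emeasure_lborel_cball_finite[of "0::'a" "R + 1"]
      by (intro integrable_mult_left integrable_real_indicator) (auto simp: top.not_eq_extremum)
    show "AE x in lborel. (\<lambda>k. s k x) \<longlonglongrightarrow> v x"
    proof (rule AE_I2)
      fix x
      have "((\<lambda>h. (u (x + h *\<^sub>R b) - u x) / h) \<longlongrightarrow> v x) (at 0)"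
        using der[of x 0] by (simp add: has_field_derivative_iff)
      moreover have "filterlim (\<lambda>k. 1 / real (Suc k)) (at 0) sequentially"
        unfolding filterlim_at using LIMSEQ_inverse_real_of_nat by (simp add: divide_inverse)
      ultimately have "(\<lambda>k. (u (x + (1 / real (Suc k)) *\<^sub>R b) - u x) / (1 / real (Suc k))) \<longlonglongrightarrow> v x"
        by (rule filterlim_compose)
      then show "(\<lambda>k. s k x) \<longlonglongrightarrow> v x" by (simp add: s_def mult.commute)
    qed
    show "AE x in lborel. norm (s k x) \<le> indicator (cball (0::'a) (R + 1)) x * C" for k
    proof (rule AE_I2)
      fix x
      let ?h = "1 / real (Suc k)"
      have h: "0 < ?h" "?h \<le> 1" by auto
      show "norm (s k x) \<le> indicator (cball (0::'a) (R + 1)) x * C"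
      proof (cases "norm x \<le> R + 1")
        case True
        have "norm (u (x + ?h *\<^sub>R b) - u (x + 0 *\<^sub>R b)) \<le> C * norm (?h - 0)"
          by (rule field_differentiable_bound[of UNIV "\<lambda>h. u (x + h *\<^sub>R b)" "\<lambda>h. v (x + h *\<^sub>R b)"])
             (use der C in auto)
        then have "real (Suc k) * norm (u (x + ?h *\<^sub>R b) - u x) \<le> real (Suc k) * (C * ?h)"
          by (intro mult_left_mono) auto
        then show ?thesis using True by (simp add: s_def abs_mult)
      next
        case False
        have "norm x \<le> norm (x + ?h *\<^sub>R b) + norm (?h *\<^sub>R b)"
          by (metis add_diff_cancel_right' norm_triangle_ineq4)
        moreover have "norm (?h *\<^sub>R b) \<le> 1" using b by simp
        ultimately have "R < norm (x + ?h *\<^sub>R b)" using False by linarith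
        then have "s k x = 0" using supp(1) False by (simp add: s_def)
        then show ?thesis by (simp add: False)
      qed
    qed
  qed (simp_all add: s_def[abs_def])
  then show ?thesis unfolding s0 by (simp add: LIMSEQ_const_iff)
qed

text \<open>Let g be the positive part of 1 - |x|^2. The divergence of g^2 grad P is g^2 lap P - 4 g
  (x . grad P) = - 4 m g P, by harmonicity and Euler's identity. Its integral is 0, and in polar
  coordinates the integral of g P is the spherical mean of P times a radial factor that is positive
  and finite. This avoids integration by parts on the sphere.\<close>

theorem integral_sphere_harmonic_homog_0:
  fixes P :: "'a::euclidean_space \<Rightarrow> real"
  assumes P: "homog m P" and harm: "\<And>x. lap P x = 0" and m: "0 < m"
  shows "(LINT \<omega>|sphere_measure. P \<omega>) = 0"
proof -
  let ?\<psi> = "\<lambda>r::real. r ^ m * max 0 (1 - r\<^sup>2)"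
  define g where "g x = max 0 (1 - (norm x)\<^sup>2)" for x :: 'a
  have p: "real_polynomial_function P" using P by (rule homogD)
  have pd: "real_polynomial_function (dird b P)" "real_polynomial_function (dird b (dird b P))" for b
    using p by auto
  have [measurable]: "P \<in> borel_measurable borel" "g \<in> borel_measurable borel"
    using rpoly_cont[OF p] by (auto intro: borel_measurable_continuous_onI simp: g_def[abs_def])
  have contg: "continuous_on UNIV g" unfolding g_def by (intro continuous_intros)
  have g0: "1 < norm x \<Longrightarrow> g x = 0" for x
    using one_less_power[of "norm x" 2] by (simp add: g_def)
  \<comment> \<open>The derivative along b of the b-component of g^2 grad P; the sum over the basis
    is the divergence.\<close>
  define v where "v b x = dird b (dird b P) x * (g x)\<^sup>2 + dird b P x * (- 4 * (x \<bullet> b) * g x)" for b x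
  have contv: "continuous_on UNIV (v b)" for b
    unfolding v_def by (intro continuous_intros rpoly_cont pd contg)
  have vb: "(LINT x|lborel. v b x) = 0" if b: "b \<in> Basis" for b
  proof (rule integral_directional_derivative_0)
    fix x h
    have max2: "((\<lambda>y. (max 0 (1 - y))\<^sup>2) has_real_derivative - 2 * max 0 (1 - y)) (at y)" for y :: real
    proof -
      consider "y < 1" | "y > 1" | "y = 1" by linarith
      then show ?thesis
      proof cases
        case 1
        have "((\<lambda>y. (1 - y)\<^sup>2) has_real_derivative - 2 * max 0 (1 - y)) (at y)"
          using 1 by (auto intro!: derivative_eq_intros)
        then show ?thesis
          by (rule has_field_derivative_transform_within_open[of _ _ _ "{..<1}"]) (use 1 in auto)
      next
        case 2
        have "((\<lambda>y. 0) has_real_derivative - 2 * max 0 (1 - y)) (at y)"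
          using 2 by (auto intro!: derivative_eq_intros)
        then show ?thesis
          by (rule has_field_derivative_transform_within_open[of _ _ _ "{1<..}"]) (use 2 in auto)
      next
        \<comment> \<open>At the boundary of the support the difference quotient is at most |h| in
          modulus: this is where the square of the cutoff is differentiable although the cutoff is
          not.\<close>
        case 3
        have "((\<lambda>h. ((max 0 (1 - (1 + h)))\<^sup>2 - (max 0 (1 - 1))\<^sup>2) / h) \<longlongrightarrow> 0) (at (0::real))"
        proof (rule Lim_null_comparison)
          show "\<forall>\<^sub>F h in at 0. norm (((max 0 (1 - (1 + h)))\<^sup>2 - (max 0 (1 - 1))\<^sup>2) / h) \<le> \<bar>h::real\<bar>"
            by (auto simp: eventually_at_filter max_def power2_eq_square intro!: always_eventually)
          show "((\<lambda>h::real. \<bar>h\<bar>) \<longlongrightarrow> 0) (at 0)" by (rule tendsto_rabs_zero) (rule tendsto_ident_at)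
        qed
        then show ?thesis using 3 by (simp add: DERIV_def)
      qed
    qed
    have nsq: "((\<lambda>h. (norm (x + h *\<^sub>R b))\<^sup>2) has_real_derivative 2 * ((x + h *\<^sub>R b) \<bullet> b)) (at h)"
      using dird_along[OF rpoly_normsq, of x b h] by (simp add: dird_normsq)
    have "((\<lambda>h. (g (x + h *\<^sub>R b))\<^sup>2) has_real_derivative (- 2 * g (x + h *\<^sub>R b)) * (2 * ((x + h *\<^sub>R b) \<bullet> b))) (at h)"
      unfolding g_def by (rule DERIV_chain2[OF max2 nsq])
    from DERIV_mult[OF dird_along[OF pd(1)[of b], of x b h] this]
    show "((\<lambda>h. dird b P (x + h *\<^sub>R b) * (g (x + h *\<^sub>R b))\<^sup>2) has_real_derivative v b (x + h *\<^sub>R b)) (at h)"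
      by (simp add: v_def algebra_simps)
  next
    show "continuous_on UNIV (\<lambda>x. dird b P x * (g x)\<^sup>2)"
      by (intro continuous_intros rpoly_cont pd contg)
  qed (use b g0 contv in \<open>auto simp: v_def\<close>)
  have iv: "integrable lborel (v b)" for b
    by (rule continuous_compact_support_integrable(1)[OF contv, of 1]) (simp add: v_def g0)
  have "(\<Sum>b\<in>Basis. v b x) = - 4 * m * (P x * g x)" for x
  proof -
    have "(\<Sum>b\<in>Basis. v b x) = (g x)\<^sup>2 * lap P x - 4 * g x * (\<Sum>b\<in>Basis. (x \<bullet> b) * dird b P x)"
      unfolding lap_def sum_distrib_left sum_subtractf[symmetric] v_def
      by (intro sum.cong refl) (simp add: algebra_simps)
    then show ?thesis by (simp add: harm euler_homog[OF P])
  qed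
  moreover have "(LINT x|lborel. (\<Sum>b\<in>Basis. v b x)) = 0"
    using iv vb by (subst Bochner_Integration.integral_sum) auto
  ultimately have 0: "(LINT x|lborel. P x * g x) = 0" using m by simp
  have iPg: "integrable lborel (\<lambda>x. P x * g x)"
    by (rule continuous_compact_support_integrable(1)[of _ 1])
       (auto intro!: continuous_on_mult rpoly_cont[OF p] contg simp: g0)
  \<comment> \<open>The radial factor of the integral of g P in polar coordinates. The factorisation
    is proved for nonnegative integrals and applied to P and to - P separately.\<close>
  define K where "K = (\<integral>\<^sup>+r. indicator {0<..} r * ennreal (r ^ (DIM('a) - 1)) * ennreal (?\<psi> r) \<partial>lborel)"
  have polar: "(\<integral>\<^sup>+x. ennreal (Q x * g x) \<partial>lborel) = (\<integral>\<^sup>+\<omega>. ennreal (Q \<omega>) \<partial>sphere_measure) * K"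
    if [measurable]: "Q \<in> borel_measurable borel" and Q: "\<And>c x. Q (c *\<^sub>R x) = c ^ m * Q x" for Q
  proof -
    have "(\<integral>\<^sup>+x. ennreal (Q x * g x) \<partial>lborel) = (\<integral>\<^sup>+r. indicator {0<..} r * ennreal (r ^ (DIM('a) - 1)) *
       (\<integral>\<^sup>+\<omega>. ennreal (Q (r *\<^sub>R \<omega>) * g (r *\<^sub>R \<omega>)) \<partial>sphere_measure) \<partial>lborel)"
      by (rule nn_integral_polar) measurable
    also have "\<dots> = (\<integral>\<^sup>+r. (\<integral>\<^sup>+\<omega>. ennreal (Q \<omega>) \<partial>sphere_measure) * (indicator {0<..} r * ennreal (r ^ (DIM('a) - 1)) * ennreal (?\<psi> r)) \<partial>lborel)"
    proof (rule nn_integral_cong)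
      fix r :: real
      have "(\<integral>\<^sup>+\<omega>. ennreal (Q (r *\<^sub>R \<omega>) * g (r *\<^sub>R \<omega>)) \<partial>sphere_measure) =
          (\<integral>\<^sup>+\<omega>. ennreal (?\<psi> r) * ennreal (Q \<omega>) \<partial>sphere_measure)" if "0 < r"
      proof (rule nn_integral_cong)
        fix \<omega> :: 'a assume "\<omega> \<in> space sphere_measure"
        then have "Q (r *\<^sub>R \<omega>) * g (r *\<^sub>R \<omega>) = (?\<psi> r) * Q \<omega>"
          by (simp add: Q g_def mult_ac)
        then show "ennreal (Q (r *\<^sub>R \<omega>) * g (r *\<^sub>R \<omega>)) = ennreal (?\<psi> r) * ennreal (Q \<omega>)"
          using that by (simp add: ennreal_mult')
      qed
      also have "(\<integral>\<^sup>+\<omega>. ennreal (?\<psi> r) * ennreal (Q \<omega>) \<partial>sphere_measure) =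
         ennreal (?\<psi> r) * (\<integral>\<^sup>+\<omega>. ennreal (Q \<omega>) \<partial>sphere_measure)"
        by (intro nn_integral_cmult borel_measurable_sphereI) measurable
      finally show "indicator {0<..} r * ennreal (r ^ (DIM('a) - 1)) *
       (\<integral>\<^sup>+\<omega>. ennreal (Q (r *\<^sub>R \<omega>) * g (r *\<^sub>R \<omega>)) \<partial>sphere_measure) =
       (\<integral>\<^sup>+\<omega>. ennreal (Q \<omega>) \<partial>sphere_measure) * (indicator {0<..} r * ennreal (r ^ (DIM('a) - 1)) * ennreal (?\<psi> r))"
        by (auto simp: indicator_def mult_ac)
    qed
    also have "\<dots> = (\<integral>\<^sup>+\<omega>. ennreal (Q \<omega>) \<partial>sphere_measure) * K"
      unfolding K_def by (rule nn_integral_cmult) measurable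
    finally show ?thesis .
  qed
  have "K \<noteq> 0"
  proof
    assume "K = 0"
    then have "AE r in lborel. indicator {0<..} r * ennreal (r ^ (DIM('a) - 1)) * ennreal (?\<psi> r) = 0"
      unfolding K_def by (subst (asm) nn_integral_0_iff_AE) auto
    then have "AE r in lborel. r \<notin> {0<..<1::real}"
    proof eventually_elim
      case (elim r)
      show ?case
      proof
        assume "r \<in> {0<..<1}"
        then have "0 < r" "r * r < 1" using mult_strict_mono[of r 1 r 1] by auto
        then have "0 < r ^ (DIM('a) - 1)" "0 < ?\<psi> r" by (auto simp: power2_eq_square)
        then show False using elim \<open>0 < r\<close> by (simp add: ennreal_eq_0_iff not_le[symmetric])
      qed
    qed
    then have "emeasure lborel {0<..<1::real} = 0"
      by (subst (asm) AE_iff_measurable[of "{0<..<1}"]) auto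
    then show False by simp
  qed
  have "K \<noteq> \<infinity>"
  proof -
    have "K \<le> (\<integral>\<^sup>+r. indicator {0..1::real} r \<partial>lborel)"
      unfolding K_def
    proof (intro nn_integral_mono)
      fix r :: real
      have "r ^ (DIM('a) - 1) * (?\<psi> r) \<le> 1 * (1 * 1)" if "0 < r" "r \<le> 1"
        using that by (intro mult_mono power_le_one) auto
      moreover have "max 0 (1 - r\<^sup>2) = 0" if "r > 1"
        using that one_less_power[of r 2] by simp
      ultimately show "indicator {0<..} r * ennreal (r ^ (DIM('a) - 1)) * ennreal (?\<psi> r) \<le> indicator {0..1} r"
        by (auto simp: indicator_def ennreal_mult[symmetric] not_le)
    qed
    also have "\<dots> < \<infinity>" by simp
    finally show ?thesis by simp
  qed
  let ?p = "\<integral>\<^sup>+\<omega>. ennreal (P \<omega>) \<partial>sphere_measure" and ?m = "\<integral>\<^sup>+\<omega>. ennreal (- P \<omega>) \<partial>sphere_measure"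
  have f: "(\<integral>\<^sup>+x. ennreal (P x * g x) \<partial>lborel) < \<infinity>" "(\<integral>\<^sup>+x. ennreal (- (P x * g x)) \<partial>lborel) < \<infinity>"
    using iPg by (auto simp: real_integrable_def top.not_eq_extremum)
  have "enn2real (\<integral>\<^sup>+x. ennreal (P x * g x) \<partial>lborel) = enn2real (\<integral>\<^sup>+x. ennreal (- (P x * g x)) \<partial>lborel)"
    using 0 real_lebesgue_integral_def[OF iPg] by simp
  then have "(\<integral>\<^sup>+x. ennreal (P x * g x) \<partial>lborel) = (\<integral>\<^sup>+x. ennreal (- (P x * g x)) \<partial>lborel)"
    using f by (metis ennreal_enn2real infinity_ennreal_def)
  then have "?p * K = ?m * K"
    using polar[of P] polar[of "\<lambda>x. - P x"] homogD(2)[OF P] by simp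
  then have "?p = ?m" using \<open>K \<noteq> 0\<close> \<open>K \<noteq> \<infinity>\<close>
    by (metis ennreal_mult_cancel_left infinity_ennreal_def mult.commute)
  \<comment> \<open>Positive and negative parts have equal integrals. If P were not integrable, the
    integral would be 0 by convention.\<close>
  then show ?thesis
    by (cases "integrable sphere_measure P") (simp_all add: real_lebesgue_integral_def not_integrable_integral_eq)
qed

section \<open>Fourier injectivity\<close>

lemma
  fixes f :: "'a::euclidean_space \<Rightarrow> real \<Rightarrow> complex"
  assumes "\<And>b. b \<in> Basis \<Longrightarrow> integrable lborel (f b)"
  shows integral_lborel_prod: "(LINT x|lborel. (\<Prod>b\<in>Basis. f b (x \<bullet> b))) = (\<Prod>b\<in>Basis. LINT x|lborel. f b x)"
    and integrable_lborel_prod: "integrable lborel (\<lambda>x. \<Prod>b\<in>Basis. f b (x \<bullet> b))"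
proof -
  interpret product_sigma_finite "\<lambda>_::'a. lborel :: real measure" by standard
  have m: "(\<lambda>y. \<Sum>b\<in>Basis. y b *\<^sub>R b) \<in> (\<Pi>\<^sub>M b\<in>Basis. lborel) \<rightarrow>\<^sub>M (borel :: 'a measure)"
    by measurable
  have fm: "(\<lambda>x. \<Prod>b\<in>Basis. f b (x \<bullet> b)) \<in> borel_measurable borel"
  proof (rule borel_measurable_prod)
    fix b :: 'a assume "b \<in> Basis"
    then have [measurable]: "f b \<in> borel_measurable borel" using assms[of b] by auto
    show "(\<lambda>x. f b (x \<bullet> b)) \<in> borel_measurable borel" by measurable
  qed
  have eq: "(\<Prod>b\<in>Basis. f b ((\<Sum>b\<in>Basis. y b *\<^sub>R b) \<bullet> b)) = (\<Prod>b\<in>Basis. f b (y b))" for y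
    by (intro prod.cong refl) (simp add: inner_sum_left_Basis)
  show "(LINT x|lborel. (\<Prod>b\<in>Basis. f b (x \<bullet> b))) = (\<Prod>b\<in>Basis. LINT x|lborel. f b x)"
    by (subst lborel_eq, subst integral_distr[OF m fm]) (simp only: eq product_integral_prod[OF finite_Basis assms])
  show "integrable lborel (\<lambda>x. \<Prod>b\<in>Basis. f b (x \<bullet> b))"
    by (subst lborel_eq, subst integrable_distr_eq[OF m fm]) (simp only: eq product_integrable_prod[OF finite_Basis assms])
qed

text \<open>The substitution x = sqrt (2 u) y turns the weight into exp (- y^2 / 2), so the
  characteristic function of the standard normal distribution gives the value.\<close>

lemma gaussian_fourier_real:
  fixes u \<xi> :: real
  assumes u: "0 < u"
  shows "(LINT x|lborel. of_real (exp (- (x\<^sup>2) / (4 * u))) * exp (- \<i> * of_real (x * \<xi>)))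
            = complex_of_real (sqrt (4 * pi * u) * exp (- u * \<xi>\<^sup>2))"
    and "integrable lborel (\<lambda>x. complex_of_real (exp (- (x\<^sup>2) / (4 * u))) * exp (- \<i> * of_real (x * \<xi>)))"
proof -
  define c where "c = sqrt (2 * u)"
  have c: "0 < c" "c\<^sup>2 = 2 * u" using u by (auto simp: c_def)
  define G where "G x = complex_of_real (exp (- (x\<^sup>2) / (4 * u))) * exp (- \<i> * of_real (x * \<xi>))" for x
  have G: "G (0 + c * y) = of_real (sqrt (2 * pi)) * (std_normal_density y *\<^sub>R iexp ((- \<xi> * c) * y))" for y
  proof -
    have "(c * y)\<^sup>2 / (4 * u) = y\<^sup>2 / 2" using u by (simp add: power_mult_distrib c(2))
    then show ?thesis
      by (simp add: G_def std_normal_density_def scaleR_conv_of_real mult_ac flip: of_real_mult)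
  qed
  have "integrable lborel (\<lambda>y. std_normal_density y *\<^sub>R iexp ((- \<xi> * c) * y))"
    by (rule Bochner_Integration.integrable_bound[OF integrable_normal_density[of 1 0]])
       (auto simp: normal_density_nonneg)
  then have i: "integrable lborel (\<lambda>y. G (0 + c * y))" unfolding G by (rule integrable_mult_right)
  have ft: "(LINT y|lborel. std_normal_density y *\<^sub>R iexp ((- \<xi> * c) * y)) = of_real (exp (- (((- \<xi> * c)^2) / 2)))"
    using fun_cong[OF char_std_normal_distribution, of "- \<xi> * c"]
    by (simp add: char_def integral_density normal_density_nonneg)
  show "integrable lborel (\<lambda>x. complex_of_real (exp (- (x\<^sup>2) / (4 * u))) * exp (- \<i> * of_real (x * \<xi>)))"
    using lborel_integrable_real_affine_iff[of c G 0] i c unfolding G_def by simp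
  have "(LINT x|lborel. G x) = \<bar>c\<bar> *\<^sub>R (LINT x|lborel. G (0 + c * x))"
    using c by (intro lborel_integral_real_affine) auto
  also have "\<dots> = of_real (c * sqrt (2 * pi) * exp (- (((- \<xi> * c)^2) / 2)))"
    unfolding G integral_mult_right_zero ft using c by (simp add: scaleR_conv_of_real)
  also have "c * sqrt (2 * pi) = sqrt (4 * pi * u)"
    by (simp add: c_def real_sqrt_mult[symmetric] mult_ac)
  also have "- (((- \<xi> * c)^2) / 2) = - u * \<xi>\<^sup>2" by (simp add: power_mult_distrib c(2))
  finally show "(LINT x|lborel. of_real (exp (- (x\<^sup>2) / (4 * u))) * exp (- \<i> * of_real (x * \<xi>)))
            = complex_of_real (sqrt (4 * pi * u) * exp (- u * \<xi>\<^sup>2))" unfolding G_def .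
qed

lemma gaussian_fourier:
  fixes \<xi> :: "'a::euclidean_space"
  assumes u: "0 < u"
  shows "(LINT x|lborel. of_real (exp (- ((norm x)\<^sup>2) / (4 * u))) * exp (- \<i> * of_real (x \<bullet> \<xi>)))
            = complex_of_real (sqrt (4 * pi * u) ^ DIM('a) * exp (- u * (norm \<xi>)\<^sup>2))"
    and "integrable lborel (\<lambda>x. complex_of_real (exp (- ((norm x)\<^sup>2) / (4 * u))) * exp (- \<i> * of_real (x \<bullet> \<xi>)))"
proof -
  have eq: "complex_of_real (exp (- ((norm x)\<^sup>2) / (4 * u))) * exp (- \<i> * of_real (x \<bullet> \<xi>)) =
      (\<Prod>b\<in>Basis. of_real (exp (- ((x \<bullet> b)\<^sup>2) / (4 * u))) * exp (- \<i> * of_real ((x \<bullet> b) * (\<xi> \<bullet> b))))" for x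
  proof -
    have "exp (- ((norm x)\<^sup>2) / (4 * u)) = exp (\<Sum>b\<in>Basis. - ((x \<bullet> b)\<^sup>2) / (4 * u))"
      unfolding power2_norm_eq_inner euclidean_inner[of x x]
      by (simp add: sum_divide_distrib sum_negf power2_eq_square)
    moreover have "exp (- \<i> * of_real (x \<bullet> \<xi>)) = exp (\<Sum>b\<in>Basis. - \<i> * of_real ((x \<bullet> b) * (\<xi> \<bullet> b)))"
      by (simp add: euclidean_inner[of x \<xi>] sum_distrib_left sum_negf)
    ultimately show ?thesis
      by (simp only: exp_sum[OF finite_Basis] prod.distrib of_real_prod)
  qed
  show "(LINT x|lborel. of_real (exp (- ((norm x)\<^sup>2) / (4 * u))) * exp (- \<i> * of_real (x \<bullet> \<xi>)))
            = complex_of_real (sqrt (4 * pi * u) ^ DIM('a) * exp (- u * (norm \<xi>)\<^sup>2))"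
  proof -
    have "exp (- u * (norm \<xi>)\<^sup>2) = (\<Prod>b\<in>Basis. exp (- u * (\<xi> \<bullet> b)\<^sup>2))"
      unfolding power2_norm_eq_inner euclidean_inner[of \<xi> \<xi>] exp_sum[OF finite_Basis, symmetric]
      by (simp add: sum_distrib_left sum_negf power2_eq_square)
    then show ?thesis
      unfolding eq by (subst integral_lborel_prod[OF gaussian_fourier_real(2)[OF u]])
        (simp only: gaussian_fourier_real(1)[OF u], simp add: prod.distrib)
  qed
  show "integrable lborel (\<lambda>x. complex_of_real (exp (- ((norm x)\<^sup>2) / (4 * u))) * exp (- \<i> * of_real (x \<bullet> \<xi>)))"
    unfolding eq by (rule integrable_lborel_prod[OF gaussian_fourier_real(2)[OF u]])
qed

lemma integrable_gaussian:
  assumes "0 < a"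
  shows "integrable lborel (\<lambda>x::'a::euclidean_space. exp (- a * (norm x)\<^sup>2))"
  using integrable_norm[OF gaussian_fourier(2)[of "1 / (4 * a)" 0]] assms by (simp add: mult.commute)

lemma integral_lborel_affine:
  fixes t :: "'a::euclidean_space" and g :: "'a \<Rightarrow> 'b::{banach, second_countable_topology}"
  assumes [measurable]: "g \<in> borel_measurable borel" and "c \<noteq> 0"
  shows "(LINT x|lborel. g x) = (\<bar>c\<bar> ^ DIM('a)) *\<^sub>R (LINT x|lborel. g (t + c *\<^sub>R x))"
  by (subst lborel_affine[OF assms(2), of t]) (simp add: integral_density integral_distr)

lemma (in pair_sigma_finite) integrable_pair_mult:
  fixes f :: "'a \<Rightarrow> complex" and g :: "'b \<Rightarrow> complex"
  assumes f: "integrable M1 f" and g: "integrable M2 g"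
  shows "integrable (M1 \<Otimes>\<^sub>M M2) (\<lambda>(x, y). f x * g y)"
proof (rule Fubini_integrable)
  have [measurable]: "f \<in> borel_measurable M1" "g \<in> borel_measurable M2" using f g by auto
  show "(\<lambda>(x, y). f x * g y) \<in> borel_measurable (M1 \<Otimes>\<^sub>M M2)" by measurable
  show "integrable M1 (\<lambda>x. LINT y|M2. norm (case (x, y) of (x, y) \<Rightarrow> f x * g y))"
    using f by (simp add: norm_mult)
qed (use g in simp)

text \<open>Closed sets form an intersection-stable generator of the Borel sets, so the integrals
  vanish over every Borel set by the Dynkin argument; uniqueness of densities then applies to real
  and imaginary part.\<close>

lemma AE_eq_0_if_closed_integrals_0:
  fixes D :: "'a::euclidean_space \<Rightarrow> complex"
  assumes D: "integrable lborel D"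
    and cl: "\<And>F. closed F \<Longrightarrow> (LINT x:F|lborel. D x) = 0"
  shows "AE x in lborel. D x = 0"
proof -
  have si: "set_integrable lborel A D" if "A \<in> sets borel" for A
    using that D by (simp add: set_integrable_def integrable_mult_indicator)
  have all: "(LINT x:A|lborel. D x) = 0" if "A \<in> sigma_sets UNIV (Collect closed)" for A
  proof -
    have "Int_stable (Collect (closed :: 'a set \<Rightarrow> bool))" "Collect (closed :: 'a set \<Rightarrow> bool) \<subseteq> Pow UNIV"
      by (auto simp: Int_stable_def)
    from this that show ?thesis
    proof (induction rule: sigma_sets_induct_disjoint)
      case (compl A)
      then have A: "A \<in> sets borel" by (simp add: borel_eq_closed)
      have "(LINT x:A \<union> (UNIV - A)|lborel. D x) = (LINT x:A|lborel. D x) + (LINT x:UNIV - A|lborel. D x)"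
        using A by (intro set_integral_Un si) auto
      moreover have "(LINT x:A \<union> (UNIV - A)|lborel. D x) = 0" using cl[of UNIV] by simp
      ultimately show ?case using compl by simp
    next
      case (union A)
      then have A: "A i \<in> sets borel" for i by (auto simp: borel_eq_closed)
      have "(LINT x:(\<Union>i. A i)|lborel. D x) = (\<Sum>i. (LINT x:A i|lborel. D x))"
        using union A by (intro lebesgue_integral_countable_add si) (auto simp: disjoint_family_on_def)
      then show ?case using union by simp
    qed (auto intro: cl)
  qed
  have sb: "sets borel = sigma_sets UNIV (Collect (closed :: 'a set \<Rightarrow> bool))"
    by (simp add: borel_eq_closed)
  have "AE x in lborel. Re (D x) = 0"
  proof (rule density_unique_real)
    fix A :: "'a set" assume "A \<in> sets lborel"
    then have A: "A \<in> sets borel" by simp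
    have "(LINT x:A|lborel. Re (D x)) = Re (LINT x:A|lborel. D x)"
      using si[OF A] unfolding set_lebesgue_integral_def set_integrable_def
      by (subst integral_Re[symmetric]) simp_all
    then show "(LINT x:A|lborel. Re (D x)) = (LINT x:A|lborel. 0)"
      using all A sb by (simp add: set_lebesgue_integral_def)
  qed (use D in auto)
  moreover have "AE x in lborel. Im (D x) = 0"
  proof (rule density_unique_real)
    fix A :: "'a set" assume "A \<in> sets lborel"
    then have A: "A \<in> sets borel" by simp
    have "(LINT x:A|lborel. Im (D x)) = Im (LINT x:A|lborel. D x)"
      using si[OF A] unfolding set_lebesgue_integral_def set_integrable_def
      by (subst integral_Im[symmetric]) simp_all
    then show "(LINT x:A|lborel. Im (D x)) = (LINT x:A|lborel. 0)"
      using all A sb by (simp add: set_lebesgue_integral_def)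
  qed (use D in auto)
  ultimately show ?thesis by eventually_elim (simp add: complex_eq_iff)
qed

text \<open>No inversion formula is used. D is tested successively against Gaussians, against
  bounded integrable continuous functions, and against indicators of closed sets. The frequency 0
  may be left out because it is a null set for the integral over frequencies.\<close>

theorem fourier_injective:
  fixes D :: "'a::euclidean_space \<Rightarrow> complex"
  assumes D: "integrable lborel D"
    and ft: "\<And>\<xi>. \<xi> \<noteq> 0 \<Longrightarrow> (LINT x|lborel. D x * exp (- \<i> * of_real (x \<bullet> \<xi>))) = 0"
  shows "AE x in lborel. D x = 0"
proof -
  have [measurable]: "D \<in> borel_measurable borel" using D by auto
  let ?L = "lborel \<Otimes>\<^sub>M lborel :: ('a \<times> 'a) measure"
  \<comment> \<open>A translated Gaussian is itself a Fourier integral of a Gaussian; after Fubini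
    the inner integral is a multiple of the Fourier transform of D.\<close>
  have step1: "(LINT x|lborel. D x * of_real (exp (- u * (norm (x - y))\<^sup>2))) = 0" if u: "0 < u" for u y
  proof -
    let ?h = "\<lambda>(x, \<xi>). D x * (of_real (exp (- ((norm \<xi>)\<^sup>2) / (4 * u))) * exp (- \<i> * of_real (\<xi> \<bullet> (x - y))))"
    have "integrable ?L (\<lambda>(x, \<xi>). D x * complex_of_real (exp (- (1 / (4 * u)) * (norm (\<xi>::'a))\<^sup>2)))"
      using integrable_gaussian[of "1 / (4 * u)", where 'a = 'a] u
      by (intro lborel_pair.integrable_pair_mult D) (auto simp: integrable_of_real)
    then have ih: "integrable ?L ?h"
      by (rule Bochner_Integration.integrable_bound) (auto simp: norm_mult)
    have "complex_of_real (sqrt (4 * pi * u) ^ DIM('a)) * (LINT x|lborel. D x * of_real (exp (- u * (norm (x - y))\<^sup>2)))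
       = (LINT x|lborel. (LINT \<xi>|lborel. ?h (x, \<xi>)))"
      unfolding integral_mult_right_zero[symmetric]
    proof (rule Bochner_Integration.integral_cong[OF refl])
      fix x
      show "complex_of_real (sqrt (4 * pi * u) ^ DIM('a)) * (D x * of_real (exp (- u * (norm (x - y))\<^sup>2))) = (LINT \<xi>|lborel. ?h (x, \<xi>))"
        unfolding case_prod_conv integral_mult_right_zero gaussian_fourier(1)[OF u] of_real_mult by (simp only: mult_ac)
    qed
    also have "\<dots> = (LINT \<xi>|lborel. (LINT x|lborel. ?h (x, \<xi>)))"
      using lborel_pair.Fubini_integral[of "\<lambda>x \<xi>. ?h (x, \<xi>)"] ih by simp
    also have "\<dots> = (LINT (\<xi>::'a)|lborel. (0::complex))"
    proof (rule integral_cong_AE)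
      have "AE \<xi> in lborel. \<xi> \<noteq> (0::'a)" by (rule AE_lborel_singleton)
      then show "AE \<xi> in lborel. (LINT x|lborel. ?h (x, \<xi>)) = 0"
      proof eventually_elim
        case (elim \<xi>)
        have "(LINT x|lborel. ?h (x, \<xi>)) = (LINT x|lborel. (of_real (exp (- ((norm \<xi>)\<^sup>2) / (4 * u))) * exp (\<i> * of_real (y \<bullet> \<xi>))) * (D x * exp (- \<i> * of_real (x \<bullet> \<xi>))))"
        proof (rule Bochner_Integration.integral_cong[OF refl])
          fix x
          have "exp (- \<i> * of_real (\<xi> \<bullet> (x - y))) = exp (\<i> * of_real (y \<bullet> \<xi>)) * exp (- \<i> * of_real (x \<bullet> \<xi>))"
            unfolding exp_add[symmetric] by (simp add: inner_diff_right inner_commute[of \<xi>] right_diff_distrib)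
          then show "?h (x, \<xi>) = (of_real (exp (- ((norm \<xi>)\<^sup>2) / (4 * u))) * exp (\<i> * of_real (y \<bullet> \<xi>))) * (D x * exp (- \<i> * of_real (x \<bullet> \<xi>)))"
            unfolding case_prod_conv by (simp only: mult_ac)
        qed
        also have "\<dots> = 0" unfolding integral_mult_right_zero ft[OF elim] by simp
        finally show ?case .
      qed
    qed measurable
    finally show ?thesis using u by simp
  qed
  \<comment> \<open>Mollification: \<phi> is averaged against a Gaussian of width 1/(k+1). The
    change of variables y = x + z/(k+1) shows that each average is an integral of the Gaussian tests
    of \<open>step1\<close>, hence 0, and the limit of infinite k is the integral of D \<phi> times
    the mass of the Gaussian.\<close>
  have step2: "(LINT x|lborel. D x * of_real (\<phi> x)) = 0"
    if c: "continuous_on UNIV \<phi>" and i: "integrable lborel \<phi>" and b: "\<And>x. \<bar>\<phi> x\<bar> \<le> 1" for \<phi> :: "'a \<Rightarrow> real"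
  proof -
    have [measurable]: "\<phi> \<in> borel_measurable borel" using c by (rule borel_measurable_continuous_onI)
    let ?e = "\<lambda>z::'a. complex_of_real (exp (- (norm z)\<^sup>2))"
    have ie: "integrable lborel ?e"
      using integrable_gaussian[of 1, where 'a = 'a] by (simp add: integrable_of_real)
    define I where "I k = (integral\<^sup>L ?L (\<lambda>(x,z). D x * ?e z * of_real (\<phi> (x + (1 / real (Suc k)) *\<^sub>R z))))" for k :: nat
    have iDe: "integrable ?L (\<lambda>(x, z). D x * ?e z)"
      by (rule lborel_pair.integrable_pair_mult[OF D ie])
    have dom: "norm (D x * ?e z * of_real (\<phi> v)) \<le> norm (D x * ?e z)" for x z v
      using b[of v] by (simp add: norm_mult mult_left_le)
    have I0: "I k = 0" for k
    proof -
      let ?k = "real (Suc k)"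
      let ?E = "\<lambda>x y. complex_of_real (exp (- (?k\<^sup>2) * (norm (x - y :: 'a))\<^sup>2))"
      have ik: "integrable ?L (\<lambda>(x,z). D x * ?e z * of_real (\<phi> (x + (1 / ?k) *\<^sub>R z)))"
        by (rule Bochner_Integration.integrable_bound[OF iDe]) (auto simp: dom simp del: norm_mult of_nat_Suc)
      have "I k = (LINT x|lborel. (LINT z|lborel. D x * ?e z * of_real (\<phi> (x + (1 / ?k) *\<^sub>R z))))"
        unfolding I_def using lborel_pair.integral_fst'[OF ik] by simp
      also have "\<dots> = (LINT x|lborel. (LINT y|lborel. ?k ^ DIM('a) *\<^sub>R (D x * ?E x y * of_real (\<phi> y))))"
      proof (rule Bochner_Integration.integral_cong[OF refl])
        fix x
        let ?g = "\<lambda>z. D x * ?e z * of_real (\<phi> (x + (1 / ?k) *\<^sub>R z))"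
        have g1: "(LINT z|lborel. ?g z) = (\<bar>?k\<bar> ^ DIM('a)) *\<^sub>R (LINT y|lborel. ?g (- ?k *\<^sub>R x + ?k *\<^sub>R y))"
          by (rule integral_lborel_affine) auto
        have g2: "?g (- ?k *\<^sub>R x + ?k *\<^sub>R y) = D x * ?E x y * of_real (\<phi> y)" for y
        proof -
          have 1: "- ?k *\<^sub>R x + ?k *\<^sub>R y = ?k *\<^sub>R (y - x)" by (simp add: algebra_simps)
          have 2: "norm (?k *\<^sub>R (y - x)) = ?k * norm (x - y)" by (simp add: norm_minus_commute)
          have 3: "x + (1 / ?k) *\<^sub>R (?k *\<^sub>R (y - x)) = y" by simp
          show ?thesis unfolding 1 2 3 by (simp add: power_mult_distrib)
        qed
        show "(LINT z|lborel. ?g z) = (LINT y|lborel. ?k ^ DIM('a) *\<^sub>R (D x * ?E x y * of_real (\<phi> y)))"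
          unfolding g1 g2 by (simp del: of_nat_Suc)
      qed
      also have "\<dots> = (LINT y|lborel. (LINT x|lborel. ?k ^ DIM('a) *\<^sub>R (D x * ?E x y * of_real (\<phi> y))))"
      proof -
        have i2: "integrable ?L (\<lambda>(x, y). D x * complex_of_real (\<phi> y))"
          using i by (intro lborel_pair.integrable_pair_mult D) auto
        have b2: "norm (D x * ?E x y * complex_of_real (\<phi> y)) \<le> norm (D x * complex_of_real (\<phi> y))" for x y
        proof -
          have "exp (- (?k\<^sup>2) * (norm (x - y))\<^sup>2) \<le> 1" by (simp del: of_nat_Suc)
          then have "norm (D x) * exp (- (?k\<^sup>2) * (norm (x - y))\<^sup>2) * \<bar>\<phi> y\<bar> \<le> norm (D x) * \<bar>\<phi> y\<bar>"
            by (intro mult_right_mono mult_left_le) auto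
          then show ?thesis by (simp only: norm_mult norm_of_real abs_exp_cancel)
        qed
        have "integrable ?L (\<lambda>(x, y). D x * ?E x y * complex_of_real (\<phi> y))"
        proof (rule Bochner_Integration.integrable_bound[OF i2])
          show "AE p in ?L. norm (case p of (x, y) \<Rightarrow> D x * ?E x y * complex_of_real (\<phi> y))
             \<le> norm (case p of (x, y) \<Rightarrow> D x * complex_of_real (\<phi> y))"
          proof (rule AE_I2)
            fix p :: "'a \<times> 'a"
            show "norm (case p of (x, y) \<Rightarrow> D x * ?E x y * complex_of_real (\<phi> y))
             \<le> norm (case p of (x, y) \<Rightarrow> D x * complex_of_real (\<phi> y))"
              by (cases p) (simp only: case_prod_conv b2)
          qed
        qed measurable
        then have "integrable ?L (\<lambda>(x, y). ?k ^ DIM('a) *\<^sub>R (D x * ?E x y * complex_of_real (\<phi> y)))"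
          unfolding case_prod_unfold by (rule integrable_scaleR_right)
        then show ?thesis by (rule lborel_pair.Fubini_integral[symmetric])
      qed
      also have "\<dots> = 0"
        using step1[of "?k\<^sup>2"] by (simp del: of_nat_Suc)
      finally show ?thesis .
    qed
    have "I \<longlonglongrightarrow> (integral\<^sup>L ?L (\<lambda>(x,z). D x * ?e z * of_real (\<phi> x)))"
      unfolding I_def case_prod_unfold
    proof (rule integral_dominated_convergence)
      show "integrable ?L (\<lambda>p. norm (D (fst p) * ?e (snd p)))"
        using integrable_norm[OF iDe] by (simp add: case_prod_unfold)
      show "AE p in ?L. (\<lambda>k. D (fst p) * ?e (snd p) * of_real (\<phi> (fst p + (1 / real (Suc k)) *\<^sub>R snd p))) \<longlonglongrightarrow> D (fst p) * ?e (snd p) * of_real (\<phi> (fst p))"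
      proof (rule AE_I2)
        fix p :: "'a \<times> 'a"
        have "(\<lambda>k. fst p + (1 / real (Suc k)) *\<^sub>R snd p) \<longlonglongrightarrow> fst p + 0 *\<^sub>R snd p"
          by (intro tendsto_intros) (use LIMSEQ_inverse_real_of_nat in \<open>simp add: divide_inverse\<close>)
        then have "(\<lambda>k. \<phi> (fst p + (1 / real (Suc k)) *\<^sub>R snd p)) \<longlonglongrightarrow> \<phi> (fst p)"
          using c by (intro continuous_on_tendsto_compose[OF c]) auto
        then show "(\<lambda>k. D (fst p) * ?e (snd p) * of_real (\<phi> (fst p + (1 / real (Suc k)) *\<^sub>R snd p))) \<longlonglongrightarrow> D (fst p) * ?e (snd p) * of_real (\<phi> (fst p))"
          by (intro tendsto_intros)
      qed
      show "AE p in ?L. norm (D (fst p) * ?e (snd p) * of_real (\<phi> (fst p + (1 / real (Suc k)) *\<^sub>R snd p))) \<le> norm (D (fst p) * ?e (snd p))" for k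
        using dom by blast
    qed auto
    then have "(integral\<^sup>L ?L (\<lambda>(x,z). D x * ?e z * of_real (\<phi> x))) = 0"
      unfolding I0[abs_def] by (simp add: LIMSEQ_const_iff)
    moreover have "integrable ?L (\<lambda>(x,z). D x * ?e z * of_real (\<phi> x))"
      by (rule Bochner_Integration.integrable_bound[OF iDe]) (auto simp: dom simp del: norm_mult)
    then have "(integral\<^sup>L ?L (\<lambda>(x,z). D x * ?e z * of_real (\<phi> x))) = (LINT x|lborel. (LINT z|lborel. D x * ?e z * of_real (\<phi> x)))"
      using lborel_pair.integral_fst'[of "\<lambda>(x,z). D x * ?e z * of_real (\<phi> x)"] by simp
    moreover have "(LINT z|lborel. D x * ?e z * of_real (\<phi> x)) = (D x * of_real (\<phi> x)) * (LINT z|lborel. ?e z)" for x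
      unfolding integral_mult_right_zero[symmetric] by (simp only: mult_ac)
    ultimately have "(LINT x|lborel. D x * of_real (\<phi> x)) * (LINT z|lborel. ?e z) = 0"
      by (simp only: integral_mult_left_zero)
    moreover have "(LINT z|lborel. ?e z) \<noteq> 0"
      using gaussian_fourier(1)[of "1/4" "0::'a"] by simp
    ultimately show ?thesis by simp
  qed
  show ?thesis
  proof (rule AE_eq_0_if_closed_integrals_0[OF D])
    fix F :: "'a set" assume F: "closed F"
    show "(LINT x:F|lborel. D x) = 0"
    proof (cases "F = {}")
      case False
      \<comment> \<open>The distance factor tends to the indicator of F because F is closed. The
        Gaussian factor makes \<phi> integrable, as \<open>step2\<close> requires, and tends to
        1.\<close>
      define \<phi> where "\<phi> j x = max 0 (1 - real j * infdist x F) * exp (- (1 / real (Suc j)) * (norm x)\<^sup>2)" for j x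
      have \<phi>01: "0 \<le> \<phi> j x" "\<phi> j x \<le> exp (- (1 / real (Suc j)) * (norm x)\<^sup>2)" for j x
        using infdist_nonneg[of x F] by (auto simp: \<phi>_def max_def intro!: mult_left_le_one_le)
      have \<phi>1: "\<bar>\<phi> j x\<bar> \<le> 1" for j x
        using \<phi>01[of j x] by (auto elim!: order_trans)
      have c: "continuous_on UNIV (\<phi> j)" for j
        unfolding \<phi>_def by (intro continuous_intros) auto
      have [measurable]: "\<phi> j \<in> borel_measurable borel" for j
        using c by (rule borel_measurable_continuous_onI)
      have i: "integrable lborel (\<phi> j)" for j
        by (rule Bochner_Integration.integrable_bound[OF integrable_gaussian[of "1 / real (Suc j)"]])
           (use \<phi>01[of j] in auto)
      have "(\<lambda>j. LINT x|lborel. D x * of_real (\<phi> j x)) \<longlonglongrightarrow> (LINT x|lborel. indicator F x *\<^sub>R D x)"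
      proof (rule integral_dominated_convergence[where w = "\<lambda>x. norm (D x)"])
        show "AE x in lborel. (\<lambda>j. D x * of_real (\<phi> j x)) \<longlonglongrightarrow> indicator F x *\<^sub>R D x"
        proof (rule AE_I2)
          fix x :: 'a
          have e: "(\<lambda>j. exp (- (1 / real (Suc j)) * (norm x)\<^sup>2)) \<longlonglongrightarrow> exp (- 0 * (norm x)\<^sup>2)"
            by (intro tendsto_intros) (use LIMSEQ_inverse_real_of_nat in \<open>simp add: divide_inverse\<close>)
          have "(\<lambda>j. max 0 (1 - real j * infdist x F)) \<longlonglongrightarrow> indicator F x"
          proof (cases "x \<in> F")
            case True then show ?thesis by simp
          next
            case nx: False
            then have "0 < infdist x F" using F False infdist_pos_not_in_closed by blast
            then have "filterlim (\<lambda>j. real j * infdist x F) at_top sequentially"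
              by (intro filterlim_at_top_mult_tendsto_pos[OF tendsto_const _ filterlim_real_sequentially])
            then have "\<forall>\<^sub>F j in sequentially. 1 \<le> real j * infdist x F" by (simp add: filterlim_at_top)
            then have "\<forall>\<^sub>F j in sequentially. max 0 (1 - real j * infdist x F) = indicator F x"
              by eventually_elim (use nx in auto)
            then show ?thesis by (rule tendsto_eventually)
          qed
          from tendsto_mult[OF this e] have "(\<lambda>j. \<phi> j x) \<longlonglongrightarrow> indicator F x" by (simp add: \<phi>_def)
          from tendsto_mult[OF tendsto_const tendsto_of_real[OF this], of "D x"]
          show "(\<lambda>j. D x * of_real (\<phi> j x)) \<longlonglongrightarrow> indicator F x *\<^sub>R D x"
            by (simp add: scaleR_conv_of_real mult.commute)
        qed
        show "AE x in lborel. norm (D x * of_real (\<phi> j x)) \<le> norm (D x)" for j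
          using \<phi>1[of j] by (auto simp: norm_mult mult_left_le)
        have [measurable]: "F \<in> sets borel" using F by simp
        show "(\<lambda>x. indicator F x *\<^sub>R D x) \<in> borel_measurable lborel" by measurable
      qed (use D in auto)
      then show ?thesis
        unfolding step2[OF c i \<phi>1] set_lebesgue_integral_def by (simp add: LIMSEQ_const_iff)
    qed (simp add: set_lebesgue_integral_def)
  qed
qed

section \<open>Consequences of Gaussian decay\<close>

text \<open>For A > a one has A = A^(1-p) A^p with a nonpositive exponent 1 - p. No conjugate
  exponent enters, so p = 1 is covered, and a stays free to be tuned later.\<close>

lemma young_split:
  fixes A a p :: real
  assumes "0 \<le> A" "0 < a" "1 \<le> p"
  shows "A \<le> a + a powr (1 - p) * A powr p"
proof (cases "A \<le> a")
  case True
  have "0 \<le> a powr (1 - p) * A powr p" by simp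
  with True show ?thesis by linarith
next
  case False
  then have "A powr (1 - p) \<le> a powr (1 - p)" using assms by (intro powr_mono2') auto
  then have "A powr (1 - p) * A powr p \<le> a powr (1 - p) * A powr p" by (intro mult_right_mono) auto
  moreover have "A powr (1 - p) * A powr p = A" using False assms by (simp add: powr_add[symmetric])
  ultimately show ?thesis using assms by linarith
qed

text \<open>From (1 + r)^k \<le> exp (k r), half of the Gaussian absorbs the linear exponent by
  completing the square and the other half survives.\<close>

lemma powr_exp_gaussian_bound:
  fixes r k R a :: real
  assumes "0 \<le> r" "0 \<le> k" "0 < a"
  shows "(1 + r) powr k * exp (R * r - a * r\<^sup>2) \<le> exp ((k + R)\<^sup>2 / (2 * a)) * exp (- (a / 2) * r\<^sup>2)"
proof -
  have "(1 + r) powr k \<le> exp r powr k"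
    using assms exp_ge_add_one_self[of r] by (intro powr_mono2) auto
  then have "(1 + r) powr k * exp (R * r - a * r\<^sup>2) \<le> exp (k * r) * exp (R * r - a * r\<^sup>2)"
    by (intro mult_right_mono) (auto simp: exp_powr_real mult.commute)
  also have "\<dots> = exp ((k + R) * r - (a / 2) * r\<^sup>2) * exp (- (a / 2) * r\<^sup>2)"
    by (simp add: exp_add[symmetric] algebra_simps)
  also have "(k + R) * r - (a / 2) * r\<^sup>2 \<le> (k + R)\<^sup>2 / (2 * a)"
  proof -
    have "0 \<le> (a * r - (k + R))\<^sup>2" by simp
    then show ?thesis using assms by (simp add: field_simps power2_eq_square)
  qed
  then have "exp ((k + R) * r - (a / 2) * r\<^sup>2) * exp (- (a / 2) * r\<^sup>2) \<le> exp ((k + R)\<^sup>2 / (2 * a)) * exp (- (a / 2) * r\<^sup>2)"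
    by (intro mult_right_mono) auto
  finally show ?thesis .
qed

text \<open>Condition (i) with s = t for a Borel function; a Lebesgue measurable function is
  replaced by a Borel representative before entering the locale.\<close>

locale gaussian_decaying =
  fixes f :: "'a::euclidean_space \<Rightarrow> complex" and p t k :: real
  assumes f_meas [measurable]: "f \<in> borel_measurable borel"
    and p: "1 \<le> p" and t: "0 < t" and k: "0 \<le> k"
    and decay: "(\<integral>\<^sup>+x. ennreal (norm (f x) powr p * exp (p / (4 * t) * (norm x)\<^sup>2) / (1 + norm x) powr k)
        \<partial>lborel) < \<infinity>"
begin

definition \<Phi> where "\<Phi> x = norm (f x) powr p * exp (p / (4 * t) * (norm x)\<^sup>2) / (1 + norm x) powr k"

lemma \<Phi>_nonneg: "0 \<le> \<Phi> x" by (simp add: \<Phi>_def)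

lemma \<Phi>_meas [measurable]: "\<Phi> \<in> borel_measurable borel"
  unfolding \<Phi>_def by measurable

lemma \<Phi>_integrable: "integrable lborel \<Phi>"
  by (intro integrableI_nonneg) (use decay in \<open>auto simp: \<Phi>_nonneg \<Phi>_def\<close>)

lemma nn_\<Phi>: "(\<integral>\<^sup>+x. ennreal (\<Phi> x) \<partial>lborel) = ennreal (LINT x|lborel. \<Phi> x)"
  by (rule nn_integral_eq_integral[OF \<Phi>_integrable]) (simp add: \<Phi>_nonneg)

text \<open>\<open>young_split\<close> for A = |f| exp (|x|^2 / (4 t)): the Gaussian weight in (i)
  is exactly the one for which A^p equals the integrand times (1 + |x|)^k.\<close>

lemma norm_f_le:
  assumes a: "0 < a"
  shows "norm (f x) * exp ((norm x)\<^sup>2 / (4 * t)) \<le> a + a powr (1 - p) * (\<Phi> x * (1 + norm x) powr k)"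
proof -
  have "0 < 1 + norm x" by (simp add: add_pos_nonneg)
  then have "0 < (1 + norm x) powr k" by simp
  moreover have "exp (p / (4 * t) * (norm x)\<^sup>2) = exp ((norm x)\<^sup>2 / (4 * t)) powr p"
    by (simp add: exp_powr_real mult.commute)
  ultimately have "\<Phi> x * (1 + norm x) powr k = (norm (f x) * exp ((norm x)\<^sup>2 / (4 * t))) powr p"
    by (simp add: \<Phi>_def powr_mult)
  then show ?thesis using young_split[of "norm (f x) * exp ((norm x)\<^sup>2 / (4 * t))" a p] a p by simp
qed

text \<open>With Young parameter 1, the remaining factor exp (R |x| - |x|^2 / (4 t)) makes the first
  term Gaussian and absorbs the weight (1 + |x|)^k in the second.\<close>

lemma integrable_exp:
  assumes "0 \<le> R"
  shows "integrable lborel (\<lambda>x. norm (f x) * exp (R * norm x))"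
proof (rule Bochner_Integration.integrable_bound)
  let ?C = "exp ((k + R)\<^sup>2 / (2 * (1 / (4 * t))))"
  show "integrable lborel (\<lambda>x. ?C * exp (- (1 / (4 * t) / 2) * (norm x)\<^sup>2) + ?C * \<Phi> x)"
    using t by (intro Bochner_Integration.integrable_add integrable_mult_right integrable_gaussian \<Phi>_integrable) auto
  show "AE x in lborel. norm (norm (f x) * exp (R * norm x)) \<le> norm (?C * exp (- (1 / (4 * t) / 2) * (norm x)\<^sup>2) + ?C * \<Phi> x)"
  proof (rule AE_I2)
    fix x :: 'a
    let ?e = "exp (R * norm x - 1 / (4 * t) * (norm x)\<^sup>2)"
    have b: "(1 + norm x) powr k * ?e \<le> ?C * exp (- (1 / (4 * t) / 2) * (norm x)\<^sup>2)"
      using t k by (intro powr_exp_gaussian_bound) auto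
    have one: "1 \<le> (1 + norm x) powr k" using k by (intro ge_one_powr_ge_zero) auto
    then have b1: "?e \<le> ?C * exp (- (1 / (4 * t) / 2) * (norm x)\<^sup>2)"
    proof -
      have "1 * ?e \<le> (1 + norm x) powr k * ?e" using one by (intro mult_right_mono) simp_all
      with b show ?thesis by linarith
    qed
    have "?C * exp (- (1 / (4 * t) / 2) * (norm x)\<^sup>2) \<le> ?C * 1" using t by (intro mult_left_mono) auto
    then have b2: "(1 + norm x) powr k * ?e \<le> ?C" using b by linarith
    have "norm (f x) * exp (R * norm x) = (norm (f x) * exp ((norm x)\<^sup>2 / (4 * t))) * ?e"
      by (simp add: exp_diff)
    also have "\<dots> \<le> (1 + \<Phi> x * (1 + norm x) powr k) * ?e"
      using norm_f_le[of 1 x] by (intro mult_right_mono) auto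
    also have "\<dots> = ?e + \<Phi> x * ((1 + norm x) powr k * ?e)" by (simp add: algebra_simps)
    also have "\<dots> \<le> ?C * exp (- (1 / (4 * t) / 2) * (norm x)\<^sup>2) + \<Phi> x * ?C"
      using b1 b2 \<Phi>_nonneg by (intro add_mono mult_left_mono) auto
    finally show "norm (norm (f x) * exp (R * norm x)) \<le> norm (?C * exp (- (1 / (4 * t) / 2) * (norm x)\<^sup>2) + ?C * \<Phi> x)"
      by (simp add: mult.commute)
  qed
qed measurable

lemma integrable_f: "integrable lborel f"
  using integrable_exp[of 0] by (simp add: integrable_norm_iff)

text \<open>The contribution of the second Young term to the integral of |f| exp (v . x), without
  the factor exp (t |v|^2) that arises from completing the square: the function \<Phi> (1 + |x|)^k
  smoothed by a Gaussian centred at 2 t v.\<close>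

definition V :: "'a \<Rightarrow> ennreal" where
  "V v = (\<integral>\<^sup>+x. ennreal (\<Phi> x * ((1 + norm x) powr k * exp (- ((norm (x - (2 * t) *\<^sub>R v))\<^sup>2) / (4 * t)))) \<partial>lborel)"

lemma V_meas [measurable]: "V \<in> borel_measurable borel"
  unfolding V_def[abs_def] by measurable

text \<open>Peetre's inequality: the weight at x is bounded by the weight at the centre 2 t v times
  the weight of the displacement.\<close>

lemma one_plus_norm_split: "1 + norm x \<le> (1 + 2 * t * norm v) * (1 + norm (x - (2 * t) *\<^sub>R v))"
proof -
  have "norm x \<le> norm ((2 * t) *\<^sub>R v) + norm (x - (2 * t) *\<^sub>R v)" by (metis add.commute diff_add_cancel norm_triangle_ineq)
  also have "norm ((2 * t) *\<^sub>R v) = 2 * t * norm v" using t by simp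
  finally have "norm x \<le> 2 * t * norm v + norm (x - (2 * t) *\<^sub>R v)" .
  moreover have "0 \<le> 2 * t * norm v * norm (x - (2 * t) *\<^sub>R v)" using t by simp
  ultimately show ?thesis by (simp add: algebra_simps)
qed

text \<open>The weight is moved to the centre of the Gaussian, which absorbs the weight of the
  displacement; completing the square there produces exp (2 t k^2). This is the crude pointwise
  bound.\<close>

lemma V_le: "V v \<le> ennreal (exp (2 * t * k\<^sup>2) * (LINT x|lborel. \<Phi> x) * (1 + 2 * t * norm v) powr k)"
proof -
  have "\<Phi> x * ((1 + norm x) powr k * exp (- ((norm (x - (2 * t) *\<^sub>R v))\<^sup>2) / (4 * t)))
      \<le> exp (2 * t * k\<^sup>2) * (1 + 2 * t * norm v) powr k * \<Phi> x" for x
  proof -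
    let ?w = "norm (x - (2 * t) *\<^sub>R v)"
    have "(1 + norm x) powr k \<le> ((1 + 2 * t * norm v) * (1 + ?w)) powr k"
      using one_plus_norm_split k by (intro powr_mono2) auto
    also have "\<dots> = (1 + 2 * t * norm v) powr k * (1 + ?w) powr k" using t by (simp add: powr_mult)
    finally have "(1 + norm x) powr k * exp (- (?w\<^sup>2) / (4 * t)) \<le> (1 + 2 * t * norm v) powr k * ((1 + ?w) powr k * exp (0 * ?w - 1 / (4 * t) * ?w\<^sup>2))"
      using mult_right_mono by (simp add: mult.assoc[symmetric])
    also have "(1 + ?w) powr k * exp (0 * ?w - 1 / (4 * t) * ?w\<^sup>2) \<le> exp ((k + 0)\<^sup>2 / (2 * (1 / (4 * t)))) * exp (- (1 / (4 * t) / 2) * ?w\<^sup>2)"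
      using t k by (intro powr_exp_gaussian_bound) auto
    then have "(1 + ?w) powr k * exp (0 * ?w - 1 / (4 * t) * ?w\<^sup>2) \<le> exp ((k + 0)\<^sup>2 / (2 * (1 / (4 * t)))) * 1"
      using t by (elim order_trans, intro mult_left_mono) auto
    then have "(1 + 2 * t * norm v) powr k * ((1 + ?w) powr k * exp (0 * ?w - 1 / (4 * t) * ?w\<^sup>2)) \<le> (1 + 2 * t * norm v) powr k * exp (2 * t * k\<^sup>2)"
      by (intro mult_left_mono) (auto simp: mult_ac)
    finally have "\<Phi> x * ((1 + norm x) powr k * exp (- (?w\<^sup>2) / (4 * t))) \<le> \<Phi> x * ((1 + 2 * t * norm v) powr k * exp (2 * t * k\<^sup>2))"
      by (intro mult_left_mono) (auto simp: \<Phi>_nonneg)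
    then show ?thesis by (simp add: mult_ac)
  qed
  then have "V v \<le> (\<integral>\<^sup>+x. ennreal (exp (2 * t * k\<^sup>2) * (1 + 2 * t * norm v) powr k) * ennreal (\<Phi> x) \<partial>lborel)"
    unfolding V_def by (intro nn_integral_mono) (auto simp: ennreal_mult[symmetric] \<Phi>_nonneg intro!: ennreal_leI)
  also have "\<dots> = ennreal (exp (2 * t * k\<^sup>2) * (1 + 2 * t * norm v) powr k) * ennreal (LINT x|lborel. \<Phi> x)"
    unfolding nn_\<Phi>[symmetric] by (rule nn_integral_cmult) measurable
  also have "\<dots> = ennreal (exp (2 * t * k\<^sup>2) * (LINT x|lborel. \<Phi> x) * (1 + 2 * t * norm v) powr k)"
    by (simp add: ennreal_mult[symmetric] integral_nonneg_AE \<Phi>_nonneg mult_ac)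
  finally show ?thesis .
qed

text \<open>In polar coordinates this is the integral of |v|^(-k) V(v) over |v| \<ge> 1. There
  |v|^(-k) cancels the growth of the weight at the centre, leaving a Gaussian in v - x / (2 t).
  Integrating first over v gives a constant times the finite integral of \<Phi>, with no power of
  |v| lost.\<close>

lemma V_tail:
  "(\<integral>\<^sup>+r. indicator {1..} r * ennreal (r powr (real DIM('a) - 1 - k)) * (\<integral>\<^sup>+\<omega>. V (r *\<^sub>R \<omega>) \<partial>sphere_measure) \<partial>lborel) < \<infinity>"
proof -
  \<comment> \<open>The Gaussian majorant in the shifted variable \<open>?u x v\<close>. The factor
    (1 + 2 t)^k comes from 1 + 2 t |v| \<le> (1 + 2 t) |v| for |v| \<ge> 1.\<close>
  let ?q = "\<lambda>v::'a. (1 + 2 * t) powr k * (exp (2 * t * k\<^sup>2) * exp (- (t / 2) * (norm v)\<^sup>2))"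
  let ?u = "\<lambda>x v. v - (1 / (2 * t)) *\<^sub>R x"
  let ?W = "\<lambda>r. \<integral>\<^sup>+\<omega>. V (r *\<^sub>R \<omega>) \<partial>sphere_measure"
  let ?W1 = "\<lambda>r. \<integral>\<^sup>+\<omega>. indicator {v. 1 \<le> norm v} (r *\<^sub>R \<omega>) * ennreal (norm (r *\<^sub>R \<omega>) powr - k) * V (r *\<^sub>R \<omega>) \<partial>sphere_measure"
  let ?d = "real DIM('a) - 1 - k"
  let ?g = "\<lambda>x v. indicator {v. 1 \<le> norm v} v * ennreal (norm v powr - k) * ennreal (\<Phi> x * ((1 + norm x) powr k * exp (- ((norm (x - (2 * t) *\<^sub>R v))\<^sup>2) / (4 * t))))"
  have "(\<integral>\<^sup>+r. indicator {1..} r * ennreal (r powr ?d) * ?W r \<partial>lborel)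
    = (\<integral>\<^sup>+r. indicator {0<..} r * ennreal (r ^ (DIM('a) - 1)) *
        ?W1 r \<partial>lborel)"
  proof (rule nn_integral_cong)
    fix r :: real
    show "indicator {1..} r * ennreal (r powr ?d) * ?W r =
      indicator {0<..} r * ennreal (r ^ (DIM('a) - 1)) *
        ?W1 r"
    proof (cases "0 < r")
      case True
      have "?W1 r
        = (\<integral>\<^sup>+\<omega>. indicator {1..} r * ennreal (r powr - k) * V (r *\<^sub>R \<omega>) \<partial>sphere_measure)"
        using True by (intro nn_integral_cong) (auto simp: indicator_def)
      also have "\<dots> = indicator {1..} r * ennreal (r powr - k) * ?W r"
        by (intro nn_integral_cmult borel_measurable_sphereI) measurable
      finally have 1: "?W1 r
          = indicator {1..} r * ennreal (r powr - k) * ?W r" .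
      have "r ^ (DIM('a) - 1) * r powr - k = r powr ?d"
        using True by (simp add: powr_realpow[symmetric] powr_add[symmetric] of_nat_diff Suc_leI)
      then have 2: "ennreal (r powr ?d) = ennreal (r ^ (DIM('a) - 1)) * ennreal (r powr - k)"
        using True by (simp add: ennreal_mult[symmetric])
      show ?thesis unfolding 1 2 using True by (simp add: mult_ac)
    qed auto
  qed
  also have "\<dots> = (\<integral>\<^sup>+v. indicator {v. 1 \<le> norm v} v * ennreal (norm v powr - k) * V v \<partial>lborel)"
    by (rule nn_integral_polar[symmetric]) measurable
  also have "\<dots> = (\<integral>\<^sup>+v. (\<integral>\<^sup>+x. ?g x v \<partial>lborel) \<partial>lborel)"
    unfolding V_def by (intro nn_integral_cong nn_integral_cmult[symmetric]) measurable
  also have "\<dots> = (\<integral>\<^sup>+x. (\<integral>\<^sup>+v. ?g x v \<partial>lborel) \<partial>lborel)"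
    by (rule lborel_pair.Fubini') measurable
  also have "\<dots> \<le> (\<integral>\<^sup>+x. ennreal (\<Phi> x) * (\<integral>\<^sup>+v. ennreal (?q (?u x v)) \<partial>lborel) \<partial>lborel)"
  proof (rule nn_integral_mono)
    fix x
    have "(\<integral>\<^sup>+v. ?g x v \<partial>lborel) \<le> (\<integral>\<^sup>+v. ennreal (\<Phi> x) * ennreal (?q (?u x v)) \<partial>lborel)"
    proof (rule nn_integral_mono)
      fix v
      let ?w = "norm (x - (2 * t) *\<^sub>R v)"
      have "norm v powr - k * (\<Phi> x * ((1 + norm x) powr k * exp (- (?w\<^sup>2) / (4 * t)))) \<le> \<Phi> x * (?q (?u x v))"
        if v: "1 \<le> norm v"
      proof -
        have "v \<noteq> 0" using v by auto
        have "1 + norm x \<le> ((1 + 2 * t) * norm v) * (1 + ?w)"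
        proof (rule order_trans[OF one_plus_norm_split[of x v]], rule mult_right_mono)
          show "1 + 2 * t * norm v \<le> (1 + 2 * t) * norm v" using v by (simp add: algebra_simps)
        qed simp
        then have "(1 + norm x) powr k \<le> (((1 + 2 * t) * norm v) * (1 + ?w)) powr k"
          using k by (intro powr_mono2) auto
        also have "\<dots> = (1 + 2 * t) powr k * norm v powr k * (1 + ?w) powr k" using t by (simp add: powr_mult)
        finally have "norm v powr - k * (1 + norm x) powr k \<le> norm v powr - k * ((1 + 2 * t) powr k * norm v powr k * (1 + ?w) powr k)"
          by (intro mult_left_mono) auto
        also have "\<dots> = (1 + 2 * t) powr k * (1 + ?w) powr k"
          using v \<open>v \<noteq> 0\<close> by (simp add: powr_minus field_simps)
        finally have 1: "norm v powr - k * (1 + norm x) powr k \<le> (1 + 2 * t) powr k * (1 + ?w) powr k" .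
        have "(1 + ?w) powr k * exp (0 * ?w - 1 / (4 * t) * ?w\<^sup>2) \<le> exp ((k + 0)\<^sup>2 / (2 * (1 / (4 * t)))) * exp (- (1 / (4 * t) / 2) * ?w\<^sup>2)"
          using t k by (intro powr_exp_gaussian_bound) auto
        also have "?w = 2 * t * norm (?u x v)"
        proof -
          have "x - (2 * t) *\<^sub>R v = (- (2 * t)) *\<^sub>R (?u x v)" using t by (simp add: algebra_simps)
          then have "?w = \<bar>- (2 * t)\<bar> * norm (?u x v)" by (simp only: norm_scaleR)
          then show ?thesis using t by simp
        qed
        then have "- (1 / (4 * t) / 2) * ?w\<^sup>2 = - (t / 2) * (norm (?u x v))\<^sup>2"
          using t by (simp add: power_mult_distrib power2_eq_square)
        finally have 2: "(1 + ?w) powr k * exp (- (?w\<^sup>2) / (4 * t)) \<le> exp (2 * t * k\<^sup>2) * exp (- (t / 2) * (norm (?u x v))\<^sup>2)"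
          by (simp add: mult_ac)
        have "norm v powr - k * (\<Phi> x * ((1 + norm x) powr k * exp (- (?w\<^sup>2) / (4 * t)))) = \<Phi> x * ((norm v powr - k * (1 + norm x) powr k) * exp (- (?w\<^sup>2) / (4 * t)))"
          by (simp only: mult_ac)
        also have "\<dots> \<le> \<Phi> x * (((1 + 2 * t) powr k * (1 + ?w) powr k) * exp (- (?w\<^sup>2) / (4 * t)))"
          by (intro mult_left_mono mult_right_mono 1 \<Phi>_nonneg) auto
        also have "\<dots> = \<Phi> x * ((1 + 2 * t) powr k * ((1 + ?w) powr k * exp (- (?w\<^sup>2) / (4 * t))))"
          by (simp only: mult_ac)
        also have "\<dots> \<le> \<Phi> x * (?q (?u x v))"
          by (intro mult_left_mono 2 \<Phi>_nonneg) auto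
        finally show ?thesis .
      qed
      then show "?g x v \<le> ennreal (\<Phi> x) * ennreal (?q (?u x v))"
        by (auto simp: indicator_def ennreal_mult[symmetric] \<Phi>_nonneg intro!: ennreal_leI)
    qed
    also have "\<dots> = ennreal (\<Phi> x) * (\<integral>\<^sup>+v. ennreal (?q (?u x v)) \<partial>lborel)"
      by (rule nn_integral_cmult) measurable
    finally show "(\<integral>\<^sup>+v. ?g x v \<partial>lborel) \<le> \<dots>" .
  qed
  also have "\<dots> = (\<integral>\<^sup>+x. ennreal (\<Phi> x) * (\<integral>\<^sup>+v. ennreal (?q v) \<partial>lborel) \<partial>lborel)"
  proof (rule nn_integral_cong)
    fix x
    show "ennreal (\<Phi> x) * (\<integral>\<^sup>+v. ennreal (?q (?u x v)) \<partial>lborel) =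
      ennreal (\<Phi> x) * (\<integral>\<^sup>+v. ennreal (?q v) \<partial>lborel)"
      by (subst nn_integral_lborel_affine[of _ 1 "(1 / (2 * t)) *\<^sub>R x"]) auto
  qed
  also have "\<dots> = (\<integral>\<^sup>+x. ennreal (\<Phi> x) \<partial>lborel) * (\<integral>\<^sup>+v. ennreal (?q v) \<partial>lborel)"
    by (rule nn_integral_multc) measurable
  also have "\<dots> < \<infinity>"
  proof -
    have "integrable lborel (\<lambda>v::'a. (1 + 2 * t) powr k * (exp (2 * t * k\<^sup>2) * exp (- (t / 2) * (norm v)\<^sup>2)))"
      using t by (intro integrable_mult_right integrable_gaussian) auto
    then have "(\<integral>\<^sup>+v. ennreal (?q v) \<partial>lborel) < \<infinity>"
      by (subst nn_integral_eq_integral) auto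
    then show ?thesis unfolding nn_\<Phi> by (simp add: ennreal_mult_less_top)
  qed
  finally show ?thesis .
qed

end

lemma space_pair_sphere: "q \<in> space (M \<Otimes>\<^sub>M sphere_measure) \<Longrightarrow> norm (snd q) = 1"
  by (auto simp: space_pair_measure)

lemma pair_sigma_finite_lborel_sphere:
  "pair_sigma_finite (lborel :: 'b::euclidean_space measure) (sphere_measure :: 'a::euclidean_space measure)"
proof -
  interpret sph: finite_measure "sphere_measure :: 'a measure" by (rule finite_measure_sphere)
  show ?thesis by (intro pair_sigma_finite.intro lborel.sigma_finite_measure_axioms sph.sigma_finite_measure_axioms)
qed

lemma measurable_snd_sphere [measurable]: "snd \<in> M \<Otimes>\<^sub>M sphere_measure \<rightarrow>\<^sub>M borel"
  by (rule measurable_to_sphere) (rule measurable_snd)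

text \<open>A finite value B is refuted by an interval of logarithmic length B + 1. The divergence
  at infinity excludes a nonconstant polynomial, the one at 0 a nonzero coefficient for m >
  0.\<close>

lemma not_nn_integrable_inverse:
  fixes a :: real
  assumes "0 < a"
  shows "(\<integral>\<^sup>+r. indicator {a..} r * ennreal (1 / r) \<partial>lborel) = \<infinity>"
    and "(\<integral>\<^sup>+r. indicator {0<..a} r * ennreal (1 / r) \<partial>lborel) = \<infinity>"
proof -
  have fin: "(\<integral>\<^sup>+r. ennreal (1 / r) * indicator {x..y} r \<partial>lborel) = ennreal (ln y - ln x)" if "0 < x" "x \<le> y" for x y :: real
    by (rule nn_integral_FTC_Icc) (use that in \<open>auto intro!: derivative_eq_intros simp: divide_simps\<close>)
  show "(\<integral>\<^sup>+r. indicator {a..} r * ennreal (1 / r) \<partial>lborel) = \<infinity>"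
  proof (rule ccontr)
    assume "\<not> ?thesis"
    then obtain B where B: "0 \<le> B" "(\<integral>\<^sup>+r. indicator {a..} r * ennreal (1 / r) \<partial>lborel) = ennreal B"
      by (cases "\<integral>\<^sup>+r. indicator {a..} r * ennreal (1 / r) \<partial>lborel") auto
    have "ennreal (ln (a * exp (B + 1)) - ln a) \<le> ennreal B"
      unfolding B(2)[symmetric]
    proof (subst fin[symmetric])
      show "0 < a" using assms by simp
      then show "(\<integral>\<^sup>+r. ennreal (1 / r) * indicator {a..a * exp (B + 1)} r \<partial>lborel) \<le> (\<integral>\<^sup>+r. indicator {a..} r * ennreal (1 / r) \<partial>lborel)"
        by (intro nn_integral_mono) (auto simp: indicator_def)
      show "a \<le> a * exp (B + 1)" using assms B by simp
    qed
    then show False using assms B by (simp add: ln_mult)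
  qed
  show "(\<integral>\<^sup>+r. indicator {0<..a} r * ennreal (1 / r) \<partial>lborel) = \<infinity>"
  proof (rule ccontr)
    assume "\<not> ?thesis"
    then obtain B where B: "0 \<le> B" "(\<integral>\<^sup>+r. indicator {0<..a} r * ennreal (1 / r) \<partial>lborel) = ennreal B"
      by (cases "\<integral>\<^sup>+r. indicator {0<..a} r * ennreal (1 / r) \<partial>lborel") auto
    have "ennreal (ln a - ln (a / exp (B + 1))) \<le> ennreal B"
      unfolding B(2)[symmetric]
    proof (subst fin[symmetric])
      show "0 < a / exp (B + 1)" using assms by simp
      then show "(\<integral>\<^sup>+r. ennreal (1 / r) * indicator {a / exp (B + 1)..a} r \<partial>lborel) \<le> (\<integral>\<^sup>+r. indicator {0<..a} r * ennreal (1 / r) \<partial>lborel)"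
        by (intro nn_integral_mono) (auto simp: indicator_def)
      show "a / exp (B + 1) \<le> a" using assms B by (simp add: divide_le_eq)
    qed
    then show False using assms B by (simp add: ln_div)
  qed
qed

text \<open>Write q(z) = a + z q'(z) with q' nonzero. Being constant or unbounded at infinity, q'
  stays away from 0 there, so |q| grows at least linearly.\<close>

lemma poly_lower_bound:
  fixes q :: "complex poly"
  assumes "degree q \<noteq> 0"
  shows "\<exists>c>0. \<exists>R\<ge>1. \<forall>z. R \<le> norm z \<longrightarrow> c * norm z \<le> norm (poly q z)"
proof -
  obtain a q' where q: "q = pCons a q'" by (cases q)
  then have "q' \<noteq> 0" using assms by auto
  note q = q this
  have "\<exists>d>0. \<exists>r. \<forall>z. r \<le> norm z \<longrightarrow> d \<le> norm (poly q' z)"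
  proof (cases "degree q' = 0")
    case True
    then obtain b where "q' = [:b:]" by (metis degree_eq_zeroE)
    then show ?thesis using q by (intro exI[of _ "norm b"]) auto
  next
    case False
    obtain b q'' where qq: "q' = pCons b q''" by (cases q')
    then have "q'' \<noteq> 0" using False by auto
    note qq = qq this
    obtain r where "\<forall>z. r \<le> norm z \<longrightarrow> 1 \<le> norm (poly (pCons b q'') z)"
      using poly_infinity[OF qq(2)] by blast
    then show ?thesis using qq by (intro exI[of _ 1]) auto
  qed
  then obtain d r where d: "0 < d" "\<And>z. r \<le> norm z \<Longrightarrow> d \<le> norm (poly q' z)" by blast
  have "d / 2 * norm z \<le> norm (poly q z)" if z: "max 1 (max r (2 * norm a / d)) \<le> norm z" for z
  proof -
    have "d * norm z \<le> norm (poly q' z) * norm z" using d z by (intro mult_right_mono) auto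
    also have "\<dots> = norm (poly q z - a)" by (simp add: q(1) norm_mult mult.commute)
    also have "\<dots> \<le> norm (poly q z) + norm a" by (rule norm_triangle_ineq4)
    also have "norm a \<le> d / 2 * norm z" using z d by (simp add: field_simps)
    finally show ?thesis by (simp add: field_simps)
  qed
  then show ?thesis using d(1) by (intro exI[of _ "d / 2"] conjI exI[of _ "max 1 (max r (2 * norm a / d))"]) auto
qed

section \<open>The entire function of a weight on the sphere\<close>

context gaussian_decaying
begin

text \<open>A single integral over the product space, in the form required by
  \<open>entire_exp_integral\<close>. At a positive real r it is the integral in
  \<open>harmonic_coeff\<close>, up to the normalising constant of the Fourier transform.\<close>

definition G :: "('a \<Rightarrow> complex) \<Rightarrow> complex \<Rightarrow> complex" where
  "G P z = (LINT q|(lborel \<Otimes>\<^sub>M sphere_measure). f (fst q) * P (snd q) * exp (- \<i> * (z * of_real (fst q \<bullet> snd q))))"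

context
  fixes P :: "'a \<Rightarrow> complex" and B :: real
  assumes P_meas [measurable]: "P \<in> borel_measurable borel"
    and P_bound: "\<And>\<omega>. norm \<omega> = 1 \<Longrightarrow> norm (P \<omega>) \<le> B"
begin

lemma B_nonneg: "0 \<le> B"
proof -
  obtain b :: 'a where "b \<in> Basis" using nonempty_Basis by blast
  then show ?thesis using P_bound[of b] norm_ge_zero[of "P b"] by (auto intro: order_trans[OF norm_ge_zero])
qed

lemma dominated_integrable:
  assumes R: "0 \<le> R"
  shows "integrable (lborel \<Otimes>\<^sub>M sphere_measure) (\<lambda>q. norm (f (fst q) * P (snd q)) * exp (R * \<bar>fst q \<bullet> snd q\<bar>))"
proof -
  interpret pair_sigma_finite "lborel :: 'a measure" "sphere_measure :: 'a measure"
    by (rule pair_sigma_finite_lborel_sphere)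
  interpret sph: finite_measure "sphere_measure :: 'a measure" by (rule finite_measure_sphere)
  have "integrable (lborel \<Otimes>\<^sub>M sphere_measure) (\<lambda>(x, \<omega>::'a). complex_of_real (norm (f x) * exp (R * norm x)) * of_real B)"
  proof (rule integrable_pair_mult)
    show "integrable lborel (\<lambda>x. complex_of_real (norm (f x) * exp (R * norm x)))"
      using integrable_exp[OF R] by (rule integrable_of_real)
  qed simp
  then show ?thesis
  proof (rule Bochner_Integration.integrable_bound)
    show "AE q in lborel \<Otimes>\<^sub>M sphere_measure. norm (norm (f (fst q) * P (snd q)) * exp (R * \<bar>fst q \<bullet> snd q\<bar>))
       \<le> norm (case q of (x, \<omega>) \<Rightarrow> complex_of_real (norm (f x) * exp (R * norm x)) * of_real B)"
    proof (rule AE_I2)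
      fix q :: "'a \<times> 'a" assume "q \<in> space (lborel \<Otimes>\<^sub>M sphere_measure)"
      then have n: "norm (snd q) = 1" by (rule space_pair_sphere)
      have "\<bar>fst q \<bullet> snd q\<bar> \<le> norm (fst q)" using Cauchy_Schwarz_ineq2[of "fst q" "snd q"] n by simp
      then have "R * \<bar>fst q \<bullet> snd q\<bar> \<le> R * norm (fst q)" using R by (rule mult_left_mono)
      then have "norm (f (fst q)) * norm (P (snd q)) * exp (R * \<bar>fst q \<bullet> snd q\<bar>) \<le> norm (f (fst q)) * B * exp (R * norm (fst q))"
        using P_bound[OF n] B_nonneg by (intro mult_mono) auto
      then show "norm (norm (f (fst q) * P (snd q)) * exp (R * \<bar>fst q \<bullet> snd q\<bar>))
       \<le> norm (case q of (x, \<omega>) \<Rightarrow> complex_of_real (norm (f x) * exp (R * norm x)) * of_real B)"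
        using B_nonneg by (simp add: case_prod_unfold norm_mult mult_ac)
    qed
  qed measurable
qed

lemma G_holomorphic: "G P holomorphic_on UNIV"
  unfolding G_def[abs_def]
  by (rule entire_exp_integral[OF _ _ dominated_integrable]) measurable

lemma norm_integrand:
  "norm (f x * P \<omega> * exp (- \<i> * (z * of_real (x \<bullet> \<omega>)))) = norm (f x * P \<omega>) * exp (Im z * (x \<bullet> \<omega>))"
  by (simp add: norm_mult)

lemma G_integrable:
  "integrable (lborel \<Otimes>\<^sub>M sphere_measure) (\<lambda>q. f (fst q) * P (snd q) * exp (- \<i> * (z * of_real (fst q \<bullet> snd q))))"
proof (rule Bochner_Integration.integrable_bound[OF dominated_integrable[of "\<bar>Im z\<bar>"]])
  show "AE q in lborel \<Otimes>\<^sub>M sphere_measure. norm (f (fst q) * P (snd q) * exp (- \<i> * (z * of_real (fst q \<bullet> snd q))))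
     \<le> norm (norm (f (fst q) * P (snd q)) * exp (\<bar>Im z\<bar> * \<bar>fst q \<bullet> snd q\<bar>))"
    unfolding norm_integrand by (intro AE_I2) (auto intro!: mult_left_mono simp: abs_mult[symmetric])
qed auto

lemma G_eq: "G P z = (LINT \<omega>|sphere_measure. (LINT x|lborel. f x * exp (- \<i> * (z * of_real (x \<bullet> \<omega>)))) * P \<omega>)"
proof -
  interpret pair_sigma_finite "lborel :: 'a measure" "sphere_measure :: 'a measure"
    by (rule pair_sigma_finite_lborel_sphere)
  have "G P z = (LINT \<omega>|sphere_measure. (LINT x|lborel. f x * P \<omega> * exp (- \<i> * (z * of_real (x \<bullet> \<omega>)))))"
    using integral_snd[of "\<lambda>x \<omega>. f x * P \<omega> * exp (- \<i> * (z * of_real (x \<bullet> \<omega>)))"] G_integrable[of z]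
    by (simp add: G_def case_prod_unfold)
  also have "\<dots> = (LINT \<omega>|sphere_measure. (LINT x|lborel. f x * exp (- \<i> * (z * of_real (x \<bullet> \<omega>)))) * P \<omega>)"
    unfolding integral_mult_left_zero[symmetric] by (simp only: mult_ac)
  finally show ?thesis .
qed

definition C0 :: real where "C0 = (LINT x|lborel. exp (- (1 / (4 * t)) * (norm (x::'a))\<^sup>2))"

lemma C0_nonneg: "0 \<le> C0" unfolding C0_def by (rule integral_nonneg_AE) simp

lemma nn_C0: "(\<integral>\<^sup>+x. ennreal (exp (- ((norm (x - s))\<^sup>2) / (4 * t))) \<partial>lborel) = ennreal C0" for s :: 'a
proof -
  have "(\<integral>\<^sup>+x. ennreal (exp (- ((norm (x - s))\<^sup>2) / (4 * t))) \<partial>lborel) = (\<integral>\<^sup>+x. ennreal (exp (- (1 / (4 * t)) * (norm (x::'a))\<^sup>2)) \<partial>lborel)"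
    by (subst nn_integral_lborel_affine[of _ 1 s]) auto
  also have "\<dots> = ennreal C0" unfolding C0_def
    using t by (intro nn_integral_eq_integral integrable_gaussian) auto
  finally show ?thesis .
qed

text \<open>With y = Im z and |\<omega>| = 1, the identity y (x . \<omega>) = |x|^2 / (4 t) + t y^2
  - |x - 2 t y \<omega>|^2 / (4 t) supplies the weight needed for \<open>norm_f_le\<close>. The
  parameter a remains free: a = 1 gives the growth of \<open>G\<close>, and a proportional to y
  gives the lower bound for \<open>V\<close>.\<close>

lemma G_bound:
  assumes a: "0 < a"
  shows "ennreal (norm (G P z)) \<le> ennreal (B * exp (t * (Im z)\<^sup>2)) *
     (ennreal (a * C0 * measure sphere_measure (sphere (0::'a) 1)) + ennreal (a powr (1 - p)) * (\<integral>\<^sup>+\<omega>. V (Im z *\<^sub>R \<omega>) \<partial>sphere_measure))"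
proof -
  interpret pair_sigma_finite "lborel :: 'a measure" "sphere_measure :: 'a measure"
    by (rule pair_sigma_finite_lborel_sphere)
  interpret sph: finite_measure "sphere_measure :: 'a measure" by (rule finite_measure_sphere)
  let ?y = "Im z"
  let ?E = "\<lambda>x \<omega>. exp (- ((norm (x - (2 * t) *\<^sub>R (?y *\<^sub>R \<omega>)))\<^sup>2) / (4 * t))"
  have "ennreal (norm (G P z)) \<le> (\<integral>\<^sup>+q. ennreal (norm (f (fst q) * P (snd q) * exp (- \<i> * (z * of_real (fst q \<bullet> snd q))))) \<partial>(lborel \<Otimes>\<^sub>M sphere_measure))"
    unfolding G_def by (rule integral_norm_bound_ennreal[OF G_integrable])
  also have "\<dots> = (\<integral>\<^sup>+\<omega>. \<integral>\<^sup>+x. ennreal (norm (f x * P \<omega>) * exp (?y * (x \<bullet> \<omega>))) \<partial>lborel \<partial>sphere_measure)"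
  proof -
    have m: "(\<lambda>q. ennreal (norm (f (fst q) * P (snd q) * exp (- \<i> * (z * of_real (fst q \<bullet> snd q)))))) \<in> borel_measurable (lborel \<Otimes>\<^sub>M sphere_measure)"
      by measurable
    show ?thesis using nn_integral_snd[OF m] by (simp only: norm_integrand fst_conv snd_conv)
  qed
  also have "\<dots> \<le> (\<integral>\<^sup>+\<omega>. ennreal (B * exp (t * ?y\<^sup>2)) * (ennreal (a * C0) + ennreal (a powr (1 - p)) * V (?y *\<^sub>R \<omega>)) \<partial>sphere_measure)"
  proof (rule nn_integral_mono)
    fix \<omega> :: 'a assume "\<omega> \<in> space sphere_measure"
    then have n: "norm \<omega> = 1" by simp
    have "norm (f x * P \<omega>) * exp (?y * (x \<bullet> \<omega>)) \<le> B * exp (t * ?y\<^sup>2) * (a * ?E x \<omega> + a powr (1 - p) * (\<Phi> x * ((1 + norm x) powr k * ?E x \<omega>)))" for x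
    proof -
      have "(norm (x - (2 * t) *\<^sub>R (?y *\<^sub>R \<omega>)))\<^sup>2 = (norm x)\<^sup>2 - 4 * t * ?y * (x \<bullet> \<omega>) + 4 * t\<^sup>2 * ?y\<^sup>2"
        using n unfolding power2_norm_eq_inner norm_eq_1
        by (simp add: inner_diff_left inner_diff_right inner_commute power2_eq_square algebra_simps)
      then have "?y * (x \<bullet> \<omega>) = (norm x)\<^sup>2 / (4 * t) + t * ?y\<^sup>2 + - ((norm (x - (2 * t) *\<^sub>R (?y *\<^sub>R \<omega>)))\<^sup>2) / (4 * t)"
        using t by (simp only:) (simp add: field_simps power2_eq_square)
      then have e: "exp (?y * (x \<bullet> \<omega>)) = exp ((norm x)\<^sup>2 / (4 * t)) * exp (t * ?y\<^sup>2) * ?E x \<omega>"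
        by (simp only: exp_add)
      have "norm (f x * P \<omega>) * exp (?y * (x \<bullet> \<omega>)) = norm (P \<omega>) * (exp (t * ?y\<^sup>2) * ((norm (f x) * exp ((norm x)\<^sup>2 / (4 * t))) * ?E x \<omega>))"
        unfolding e norm_mult by (simp only: mult_ac)
      also have "\<dots> \<le> B * (exp (t * ?y\<^sup>2) * ((a + a powr (1 - p) * (\<Phi> x * (1 + norm x) powr k)) * ?E x \<omega>))"
        using P_bound[OF n] B_nonneg norm_f_le[OF a, of x] by (intro mult_mono mult_left_mono mult_right_mono) auto
      also have "\<dots> = B * exp (t * ?y\<^sup>2) * (a * ?E x \<omega> + a powr (1 - p) * (\<Phi> x * ((1 + norm x) powr k * ?E x \<omega>)))"
        by (simp add: algebra_simps)
      finally show ?thesis .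
    qed
    then have "(\<integral>\<^sup>+x. ennreal (norm (f x * P \<omega>) * exp (?y * (x \<bullet> \<omega>))) \<partial>lborel)
      \<le> (\<integral>\<^sup>+x. ennreal (B * exp (t * ?y\<^sup>2)) * (ennreal a * ennreal (?E x \<omega>) + ennreal (a powr (1 - p)) * ennreal (\<Phi> x * ((1 + norm x) powr k * ?E x \<omega>))) \<partial>lborel)"
      using a B_nonneg by (intro nn_integral_mono) (simp add: ennreal_mult[symmetric] ennreal_plus[symmetric] \<Phi>_nonneg ennreal_leI del: ennreal_plus)
    also have "\<dots> = ennreal (B * exp (t * ?y\<^sup>2)) * (ennreal a * ennreal C0 + ennreal (a powr (1 - p)) * V (?y *\<^sub>R \<omega>))"
      unfolding V_def nn_C0[of "(2 * t) *\<^sub>R (?y *\<^sub>R \<omega>)", symmetric]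
      by (simp add: nn_integral_cmult nn_integral_add)
    also have "ennreal a * ennreal C0 = ennreal (a * C0)" using a C0_nonneg by (simp add: ennreal_mult)
    finally show "(\<integral>\<^sup>+x. ennreal (norm (f x * P \<omega>) * exp (?y * (x \<bullet> \<omega>))) \<partial>lborel) \<le> ennreal (B * exp (t * ?y\<^sup>2)) * (ennreal (a * C0) + ennreal (a powr (1 - p)) * V (?y *\<^sub>R \<omega>))" .
  qed
  also have "\<dots> = ennreal (B * exp (t * ?y\<^sup>2)) * (ennreal (a * C0) * emeasure sphere_measure (sphere (0::'a) 1) + ennreal (a powr (1 - p)) * (\<integral>\<^sup>+\<omega>. V (?y *\<^sub>R \<omega>) \<partial>sphere_measure))"
  proof -
    have m: "(\<lambda>\<omega>. V (?y *\<^sub>R \<omega>)) \<in> borel_measurable sphere_measure"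
      by (rule borel_measurable_sphereI) measurable
    then show ?thesis by (simp add: nn_integral_cmult nn_integral_add)
  qed
  also have "ennreal (a * C0) * emeasure sphere_measure (sphere (0::'a) 1) = ennreal (a * C0 * measure sphere_measure (sphere (0::'a) 1))"
    using a C0_nonneg by (simp add: sph.emeasure_eq_measure ennreal_mult)
  finally show ?thesis .
qed

lemma V_sphere_le:
  "(\<integral>\<^sup>+\<omega>. V (y *\<^sub>R \<omega>) \<partial>sphere_measure) \<le> ennreal (exp (2 * t * k\<^sup>2) * (LINT x|lborel. \<Phi> x) * (1 + 2 * t * \<bar>y\<bar>) powr k * measure sphere_measure (sphere (0::'a) 1))"
proof -
  interpret sph: finite_measure "sphere_measure :: 'a measure" by (rule finite_measure_sphere)
  have "(\<integral>\<^sup>+\<omega>. V (y *\<^sub>R \<omega>) \<partial>sphere_measure) \<le> (\<integral>\<^sup>+\<omega>. ennreal (exp (2 * t * k\<^sup>2) * (LINT x|lborel. \<Phi> x) * (1 + 2 * t * \<bar>y\<bar>) powr k) \<partial>(sphere_measure :: 'a measure))"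
  proof (rule nn_integral_mono)
    fix \<omega> :: 'a assume "\<omega> \<in> space sphere_measure"
    then show "V (y *\<^sub>R \<omega>) \<le> ennreal (exp (2 * t * k\<^sup>2) * (LINT x|lborel. \<Phi> x) * (1 + 2 * t * \<bar>y\<bar>) powr k)"
      using V_le[of "y *\<^sub>R \<omega>"] by simp
  qed
  then show ?thesis by (simp add: sph.emeasure_eq_measure ennreal_mult integral_nonneg_AE \<Phi>_nonneg)
qed

text \<open>\<open>G_bound\<close> with a = 1 and the crude bound for \<open>V\<close>; the degree
  is k rounded up.\<close>

lemma G_growth: "\<exists>C. \<forall>z. norm (G P z) \<le> C * (1 + norm z) ^ nat \<lceil>k\<rceil> * exp (t * (Im z)\<^sup>2)"
proof -
  let ?s = "measure sphere_measure (sphere (0::'a) 1)"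
  let ?N = "nat \<lceil>k\<rceil>"
  let ?c = "exp (2 * t * k\<^sup>2) * (LINT x|lborel. \<Phi> x)"
  have c: "0 \<le> ?c" by (simp add: integral_nonneg_AE \<Phi>_nonneg)
  define C where "C = B * (C0 * ?s + ?c * (1 + 2 * t) ^ ?N * ?s)"
  have "norm (G P z) \<le> C * (1 + norm z) ^ ?N * exp (t * (Im z)\<^sup>2)" for z
  proof -
    have N: "x powr k \<le> x ^ ?N" if "1 \<le> x" for x :: real
    proof -
      have "x powr k \<le> x powr (real ?N)" using that k by (intro powr_mono) (auto simp: of_nat_ceiling)
      then show ?thesis using that by (simp add: powr_realpow)
    qed
    have "(1 + 2 * t * \<bar>Im z\<bar>) powr k \<le> (1 + 2 * t * \<bar>Im z\<bar>) ^ ?N" using t by (intro N) auto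
    also have "\<dots> \<le> ((1 + 2 * t) * (1 + norm z)) ^ ?N"
    proof (rule power_mono)
      have "2 * t * \<bar>Im z\<bar> \<le> 2 * t * norm z" using t abs_Im_le_cmod[of z] by (intro mult_left_mono) auto
      then show "1 + 2 * t * \<bar>Im z\<bar> \<le> (1 + 2 * t) * (1 + norm z)" using t by (simp add: algebra_simps add_increasing)
    qed (use t in auto)
    finally have pw: "(1 + 2 * t * \<bar>Im z\<bar>) powr k \<le> (1 + 2 * t) ^ ?N * (1 + norm z) ^ ?N" by (simp add: power_mult_distrib)
    have "ennreal (norm (G P z)) \<le> ennreal (B * exp (t * (Im z)\<^sup>2)) * (ennreal (1 * C0 * ?s) + ennreal (1 powr (1 - p)) * (\<integral>\<^sup>+\<omega>. V (Im z *\<^sub>R \<omega>) \<partial>sphere_measure))"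
      by (rule G_bound) simp
    also have "\<dots> \<le> ennreal (B * exp (t * (Im z)\<^sup>2)) * (ennreal (C0 * ?s) + ennreal (?c * (1 + 2 * t * \<bar>Im z\<bar>) powr k * ?s))"
      using V_sphere_le[of "Im z"] by (intro mult_left_mono add_mono) auto
    also have "\<dots> = ennreal (B * exp (t * (Im z)\<^sup>2) * (C0 * ?s + ?c * (1 + 2 * t * \<bar>Im z\<bar>) powr k * ?s))"
      using B_nonneg C0_nonneg c by (simp add: ennreal_mult[symmetric] ennreal_plus[symmetric] del: ennreal_plus)
    finally have "norm (G P z) \<le> B * exp (t * (Im z)\<^sup>2) * (C0 * ?s + ?c * (1 + 2 * t * \<bar>Im z\<bar>) powr k * ?s)"
      using B_nonneg C0_nonneg c by (subst (asm) ennreal_le_iff) auto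
    also have "\<dots> \<le> B * exp (t * (Im z)\<^sup>2) * ((C0 * ?s) * (1 + norm z) ^ ?N + ?c * ((1 + 2 * t) ^ ?N * (1 + norm z) ^ ?N) * ?s)"
    proof (intro mult_left_mono add_mono mult_right_mono)
      show "C0 * ?s \<le> (C0 * ?s) * (1 + norm z) ^ ?N"
        using C0_nonneg mult_left_mono[of 1 "(1 + norm z) ^ ?N" "C0 * ?s"] by simp
    qed (use pw c B_nonneg in auto)
    also have "\<dots> = C * (1 + norm z) ^ ?N * exp (t * (Im z)\<^sup>2)" by (simp add: C_def algebra_simps)
    finally show ?thesis .
  qed
  then show ?thesis by blast
qed

text \<open>Multiplication by exp (t z^2) moves the Gaussian growth from the imaginary to the real
  direction, the form required by Phragmen-Lindelof. Degree 0 is then forced by playing the linear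
  growth of a nonconstant polynomial against \<open>V_tail\<close>.\<close>

theorem G_gaussian:
  assumes kp: "k \<le> real DIM('a) + p"
    and even: "\<And>r. norm (G P (- of_real r)) = norm (G P (of_real r))"
    and int: "\<And>x. 0 < x \<Longrightarrow> integral {0..x} (\<lambda>y. norm (G P (of_real y)) * exp (t * y\<^sup>2)) \<le> D * (1 + x) ^ M"
  shows "\<exists>c. \<forall>z. G P z = c * exp (- of_real t * z\<^sup>2)"
proof -
  define h where "h z = G P z * exp (of_real t * z\<^sup>2)" for z
  have nh: "norm (h z) = norm (G P z) * exp (t * ((Re z)\<^sup>2 - (Im z)\<^sup>2))" for z
    by (simp add: h_def norm_mult power2_eq_square)
  obtain C where C: "\<And>z. norm (G P z) \<le> C * (1 + norm z) ^ nat \<lceil>k\<rceil> * exp (t * (Im z)\<^sup>2)"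
    using G_growth by blast
  have "\<exists>q. h = poly q"
  proof (rule Phragmen_Lindelof_polynomial_integral[OF _ _ _ _ t])
    show "h holomorphic_on UNIV" unfolding h_def[abs_def] by (intro holomorphic_intros G_holomorphic)
    show "norm (h z) \<le> C * (1 + norm z) ^ nat \<lceil>k\<rceil> * exp (t * (Re z)\<^sup>2)" for z
    proof -
      have "norm (h z) \<le> (C * (1 + norm z) ^ nat \<lceil>k\<rceil> * exp (t * (Im z)\<^sup>2)) * exp (t * ((Re z)\<^sup>2 - (Im z)\<^sup>2))"
        unfolding nh using C by (intro mult_right_mono) auto
      also have "\<dots> = C * (1 + norm z) ^ nat \<lceil>k\<rceil> * exp (t * (Re z)\<^sup>2)"
        by (simp add: mult.assoc exp_add[symmetric] algebra_simps)
      finally show ?thesis .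
    qed
    show "norm (h (- of_real x)) = norm (h (of_real x))" for x using even[of x] by (simp add: nh)
    show "integral {0..x} (\<lambda>y. norm (h (of_real y))) \<le> D * (1 + x) ^ M" if "0 < x" for x
      using int[OF that] by (simp add: nh)
  qed
  then obtain q where q: "h = poly q" by blast
  have "degree q = 0"
  proof (rule ccontr)
    assume "degree q \<noteq> 0"
    then obtain c R where c: "0 < c" "1 \<le> R" "\<And>z. R \<le> norm z \<Longrightarrow> c * norm z \<le> norm (h z)"
      using poly_lower_bound q by metis
    let ?s = "measure sphere_measure (sphere (0::'a) 1)"
    \<comment> \<open>A positive majorant of B, since B may be 0 and b enters a denominator.\<close>
    define b where "b = B + 1"
    \<comment> \<open>With a = \<epsilon> y the first Young term contributes at most (c / 2) y, half
      of the lower bound c y for |h(i y)|. The summand 1 keeps the denominator positive.\<close>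
    define \<epsilon> where "\<epsilon> = c / (2 * b * (C0 * ?s + 1))"
    have b: "0 < b" "B \<le> b" using B_nonneg by (auto simp: b_def)
    have s: "0 \<le> C0 * ?s" using C0_nonneg by simp
    then have \<epsilon>: "0 < \<epsilon>" using c b by (simp add: \<epsilon>_def)
    have \<epsilon>2: "b * (\<epsilon> * y * C0 * ?s) \<le> c / 2 * y" if "0 < y" for y
    proof -
      have "b * (\<epsilon> * y * C0 * ?s) = (c / 2 * y) * ((C0 * ?s) / (C0 * ?s + 1))"
      proof -
        have "b * (c / (2 * b * E) * y * X) = (c / 2 * y) * (X / E)" if "0 < E" for X E
          using b that by (simp add: field_simps)
        from this[of "C0 * ?s + 1" "C0 * ?s"] s show ?thesis by (simp add: \<epsilon>_def mult.assoc)
      qed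
      also have "\<dots> \<le> (c / 2 * y) * 1"
        using c that s by (intro mult_left_mono) (auto simp: divide_le_eq)
      finally show ?thesis by simp
    qed
    define \<kappa> where "\<kappa> = c / 2 / (b * \<epsilon> powr (1 - p))"
    have \<kappa>: "0 < \<kappa>" using c b \<epsilon> by (simp add: \<kappa>_def)
    \<comment> \<open>The other half of the lower bound must be carried by \<open>V\<close>: (c / 2)
      y \<le> b (\<epsilon> y)^(1-p) W. Solving for W produces the power y^p and the constant
      \<kappa>.\<close>
    have low: "ennreal (\<kappa> * y powr p) \<le> (\<integral>\<^sup>+\<omega>. V (y *\<^sub>R \<omega>) \<partial>sphere_measure)" if y: "R \<le> y" for y
    proof (cases "(\<integral>\<^sup>+\<omega>. V (y *\<^sub>R \<omega>) \<partial>sphere_measure)")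
      case (real W)
      have y0: "0 < y" using y c by linarith
      let ?e = "exp (t * y\<^sup>2)"
      have hy: "norm (h (\<i> * of_real y)) * ?e = norm (G P (\<i> * of_real y))"
        by (simp add: nh exp_add[symmetric] mult.assoc)
      have "c * y \<le> norm (h (\<i> * of_real y))" using c(3)[of "\<i> * of_real y"] y y0 by (simp add: norm_mult)
      then have "c * y * ?e \<le> norm (G P (\<i> * of_real y))" unfolding hy[symmetric] by (intro mult_right_mono) auto
      then have "ennreal (c * y * ?e) \<le> ennreal (norm (G P (\<i> * of_real y)))" by (rule ennreal_leI)
      also have "\<dots> \<le> ennreal (B * exp (t * (Im (\<i> * of_real y))\<^sup>2)) * (ennreal (\<epsilon> * y * C0 * ?s) + ennreal ((\<epsilon> * y) powr (1 - p)) * (\<integral>\<^sup>+\<omega>. V (Im (\<i> * of_real y) *\<^sub>R \<omega>) \<partial>sphere_measure))"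
        using \<epsilon> y0 by (intro G_bound) auto
      also have "\<dots> = ennreal (B * ?e * (\<epsilon> * y * C0 * ?s + (\<epsilon> * y) powr (1 - p) * W))"
        using real B_nonneg \<epsilon> y0 C0_nonneg by (simp add: ennreal_mult[symmetric] ennreal_plus[symmetric] del: ennreal_plus)
      also have "\<dots> \<le> ennreal (b * ?e * (\<epsilon> * y * C0 * ?s + (\<epsilon> * y) powr (1 - p) * W))"
        using b real \<epsilon> y0 C0_nonneg by (intro ennreal_leI mult_right_mono add_nonneg_nonneg) auto
      finally have "c * y * ?e \<le> b * ?e * (\<epsilon> * y * C0 * ?s + (\<epsilon> * y) powr (1 - p) * W)"
        using b real \<epsilon> y0 C0_nonneg by (subst (asm) ennreal_le_iff) auto
      then have "c * y \<le> b * (\<epsilon> * y * C0 * ?s + (\<epsilon> * y) powr (1 - p) * W)"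
        by (simp add: mult_ac)
      then have "c / 2 * y \<le> b * ((\<epsilon> * y) powr (1 - p) * W)" using \<epsilon>2[OF y0] by (simp add: algebra_simps)
      also have "\<dots> = (b * \<epsilon> powr (1 - p)) * y powr (1 - p) * W" using \<epsilon> y0 by (simp add: powr_mult)
      finally have "\<kappa> * y \<le> y powr (1 - p) * W" using b \<epsilon> by (simp add: \<kappa>_def field_simps)
      then have "y powr (p - 1) * (\<kappa> * y) \<le> y powr (p - 1) * (y powr (1 - p) * W)" by (intro mult_left_mono) auto
      moreover have "y powr (p - 1) * (y powr (1 - p) * W) = W" using y0 by (simp add: mult.assoc[symmetric] powr_add[symmetric])
      moreover have "y powr (p - 1) * (\<kappa> * y) = \<kappa> * y powr p" using y0 by (simp add: powr_diff)
      ultimately show ?thesis using real by (auto intro: ennreal_leI)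
    qed simp
    have "\<infinity> = ennreal \<kappa> * (\<integral>\<^sup>+r. indicator {R..} r * ennreal (1 / r) \<partial>lborel)"
      using not_nn_integrable_inverse(1)[of R] c \<kappa> by (simp add: ennreal_mult_eq_top_iff)
    also have "\<dots> = (\<integral>\<^sup>+r. ennreal \<kappa> * (indicator {R..} r * ennreal (1 / r)) \<partial>lborel)"
      by (rule nn_integral_cmult[symmetric]) measurable
    also have "\<dots> \<le> (\<integral>\<^sup>+r. indicator {1..} r * ennreal (r powr (real DIM('a) - 1 - k)) * (\<integral>\<^sup>+\<omega>. V (r *\<^sub>R \<omega>) \<partial>sphere_measure) \<partial>lborel)"
    proof (rule nn_integral_mono)
      fix r :: real
      show "ennreal \<kappa> * (indicator {R..} r * ennreal (1 / r)) \<le> indicator {1..} r * ennreal (r powr (real DIM('a) - 1 - k)) * (\<integral>\<^sup>+\<omega>. V (r *\<^sub>R \<omega>) \<partial>sphere_measure)"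
      proof (cases "R \<le> r")
        case True
        have r1: "1 \<le> r" using True c by simp
        \<comment> \<open>Here k \<le> n + p makes the exponent n - 1 - k + p at least -1, just
          enough for comparison with the divergent integral of 1/r.\<close>
        have "1 / r = r powr (-1)" using r1 by (simp add: powr_minus_divide)
        also have "\<dots> \<le> r powr (real DIM('a) - 1 - k + p)" using r1 kp by (intro powr_mono) auto
        finally have "\<kappa> * (1 / r) \<le> \<kappa> * r powr (real DIM('a) - 1 - k + p)"
          using \<kappa> by (intro mult_left_mono) auto
        then have "\<kappa> * (1 / r) \<le> r powr (real DIM('a) - 1 - k) * (\<kappa> * r powr p)"
          by (simp add: powr_add mult_ac)
        then have "ennreal \<kappa> * ennreal (1 / r) \<le> ennreal (r powr (real DIM('a) - 1 - k)) * ennreal (\<kappa> * r powr p)"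
          using \<kappa> r1 by (simp add: ennreal_mult[symmetric] ennreal_leI)
        also have "\<dots> \<le> ennreal (r powr (real DIM('a) - 1 - k)) * (\<integral>\<^sup>+\<omega>. V (r *\<^sub>R \<omega>) \<partial>sphere_measure)"
          using low[OF True] by (rule mult_left_mono) simp
        finally show ?thesis using True r1 by simp
      qed simp
    qed
    also have "\<dots> < \<infinity>" by (rule V_tail)
    finally show False by simp
  qed
  then obtain c where "q = [:c:]" by (metis degree_eq_zeroE)
  then have "G P z * exp (of_real t * z\<^sup>2) = c" for z using q by (simp add: h_def fun_eq_iff)
  then have "G P z = c * exp (- of_real t * z\<^sup>2)" for z
    by (simp add: exp_minus field_simps)
  then show ?thesis by blast
qed

end

end

section \<open>Spherical harmonics\<close>

text \<open>Along coordinate lines the real and imaginary parts are differentiated separately, so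
  the iterated vector derivatives of the definition are iterated directional derivatives.\<close>

lemma laplacian_eq_lap:
  fixes P :: "'a::euclidean_space \<Rightarrow> complex"
  assumes "real_polynomial_function (\<lambda>x. Re (P x))" "real_polynomial_function (\<lambda>x. Im (P x))"
  shows "laplacian P x = Complex (lap (\<lambda>x. Re (P x)) x) (lap (\<lambda>x. Im (P x)) x)"
proof -
  let ?u = "\<lambda>x. Re (P x)" and ?v = "\<lambda>x. Im (P x)"
  have 1: "vector_derivative (\<lambda>h'. P (x + h' *\<^sub>R b)) (at h) = Complex (dird b ?u (x + h *\<^sub>R b)) (dird b ?v (x + h *\<^sub>R b))" for b h
    by (rule vector_derivative_at)
       (use dird_along[OF assms(1), of x b h] dird_along[OF assms(2), of x b h] in \<open>simp add: has_vector_derivative_complex_iff\<close>)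
  have 2: "vector_derivative (\<lambda>h. Complex (dird b ?u (x + h *\<^sub>R b)) (dird b ?v (x + h *\<^sub>R b))) (at 0) = Complex (dird b (dird b ?u) x) (dird b (dird b ?v) x)" for b
    by (rule vector_derivative_at)
       (use dird_along[OF rpoly_dird[OF assms(1)], of b x b 0] dird_along[OF rpoly_dird[OF assms(2)], of b x b 0] in \<open>simp add: has_vector_derivative_complex_iff\<close>)
  show ?thesis unfolding laplacian_def 1 2 lap_def by (simp add: complex_eq_iff)
qed

lemma polynomial_function_Re_Im:
  fixes P :: "'a::euclidean_space \<Rightarrow> complex"
  assumes "polynomial_function P"
  shows "real_polynomial_function (\<lambda>x. Re (P x))" "real_polynomial_function (\<lambda>x. Im (P x))"
  using assms bounded_linear_Re bounded_linear_Im unfolding polynomial_function_def o_def by auto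

lemma of_real_polynomial_function:
  assumes "real_polynomial_function H"
  shows "polynomial_function (\<lambda>x. complex_of_real (H x))"
  unfolding polynomial_function_def o_def
proof (intro allI impI)
  fix g :: "complex \<Rightarrow> real" assume "bounded_linear g"
  then have "g (of_real r) = r * g 1" for r
    using linear_scale[OF bounded_linear.linear, of g r 1] by (simp add: scaleR_conv_of_real)
  then show "real_polynomial_function (\<lambda>x. g (complex_of_real (H x)))"
    using rpoly_mult[OF assms rpoly_const[of "g 1"]] by simp
qed

text \<open>Supplies the test functions for (ii): real harmonics already separate continuous
  functions on the sphere.\<close>

lemma of_real_homog_spherical_harmonic:
  assumes "homog m H" "\<And>x. lap H x = 0"
  shows "restrict (\<lambda>x. complex_of_real (H x)) (sphere 0 1) \<in> spherical_harmonics m"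
  unfolding spherical_harmonics_def
proof (rule CollectI, intro exI conjI allI)
  have H: "real_polynomial_function H" using assms(1) by (rule homogD)
  show "polynomial_function (\<lambda>x. complex_of_real (H x))" using H by (rule of_real_polynomial_function)
  show "laplacian (\<lambda>x. complex_of_real (H x)) x = 0" for x
    using laplacian_eq_lap[of "\<lambda>x. complex_of_real (H x)" x] H assms(2)
    by (simp add: rpoly_const lap_def[of "\<lambda>x. 0"] dird_const complex_eq_iff)
  show "complex_of_real (H (c *\<^sub>R x)) = complex_of_real (c ^ m) * complex_of_real (H x)" for c x
    by (simp add: homogD(2)[OF assms(1)])
qed simp

lemma spherical_harmonicE:
  assumes "S \<in> spherical_harmonics m"
  obtains P where "S = restrict P (sphere 0 1)" "continuous_on UNIV P"
    "homog m (\<lambda>x. Re (P x))" "homog m (\<lambda>x. Im (P x))" "\<And>x. lap (\<lambda>x. Re (P x)) x = 0" "\<And>x. lap (\<lambda>x. Im (P x)) x = 0"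
proof -
  obtain P where P: "S = restrict P (sphere 0 1)" "polynomial_function P"
    "\<And>c x. P (c *\<^sub>R x) = of_real (c ^ m) * P x" "\<And>x. laplacian P x = 0"
    using assms by (auto simp: spherical_harmonics_def)
  show thesis
  proof (rule that[OF P(1)])
    show "continuous_on UNIV P" using P(2) by (rule continuous_on_polymonial_function)
    show "homog m (\<lambda>x. Re (P x))" "homog m (\<lambda>x. Im (P x))"
      using polynomial_function_Re_Im[OF P(2)] by (simp_all add: homog_def P(3))
    show "lap (\<lambda>x. Re (P x)) x = 0" "lap (\<lambda>x. Im (P x)) x = 0" for x
      using laplacian_eq_lap[OF polynomial_function_Re_Im[OF P(2)], of x] P(4)[of x] by (auto simp: complex_eq_iff)
  qed
qed

section \<open>Antipodal symmetry and totality on the sphere\<close>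

lemma continuous_bounded_sphere:
  fixes P :: "'a::euclidean_space \<Rightarrow> 'b::real_normed_vector"
  assumes "continuous_on UNIV P"
  shows "\<exists>B. \<forall>\<omega>. norm \<omega> = 1 \<longrightarrow> norm (P \<omega>) \<le> B"
proof -
  have "compact (P ` sphere 0 1)"
    by (rule compact_continuous_image[OF continuous_on_subset[OF assms]]) auto
  then obtain B where "\<And>y. y \<in> P ` sphere 0 1 \<Longrightarrow> norm y \<le> B"
    using compact_imp_bounded bounded_iff by metis
  then show ?thesis by (intro exI[of _ B]) auto
qed

lemma continuous_integrable_sphere:
  fixes P :: "'a::euclidean_space \<Rightarrow> 'b::{banach, second_countable_topology}"
  assumes "continuous_on UNIV P"
  shows "integrable sphere_measure P"
proof -
  interpret sph: finite_measure "sphere_measure :: 'a measure" by (rule finite_measure_sphere)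
  obtain B where "\<And>\<omega>. norm \<omega> = 1 \<Longrightarrow> norm (P \<omega>) \<le> B" using continuous_bounded_sphere[OF assms] by blast
  then show ?thesis
    by (intro sph.integrable_const_bound[of _ B] AE_I2)
       (auto intro: borel_measurable_sphereI borel_measurable_continuous_onI[OF assms])
qed

lemma integral_sphere_spherical_harmonic_0:
  fixes P :: "'a::euclidean_space \<Rightarrow> complex"
  assumes "homog m (\<lambda>x. Re (P x))" "homog m (\<lambda>x. Im (P x))" "\<And>x. lap (\<lambda>x. Re (P x)) x = 0" "\<And>x. lap (\<lambda>x. Im (P x)) x = 0"
    and "continuous_on UNIV P" "0 < m"
  shows "(LINT \<omega>|sphere_measure. P \<omega>) = 0"
  using continuous_integrable_sphere[OF assms(5)]
    integral_sphere_harmonic_homog_0[OF assms(1,3,6)] integral_sphere_harmonic_homog_0[OF assms(2,4,6)]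
  by (simp add: complex_eq_iff)

text \<open>Extending along rays turns the antipodal map into x -> - x on the ball, which preserves
  Lebesgue measure.\<close>

lemma nn_integral_sphere_uminus:
  fixes u :: "'a::euclidean_space \<Rightarrow> ennreal"
  assumes [measurable]: "u \<in> borel_measurable borel"
  shows "(\<integral>\<^sup>+\<omega>. u (- \<omega>) \<partial>sphere_measure) = (\<integral>\<^sup>+\<omega>. u \<omega> \<partial>sphere_measure)"
proof -
  let ?g = "\<lambda>x::'a. indicator (cball 0 1 - {0}) x * u (x /\<^sub>R norm x)"
  have m: "?g \<in> borel_measurable borel"
  proof -
    have [measurable]: "(indicator (cball 0 1 - {0::'a}) :: 'a \<Rightarrow> ennreal) \<in> borel_measurable borel"
      by (rule borel_measurable_indicator) auto
    show ?thesis by measurable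
  qed
  have "(\<integral>\<^sup>+\<omega>. u (- \<omega>) \<partial>sphere_measure) = of_nat DIM('a) * (\<integral>\<^sup>+x. ?g (0 + (- 1) *\<^sub>R x) \<partial>lborel)"
    by (subst nn_integral_sphere) (auto intro!: arg_cong[where f = "\<lambda>x. of_nat DIM('a) * x"] nn_integral_cong simp: indicator_def)
  also have "(\<integral>\<^sup>+x. ?g (0 + (- 1) *\<^sub>R x) \<partial>lborel) = (\<integral>\<^sup>+x. ?g x \<partial>lborel)"
    using nn_integral_lborel_affine[OF m, of "-1" 0] by simp
  finally show ?thesis by (subst nn_integral_sphere[of u]) auto
qed

lemma integral_sphere_uminus:
  fixes g :: "'a::euclidean_space \<Rightarrow> complex"
  assumes [measurable]: "g \<in> borel_measurable borel"
  shows "(LINT \<omega>|sphere_measure. g (- \<omega>)) = (LINT \<omega>|sphere_measure. g \<omega>)"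
proof -
  have m: "(\<lambda>\<omega>. - \<omega>) \<in> sphere_measure \<rightarrow>\<^sub>M (borel :: 'a measure)" "(\<lambda>\<omega>. \<omega>) \<in> sphere_measure \<rightarrow>\<^sub>M (borel :: 'a measure)"
    by (rule measurable_compose[OF borel_measurable_sphere], measurable) (rule borel_measurable_sphere)
  have "distr sphere_measure borel (\<lambda>\<omega>::'a. - \<omega>) = distr sphere_measure borel (\<lambda>\<omega>. \<omega>)"
  proof (rule measure_eqI)
    fix A :: "'a set" assume "A \<in> sets (distr sphere_measure borel (\<lambda>\<omega>::'a. - \<omega>))"
    then have [measurable]: "A \<in> sets borel" by simp
    have e: "emeasure (distr sphere_measure borel h) A = (\<integral>\<^sup>+\<omega>. indicator A (h \<omega>) \<partial>sphere_measure)"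
      if "h \<in> sphere_measure \<rightarrow>\<^sub>M (borel :: 'a measure)" for h :: "'a \<Rightarrow> 'a"
      using nn_integral_distr[OF that, of "indicator A"] by (simp add: nn_integral_indicator[symmetric] del: nn_integral_indicator)
    show "emeasure (distr sphere_measure borel (\<lambda>\<omega>::'a. - \<omega>)) A = emeasure (distr sphere_measure borel (\<lambda>\<omega>. \<omega>)) A"
      unfolding e[OF m(1)] e[OF m(2)] by (rule nn_integral_sphere_uminus) measurable
  qed simp
  then show ?thesis using integral_distr[OF m(1), of g] integral_distr[OF m(2), of g] by simp
qed

text \<open>If g did not vanish at \<omega>, the cone over the set where g is nonzero would contain
  a nonempty open subset of the ball, which cannot be a null set.\<close>

lemma AE_sphere_continuous_eq_0:
  fixes g :: "'a::euclidean_space \<Rightarrow> real"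
  assumes g: "continuous_on UNIV g" and ae: "AE \<omega> in sphere_measure. g \<omega> = 0" and \<omega>: "norm \<omega> = 1"
  shows "g \<omega> = 0"
proof (rule ccontr)
  assume n: "g \<omega> \<noteq> 0"
  have [measurable]: "g \<in> borel_measurable borel" using g by (rule borel_measurable_continuous_onI)
  let ?U = "{x \<in> ball 0 1 - {0}. g (x /\<^sub>R norm x) \<in> - {0}}"
  have "continuous_on (ball 0 1 - {0}) (\<lambda>x. g (x /\<^sub>R norm x))"
    by (rule continuous_on_compose2[OF g]) (auto intro!: continuous_intros)
  then have oU: "open ?U"
    by (rule continuous_open_preimage[unfolded vimage_def Int_def mem_Collect_eq, of _ _ "- {0}"]) auto
  have "\<omega> \<noteq> 0" using \<omega> by auto
  \<comment> \<open>The witness is halved because \<omega> itself lies on the boundary of the open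
    ball.\<close>
  then have "(1 / 2) *\<^sub>R \<omega> \<in> ?U" using n \<omega> by simp
  then have "\<not> negligible ?U" using open_not_negligible[OF oU] by blast
  moreover have "negligible ?U"
  proof -
    let ?h = "\<lambda>\<omega>. indicator (- {0}) (g \<omega>) :: ennreal"
    have "(\<integral>\<^sup>+\<omega>. ?h \<omega> \<partial>sphere_measure) = (\<integral>\<^sup>+\<omega>. 0 \<partial>(sphere_measure :: 'a measure))"
      by (rule nn_integral_cong_AE) (use ae in eventually_elim, simp)
    then have "(\<integral>\<^sup>+x. indicator (cball 0 1 - {0}) x * ?h (x /\<^sub>R norm x) \<partial>lborel) = 0"
      by (subst (asm) nn_integral_sphere) auto
    moreover have "emeasure lborel ?U \<le> (\<integral>\<^sup>+x. indicator (cball 0 1 - {0}) x * ?h (x /\<^sub>R norm x) \<partial>lborel)"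
    proof -
      have "emeasure lborel ?U = (\<integral>\<^sup>+x. indicator ?U x \<partial>lborel)"
        by (rule nn_integral_indicator[symmetric]) (simp only: sets_lborel borel_open[OF oU])
      also have "\<dots> \<le> (\<integral>\<^sup>+x. indicator (cball 0 1 - {0}) x * ?h (x /\<^sub>R norm x) \<partial>lborel)"
        by (rule nn_integral_mono) (auto simp: indicator_def)
      finally show ?thesis .
    qed
    ultimately have "?U \<in> null_sets lborel" using oU by (auto simp: null_sets_def)
    then show ?thesis by (simp add: negligible_iff_null_sets null_sets_completionI)
  qed
  ultimately show False by simp
qed

text \<open>For a Stone-Weierstrass approximation P of g up to e, orthogonality gives that the
  integral of g^2 equals that of g (g - P), hence is at most e times the integral of |g|.\<close>

lemma sphere_polynomials_total_real:
  fixes g :: "'a::euclidean_space \<Rightarrow> real"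
  assumes g: "continuous_on UNIV g"
    and orth: "\<And>P. real_polynomial_function P \<Longrightarrow> (LINT \<omega>|sphere_measure. g \<omega> * P \<omega>) = 0"
    and \<omega>: "norm \<omega> = 1"
  shows "g \<omega> = 0"
proof -
  have gg: "continuous_on UNIV (\<lambda>\<omega>. g \<omega> * g \<omega>)" "continuous_on UNIV (\<lambda>\<omega>. \<bar>g \<omega>\<bar>)"
    using g by (auto intro!: continuous_intros)
  note i = continuous_integrable_sphere[OF gg(1)] continuous_integrable_sphere[OF gg(2)]
  have le: "(LINT \<omega>|sphere_measure. g \<omega> * g \<omega>) \<le> 0 + e * (LINT \<omega>|sphere_measure. \<bar>g \<omega>\<bar>)" if "0 < e" for e
  proof -
    obtain P where P: "real_polynomial_function P" "\<And>\<omega>. norm \<omega> = 1 \<Longrightarrow> \<bar>g \<omega> - P \<omega>\<bar> < e"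
      using Stone_Weierstrass_real_polynomial_function[of "sphere 0 1" g e] \<open>0 < e\<close> continuous_on_subset[OF g]
      by (metis compact_sphere mem_sphere_0 subset_UNIV)
    have cP: "continuous_on UNIV (\<lambda>\<omega>. g \<omega> * P \<omega>)" using g rpoly_cont[OF P(1)] by (intro continuous_intros)
    have "(LINT \<omega>|sphere_measure. g \<omega> * g \<omega>) = (LINT \<omega>|sphere_measure. g \<omega> * g \<omega> - g \<omega> * P \<omega>)"
      using i continuous_integrable_sphere[OF cP] orth[OF P(1)] by simp
    also have "\<dots> \<le> (LINT \<omega>|sphere_measure. e * \<bar>g \<omega>\<bar>)"
    proof (rule integral_mono)
      fix \<omega> :: 'a assume "\<omega> \<in> space sphere_measure"
      then have "\<bar>g \<omega>\<bar> * \<bar>g \<omega> - P \<omega>\<bar> \<le> \<bar>g \<omega>\<bar> * e" using P(2)[of \<omega>] by (intro mult_left_mono) auto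
      then show "g \<omega> * g \<omega> - g \<omega> * P \<omega> \<le> e * \<bar>g \<omega>\<bar>"
        by (simp add: abs_mult[symmetric] right_diff_distrib[symmetric] mult.commute[of e])
    qed (use i continuous_integrable_sphere[OF cP] in auto)
    finally show ?thesis by simp
  qed
  have "(LINT \<omega>|sphere_measure. g \<omega> * g \<omega>) \<le> 0"
  proof (rule field_le_epsilon)
    fix e :: real assume e: "0 < e"
    let ?I = "LINT \<omega>|sphere_measure. \<bar>g \<omega>\<bar>"
    have I0: "0 \<le> ?I" by (rule integral_nonneg_AE) simp
    have "e / (I + 1) * I \<le> e \<and> 0 < e / (I + 1)" if "0 \<le> I" for I
      using that e by (simp add: pos_divide_le_eq algebra_simps)
    from this[OF I0] have "e / (?I + 1) * ?I \<le> e" "0 < e / (?I + 1)" by auto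
    then show "(LINT \<omega>|sphere_measure. g \<omega> * g \<omega>) \<le> 0 + e" using le[of "e / (?I + 1)"] by linarith
  qed
  moreover have "0 \<le> (LINT \<omega>|sphere_measure. g \<omega> * g \<omega>)" by (rule integral_nonneg_AE) simp
  ultimately have "(LINT \<omega>|sphere_measure. g \<omega> * g \<omega>) = 0" by simp
  then have "AE \<omega> in sphere_measure. g \<omega> * g \<omega> = 0"
    using integral_nonneg_eq_0_iff_AE[OF i(1)] by simp
  then have "AE \<omega> in sphere_measure. g \<omega> = 0" by simp
  then show ?thesis by (rule AE_sphere_continuous_eq_0[OF g _ \<omega>])
qed

text \<open>On the sphere the factors |\<omega>|^(2 j) are 1, so orthogonality to harmonics extends
  to homogeneous polynomials by \<open>homog_harmonic_sum\<close> and to all polynomials by the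
  grading.\<close>

theorem spherical_harmonics_total:
  fixes g :: "'a::euclidean_space \<Rightarrow> complex"
  assumes g: "continuous_on UNIV g"
    and orth: "\<And>m H. homog m H \<Longrightarrow> (\<And>x. lap H x = 0) \<Longrightarrow> (LINT \<omega>|sphere_measure. g \<omega> * of_real (H \<omega>)) = 0"
    and \<omega>: "norm \<omega> = 1"
  shows "g \<omega> = 0"
proof -
  have ip: "integrable sphere_measure (\<lambda>\<omega>. g \<omega> * of_real (P \<omega>))" if "real_polynomial_function P" for P
    by (rule continuous_integrable_sphere) (intro continuous_intros g rpoly_cont that)
  have h: "(LINT \<omega>|sphere_measure. g \<omega> * of_real (P \<omega>)) = 0" if "harmonic_sum m P" for m P
    using that
  proof (induction rule: harmonic_sum.induct)
    case (add m f d H j)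
    have "(LINT \<omega>|sphere_measure. g \<omega> * of_real (f \<omega> + norm \<omega> ^ (2 * j) * H \<omega>)) = (LINT \<omega>|sphere_measure. g \<omega> * of_real (f \<omega>) + g \<omega> * of_real (H \<omega>))"
      by (rule Bochner_Integration.integral_cong) (auto simp: algebra_simps)
    also have "\<dots> = 0"
      using add orth[OF add(2)] ip[OF homogD(1)[OF add(2)]] ip[OF homogD(1)[OF harmonic_sum_homog[OF add(1)]]] by simp
    finally show ?case .
  qed simp
  have all: "(LINT \<omega>|sphere_measure. g \<omega> * of_real (P \<omega>)) = 0 \<and> real_polynomial_function P" if "homog_sum P" for P
    using that
  proof (induction rule: homog_sum.induct)
    case (add f m H)
    then show ?case using h[OF homog_harmonic_sum[OF add(2)]] ip[of f] ip[OF homogD(1)[OF add(2)]] homogD(1)[OF add(2)]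
      by (auto simp: distrib_left intro: rpoly_add)
  qed (simp add: rpoly_const)
  have z: "(LINT \<omega>|sphere_measure. g \<omega> * of_real (P \<omega>)) = 0" if "real_polynomial_function P" for P
    using all[OF rpoly_homog_sum[OF that]] by blast
  have "Re (g \<omega>) = 0"
  proof (rule sphere_polynomials_total_real[OF _ _ \<omega>])
    fix P :: "'a \<Rightarrow> real" assume P: "real_polynomial_function P"
    show "(LINT \<omega>|sphere_measure. Re (g \<omega>) * P \<omega>) = 0"
      using arg_cong[OF z[OF P], of Re] integral_Re[OF ip[OF P]] by simp
  qed (intro continuous_intros g)
  moreover have "Im (g \<omega>) = 0"
  proof (rule sphere_polynomials_total_real[OF _ _ \<omega>])
    fix P :: "'a \<Rightarrow> real" assume P: "real_polynomial_function P"
    show "(LINT \<omega>|sphere_measure. Im (g \<omega>) * P \<omega>) = 0"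
      using arg_cong[OF z[OF P], of Im] integral_Im[OF ip[OF P]] by simp
  qed (intro continuous_intros g)
  ultimately show ?thesis by (simp add: complex_eq_iff)
qed

lemma continuous_fourier:
  fixes f :: "'a::euclidean_space \<Rightarrow> complex"
  assumes f: "integrable lborel f" and z: "Im z = 0"
  shows "continuous_on UNIV (\<lambda>\<xi>. LINT x|lborel. f x * exp (- \<i> * (z * of_real (x \<bullet> \<xi>))))"
proof -
  have [measurable]: "f \<in> borel_measurable borel" using f by auto
  show ?thesis
    unfolding continuous_on_sequentially
  proof (intro allI impI ballI)
    fix X :: "nat \<Rightarrow> 'a" and a assume "(\<forall>n. X n \<in> UNIV) \<and> X \<longlonglongrightarrow> a"
    then have X: "X \<longlonglongrightarrow> a" by simp
    have "(\<lambda>n. LINT x|lborel. f x * exp (- \<i> * (z * of_real (x \<bullet> X n)))) \<longlonglongrightarrow> (LINT x|lborel. f x * exp (- \<i> * (z * of_real (x \<bullet> a))))"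
    proof (rule integral_dominated_convergence[where w = "\<lambda>x. norm (f x)"])
      show "AE x in lborel. (\<lambda>n. f x * exp (- \<i> * (z * of_real (x \<bullet> X n)))) \<longlonglongrightarrow> f x * exp (- \<i> * (z * of_real (x \<bullet> a)))"
        by (intro AE_I2 tendsto_intros X)
      show "AE x in lborel. norm (f x * exp (- \<i> * (z * of_real (x \<bullet> X n)))) \<le> norm (f x)" for n
        using z by (simp add: norm_mult)
    qed (use f in auto)
    then show "((\<lambda>\<xi>. LINT x|lborel. f x * exp (- \<i> * (z * of_real (x \<bullet> \<xi>)))) \<circ> X) \<longlonglongrightarrow> (LINT x|lborel. f x * exp (- \<i> * (z * of_real (x \<bullet> a))))"
      by (simp add: o_def)
  qed
qed

section \<open>The equality case\<close>

lemma fourier_polar_lborel: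
  assumes "f \<in> borel_measurable borel"
  shows "fourier_polar f r \<omega> = of_real ((2 * pi) powr (- real DIM('a) / 2)) *
     (LINT x|lborel. f x * exp (- \<i> * (of_real r * of_real (x \<bullet> (\<omega>::'a::euclidean_space)))))"
  unfolding fourier_polar_def using assms by (subst integral_completion) auto

context gaussian_decaying
begin

lemma harmonic_coeff_eq:
  assumes "continuous_on UNIV P"
  shows "harmonic_coeff f m (restrict P (sphere 0 1)) r = of_real (r powi (- int m)) * (of_real ((2 * pi) powr (- real DIM('a) / 2)) * G P (of_real r))"
proof -
  obtain B where B: "\<And>\<omega>. norm \<omega> = 1 \<Longrightarrow> norm (P \<omega>) \<le> B" using continuous_bounded_sphere[OF assms] by blast
  have [measurable]: "P \<in> borel_measurable borel" using assms by (rule borel_measurable_continuous_onI)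
  have "(LINT \<omega>|sphere_measure. fourier_polar f r \<omega> * restrict P (sphere 0 1) \<omega>)
     = (LINT \<omega>|sphere_measure. of_real ((2 * pi) powr (- real DIM('a) / 2)) * ((LINT x|lborel. f x * exp (- \<i> * (of_real r * of_real (x \<bullet> \<omega>)))) * P \<omega>))"
    by (rule Bochner_Integration.integral_cong) (auto simp: fourier_polar_lborel)
  also have "\<dots> = of_real ((2 * pi) powr (- real DIM('a) / 2)) * G P (of_real r)"
    by (subst G_eq[OF _ B]) auto
  finally show ?thesis by (simp add: harmonic_coeff_def)
qed

text \<open>Replacing \<omega> by - \<omega> changes the sign of the frequency and multiplies P by
  (-1)^m, which has modulus 1.\<close>

lemma G_even:
  assumes P: "continuous_on UNIV P" and hom: "\<And>c x. P (c *\<^sub>R x) = of_real (c ^ m) * P x"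
  shows "norm (G P (- of_real r)) = norm (G P (of_real r))"
proof -
  obtain B where B: "\<And>\<omega>. norm \<omega> = 1 \<Longrightarrow> norm (P \<omega>) \<le> B" using continuous_bounded_sphere[OF P] by blast
  have [measurable]: "P \<in> borel_measurable borel" using P by (rule borel_measurable_continuous_onI)
  let ?g = "\<lambda>\<omega>. (LINT x|lborel. f x * exp (- \<i> * (of_real r * of_real (x \<bullet> \<omega>)))) * P \<omega>"
  have Pm: "P \<omega> = (-1) ^ m * P (- \<omega>)" for \<omega> using hom[of "-1" "- \<omega>"] by simp
  have "G P (- of_real r) = (LINT \<omega>|sphere_measure. (LINT x|lborel. f x * exp (- \<i> * (- of_real r * of_real (x \<bullet> \<omega>)))) * P \<omega>)"
    by (rule G_eq[OF _ B]) auto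
  also have "\<dots> = (LINT \<omega>|sphere_measure. (-1) ^ m * ?g (- \<omega>))"
    by (rule Bochner_Integration.integral_cong[OF refl], subst Pm) simp
  also have "\<dots> = (-1) ^ m * (LINT \<omega>|sphere_measure. ?g (- \<omega>))" by (rule integral_mult_right_zero)
  also have "(LINT \<omega>|sphere_measure. ?g (- \<omega>)) = (LINT \<omega>|sphere_measure. ?g \<omega>)"
    by (rule integral_sphere_uminus) measurable
  also have "\<dots> = G P (of_real r)" by (rule G_eq[symmetric, OF _ B]) auto
  finally show ?thesis by (simp add: norm_mult norm_power)
qed

text \<open>Turns the q-th power condition (ii) into the integral bound of \<open>G_gaussian\<close>
  by H \<le> 1 + H^q, the weights being polynomially bounded on [0, x]. Once \<open>G\<close> is
  Gaussian, H is constant, and (ii) is tested once more near r = 0.\<close>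

lemma G_spherical_harmonic:
  assumes q: "1 \<le> q" and l: "0 \<le> l" and kp: "k \<le> real DIM('a) + p"
    and fg: "fourier_gaussian_decay q t l f"
    and S: "S \<in> spherical_harmonics m" "S = restrict P (sphere 0 1)"
    and P: "continuous_on UNIV P" "\<And>c x. P (c *\<^sub>R x) = of_real (c ^ m) * P x"
  shows "\<exists>c. (\<forall>z. G P z = c * exp (- of_real t * z\<^sup>2)) \<and> (0 < m \<longrightarrow> c = 0)"
proof -
  obtain B where B: "\<And>\<omega>. norm \<omega> = 1 \<Longrightarrow> norm (P \<omega>) \<le> B" using continuous_bounded_sphere[OF P(1)] by blast
  have [measurable]: "P \<in> borel_measurable borel" using P(1) by (rule borel_measurable_continuous_onI)
  define H where "H y = norm (G P (of_real y)) * exp (t * y\<^sup>2)" for y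
  define a where "a = ((2 * pi) powr (- real DIM('a) / 2))"
  have a: "0 < a" by (simp add: a_def)
  have cG: "continuous_on UNIV (G P)" by (rule holomorphic_on_imp_continuous_on[OF G_holomorphic[OF _ B]]) auto
  have cH: "continuous_on A H" for A unfolding H_def
    by (intro continuous_intros continuous_on_compose2[OF cG]) auto
  have [measurable]: "H \<in> borel_measurable borel" by (rule borel_measurable_continuous_onI[OF cH])
  \<comment> \<open>The integrand of (ii) written through H: the Gaussian weight is absorbed in H,
    and the factor 1 / r^m of the harmonic coefficient is kept explicit.\<close>
  define j where "j r = (a / r ^ m * H r) powr q / (1 + r) powr l" for r
  have [measurable]: "j \<in> borel_measurable borel" unfolding j_def by measurable
  have jeq: "norm (harmonic_coeff f m S r) powr q * exp (q * t * r\<^sup>2) / (1 + r) powr l = j r" if "0 < r" for r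
  proof -
    have "norm (harmonic_coeff f m S r) = a / r ^ m * norm (G P (of_real r))"
    proof -
      have "r powi (- int m) = 1 / r ^ m" by (simp add: power_int_minus divide_inverse)
      then show ?thesis unfolding S(2) harmonic_coeff_eq[OF P(1)] norm_mult norm_of_real a_def[symmetric]
        using that a by simp
    qed
    moreover have "exp (q * t * r\<^sup>2) = exp (t * r\<^sup>2) powr q" by (simp add: exp_powr_real mult_ac)
    ultimately have "norm (harmonic_coeff f m S r) powr q * exp (q * t * r\<^sup>2) = (a / r ^ m * norm (G P (of_real r))) powr q * exp (t * r\<^sup>2) powr q"
      by (simp only:)
    also have "\<dots> = (a / r ^ m * norm (G P (of_real r)) * exp (t * r\<^sup>2)) powr q"
      by (rule powr_mult[symmetric])
    finally show ?thesis by (simp add: j_def H_def mult.assoc)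
  qed
  have j0: "0 \<le> j r" for r by (simp add: j_def)
  have "(\<integral>\<^sup>+r\<in>{0<..}. ennreal (j r) \<partial>lborel) = (\<integral>\<^sup>+r\<in>{0<..}. ennreal (norm (harmonic_coeff f m S r) powr q * exp (q * t * r\<^sup>2) / (1 + r) powr l) \<partial>lborel)"
    by (rule nn_integral_cong) (auto simp: indicator_def jeq)
  also have "\<dots> < \<infinity>" using fg S(1) by (auto simp: fourier_gaussian_decay_def)
  finally have jfin: "(\<integral>\<^sup>+r\<in>{0<..}. ennreal (j r) \<partial>lborel) < \<infinity>" .
  define J where "J = enn2real (\<integral>\<^sup>+r\<in>{0<..}. ennreal (j r) \<partial>lborel)"
  have J: "(\<integral>\<^sup>+r\<in>{0<..}. ennreal (j r) \<partial>lborel) = ennreal J" "0 \<le> J" using jfin by (auto simp: J_def)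
  \<comment> \<open>Solving the definition of j for H^q leaves the weight r^(m q) (1 + r)^l, bounded
    by (1 + x)^N for r \<le> x.\<close>
  define N where "N = nat \<lceil>real m * q + l\<rceil>"
  define \<kappa> where "\<kappa> = a powr - q"
  have int: "integral {0..x} H \<le> (1 + \<kappa> * J) * (1 + x) ^ Suc N" if x: "0 < x" for x
  proof -
    have pt: "H y \<le> 1 + \<kappa> * (1 + x) ^ N * j y" if y: "0 < y" "y \<le> x" for y
    proof (cases "H y \<le> 1")
      case True
      have "0 \<le> \<kappa> * (1 + x) ^ N * j y" using x j0 by (simp add: \<kappa>_def)
      with True show ?thesis by linarith
    next
      case False
      have "H y \<le> H y powr q" using False q powr_mono[of 1 q "H y"] by simp
      also have "H y powr q = \<kappa> * ((y ^ m) powr q * (1 + y) powr l) * j y"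
      proof -
        have "(a / y ^ m * H y) powr q = a powr q / (y ^ m) powr q * H y powr q"
          using a y False by (simp add: powr_mult powr_divide)
        then show ?thesis using a y by (simp add: j_def \<kappa>_def powr_minus field_simps)
      qed
      also have "(y ^ m) powr q * (1 + y) powr l \<le> (1 + x) ^ N"
      proof -
        have "(y ^ m) powr q \<le> ((1 + x) ^ m) powr q" using y q by (intro powr_mono2 power_mono) auto
        moreover have "(1 + y) powr l \<le> (1 + x) powr l" using y l by (intro powr_mono2) auto
        ultimately have "(y ^ m) powr q * (1 + y) powr l \<le> ((1 + x) ^ m) powr q * (1 + x) powr l"
          by (intro mult_mono) auto
        also have "\<dots> = (1 + x) powr (real m * q + l)"
          using x by (simp add: powr_realpow[symmetric] powr_powr powr_add)
        also have "\<dots> \<le> (1 + x) powr real N" using x unfolding N_def by (intro powr_mono real_nat_ceiling_ge) auto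
        also have "\<dots> = (1 + x) ^ N" using x by (simp add: powr_realpow)
        finally show ?thesis .
      qed
      then have "\<kappa> * ((y ^ m) powr q * (1 + y) powr l) * j y \<le> \<kappa> * (1 + x) ^ N * j y"
        using j0 by (intro mult_right_mono mult_left_mono) (auto simp: \<kappa>_def)
      finally show ?thesis by simp
    qed
    have si: "set_integrable lborel {0..x} H"
      by (rule borel_integrable_atLeastAtMost') (rule cH)
    have "ennreal (integral {0..x} H) = ennreal (LINT y:{0..x}|lborel. H y)"
      by (simp add: set_borel_integral_eq_integral(2)[OF si])
    also have "\<dots> = (\<integral>\<^sup>+y. ennreal (indicator {0..x} y *\<^sub>R H y) \<partial>lborel)"
      unfolding set_lebesgue_integral_def using si
      by (subst nn_integral_eq_integral) (auto simp: set_integrable_def H_def)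
    also have "\<dots> \<le> (\<integral>\<^sup>+y. indicator {0..x} y + ennreal (\<kappa> * (1 + x) ^ N) * (ennreal (j y) * indicator {0<..} y) \<partial>lborel)"
    proof (rule nn_integral_mono_AE)
      have "AE y in lborel. y \<noteq> (0::real)" by (rule AE_lborel_singleton)
      then show "AE y in lborel. ennreal (indicator {0..x} y *\<^sub>R H y) \<le> indicator {0..x} y + ennreal (\<kappa> * (1 + x) ^ N) * (ennreal (j y) * indicator {0<..} y)"
      proof eventually_elim
        case (elim y)
        show ?case
        proof (cases "0 < y \<and> y \<le> x")
          case True
          have "ennreal (H y) \<le> ennreal (1 + \<kappa> * (1 + x) ^ N * j y)" using pt True by (intro ennreal_leI) auto
          also have "\<dots> = 1 + ennreal (\<kappa> * (1 + x) ^ N) * ennreal (j y)"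
            using j0 x by (simp add: ennreal_mult[symmetric] \<kappa>_def)
          finally show ?thesis using True by simp
        next
          case False
          then have "indicator {0..x} y = (0::real)" using elim by (auto simp: indicator_def)
          then show ?thesis by simp
        qed
      qed
    qed
    also have "\<dots> = ennreal x + ennreal (\<kappa> * (1 + x) ^ N) * ennreal J"
      using x by (simp add: nn_integral_add nn_integral_cmult J)
    also have "\<dots> = ennreal (x + \<kappa> * (1 + x) ^ N * J)"
      using x J by (simp add: ennreal_mult[symmetric] \<kappa>_def ennreal_plus[symmetric] del: ennreal_plus)
    finally have "integral {0..x} H \<le> x + \<kappa> * (1 + x) ^ N * J"
      using x J by (subst (asm) ennreal_le_iff) (auto simp: \<kappa>_def)
    also have "\<dots> \<le> (1 + x) ^ Suc N + \<kappa> * (1 + x) ^ Suc N * J"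
    proof (intro add_mono mult_right_mono mult_left_mono)
      have "(1 + x) * 1 \<le> (1 + x) * (1 + x) ^ N" using x by (intro mult_left_mono one_le_power) auto
      then have "x \<le> (1 + x) * (1 + x) ^ N" by (rule order_trans[rotated]) simp
      then show "x \<le> (1 + x) ^ Suc N" by simp
      show "(1 + x) ^ N \<le> (1 + x) ^ Suc N" using x by (intro power_increasing) auto
    qed (auto simp: \<kappa>_def J)
    finally show ?thesis by (simp add: algebra_simps)
  qed
  have "\<exists>c. \<forall>z. G P z = c * exp (- of_real t * z\<^sup>2)"
    by (rule G_gaussian[OF _ B kp G_even[OF P] int[unfolded H_def]]) auto
  then obtain c where c: "\<And>z. G P z = c * exp (- of_real t * z\<^sup>2)" by blast
  have "c = 0" if m: "0 < m"
  proof (rule ccontr)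
    assume "c \<noteq> 0"
    have Hc: "H r = norm c" for r
      by (simp add: H_def c norm_mult mult.assoc exp_add[symmetric])
    \<comment> \<open>For r \<le> 1 and m > 0 one has r^(m q) \<le> r because m q \<ge> 1, so j
      dominates a multiple of 1/r.\<close>
    have low: "(a * norm c) powr q / 2 powr l * (1 / r) \<le> j r" if r: "0 < r" "r \<le> 1" for r
    proof -
      have "r powr (real m * q) \<le> r powr 1" using r q m mult_mono[of 1 "real m" 1 q] by (intro powr_mono') auto
      then have "(r ^ m) powr q \<le> r" using r by (simp add: powr_realpow[symmetric] powr_powr)
      moreover have "(1 + r) powr l \<le> 2 powr l" using r l by (intro powr_mono2) auto
      ultimately have "(a * norm c) powr q / (2 powr l * r) \<le> (a * norm c) powr q / ((1 + r) powr l * (r ^ m) powr q)"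
        using r by (intro divide_left_mono mult_mono mult_pos_pos) auto
      also have "\<dots> = j r" using r a by (simp add: j_def Hc powr_mult powr_divide field_simps)
      finally show ?thesis by simp
    qed
    have "\<infinity> = ennreal ((a * norm c) powr q / 2 powr l) * (\<integral>\<^sup>+r. indicator {0<..1} r * ennreal (1 / r) \<partial>lborel)"
      using not_nn_integrable_inverse(2)[of 1] a \<open>c \<noteq> 0\<close> by (simp add: ennreal_mult_eq_top_iff)
    also have "\<dots> = (\<integral>\<^sup>+r. ennreal ((a * norm c) powr q / 2 powr l) * (indicator {0<..1} r * ennreal (1 / r)) \<partial>lborel)"
      by (rule nn_integral_cmult[symmetric]) measurable
    also have "\<dots> \<le> (\<integral>\<^sup>+r\<in>{0<..}. ennreal (j r) \<partial>lborel)"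
    proof (rule nn_integral_mono)
      fix r :: real
      show "ennreal ((a * norm c) powr q / 2 powr l) * (indicator {0<..1} r * ennreal (1 / r)) \<le> ennreal (j r) * indicator {0<..} r"
      proof (cases "0 < r \<and> r \<le> 1")
        case True
        have "ennreal ((a * norm c) powr q / 2 powr l) * ennreal (1 / r) = ennreal ((a * norm c) powr q / 2 powr l * (1 / r))"
          using True by (intro ennreal_mult[symmetric]) auto
        also have "\<dots> \<le> ennreal (j r)" using low True by (intro ennreal_leI) auto
        finally show ?thesis using True by simp
      qed (simp add: indicator_def)
    qed
    finally show False using jfin by simp
  qed
  with c show ?thesis by blast
qed

text \<open>On each sphere the Fourier transform of f minus a suitable constant is orthogonal to all
  harmonics: for m > 0 both integrals vanish, and for m = 0 the constant is matched. By totality the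
  transform of f is radial and Gaussian.\<close>

theorem eq_heat_kernel:
  assumes q: "1 \<le> q" and l: "0 \<le> l" and kp: "k \<le> real DIM('a) + p"
    and fg: "fourier_gaussian_decay q t l f"
  shows "\<exists>c. AE x in lborel. f x = c * of_real (heat_kernel t x)"
proof -
  interpret sph: finite_measure "sphere_measure :: 'a measure" by (rule finite_measure_sphere)
  define Fh where "Fh r \<omega> = (LINT x|lborel. f x * exp (- \<i> * (of_real r * of_real (x \<bullet> \<omega>))))" for r :: real and \<omega>
  have cFh: "continuous_on UNIV (Fh r)" for r
    unfolding Fh_def by (rule continuous_fourier[OF integrable_f]) simp
  have coeff: "\<exists>c. (\<forall>r. (LINT \<omega>|sphere_measure. Fh r \<omega> * of_real (H \<omega>)) = c * exp (- of_real t * (of_real r)\<^sup>2)) \<and> (0 < m \<longrightarrow> c = 0)"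
    if H: "homog m H" "\<And>x. lap H x = 0" for m H
  proof -
    have cH: "continuous_on UNIV (\<lambda>x. complex_of_real (H x))"
      by (intro continuous_intros rpoly_cont homogD(1)[OF H(1)])
    obtain B where B: "\<And>\<omega>. norm \<omega> = 1 \<Longrightarrow> norm (complex_of_real (H \<omega>)) \<le> B" using continuous_bounded_sphere[OF cH] by blast
    have G: "G (\<lambda>x. of_real (H x)) (of_real r) = (LINT \<omega>|sphere_measure. Fh r \<omega> * of_real (H \<omega>))" for r
      unfolding Fh_def by (rule G_eq[OF borel_measurable_continuous_onI[OF cH] B])
    obtain c where "\<And>z. G (\<lambda>x. of_real (H x)) z = c * exp (- of_real t * z\<^sup>2)" "0 < m \<longrightarrow> c = 0"
      using G_spherical_harmonic[OF q l kp fg of_real_homog_spherical_harmonic[OF H] refl cH] homogD(2)[OF H(1)] by auto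
    then show ?thesis unfolding G[symmetric] by blast
  qed
  let ?\<sigma> = "measure sphere_measure (sphere (0::'a) 1)"
  \<comment> \<open>The area of the sphere will be a divisor; if it vanished, the constant function
    1 would be 0 almost everywhere on the sphere.\<close>
  have \<sigma>: "?\<sigma> \<noteq> 0"
  proof
    assume "?\<sigma> = 0"
    then have "emeasure (sphere_measure :: 'a measure) (space sphere_measure) = 0" by (simp add: sph.emeasure_eq_measure)
    then have "AE \<omega> in (sphere_measure :: 'a measure). (1::real) = 0"
      by (intro AE_I[where N = "space sphere_measure"] sets.top) auto
    moreover obtain b :: 'a where "b \<in> Basis" using nonempty_Basis by blast
    ultimately show False using AE_sphere_continuous_eq_0[of "\<lambda>_. 1" b] by simp
  qed
  have one: "homog 0 (\<lambda>x::'a. 1)" "lap (\<lambda>x::'a. 1) x = 0" for x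
    by (auto simp: homog_def rpoly_const lap_def dird_const)
  obtain c where c: "\<And>r. (LINT \<omega>|sphere_measure. Fh r \<omega>) = c * exp (- of_real t * (of_real r)\<^sup>2)"
    using coeff[OF one] by auto
  \<comment> \<open>The constant is the mean of \<open>Fh r\<close> over the sphere, so
    orthogonality to constants holds by construction.\<close>
  have Fh: "Fh r \<omega> = c / of_real ?\<sigma> * exp (- of_real t * (of_real r)\<^sup>2)" if \<omega>: "norm \<omega> = 1" for r \<omega>
  proof -
    let ?e = "c / of_real ?\<sigma> * exp (- of_real t * (of_real r)\<^sup>2)"
    have "Fh r \<omega> - ?e = 0"
    proof (rule spherical_harmonics_total[OF _ _ \<omega>])
      show "continuous_on UNIV (\<lambda>\<omega>. Fh r \<omega> - ?e)" by (intro continuous_intros cFh)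
      fix m and H :: "'a \<Rightarrow> real" assume H: "homog m H" "\<And>x. lap H x = 0"
      have cH: "continuous_on UNIV (\<lambda>x. complex_of_real (H x))"
        by (intro continuous_intros rpoly_cont homogD(1)[OF H(1)])
      have iH: "integrable sphere_measure (\<lambda>x. complex_of_real (H x))" by (rule continuous_integrable_sphere[OF cH])
      have iFH: "integrable sphere_measure (\<lambda>\<omega>. Fh r \<omega> * of_real (H \<omega>))"
        by (rule continuous_integrable_sphere) (intro continuous_intros cFh cH)
      have eq: "(LINT \<omega>|sphere_measure. (Fh r \<omega> - ?e) * of_real (H \<omega>)) = (LINT \<omega>|sphere_measure. Fh r \<omega> * of_real (H \<omega>)) - ?e * (LINT \<omega>|sphere_measure. of_real (H \<omega>))"
        using iH iFH by (simp add: left_diff_distrib)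
      show "(LINT \<omega>|sphere_measure. (Fh r \<omega> - ?e) * of_real (H \<omega>)) = 0"
      proof (cases "0 < m")
        case True
        then have "(LINT \<omega>|sphere_measure. Fh r \<omega> * of_real (H \<omega>)) = 0" using coeff[OF H] by auto
        moreover have "(LINT \<omega>|sphere_measure. complex_of_real (H \<omega>)) = 0"
          using integral_sphere_harmonic_homog_0[OF H True] by simp
        ultimately show ?thesis unfolding eq by simp
      next
        case False
        then have "H x = H 0" for x using homogD(2)[OF H(1), of 0 x] by simp
        then have "H = (\<lambda>x. H 0)" by blast
        then obtain h where h: "H = (\<lambda>x. h)" by blast
        show ?thesis unfolding eq unfolding h using \<sigma> c[of r] by (simp add: scaleR_conv_of_real)
      qed
    qed
    then show ?thesis by simp
  qed
  \<comment> \<open>Normalised by the mass of the Gaussian exp (- |x|^2 / (4 t)), so that d times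
    this Gaussian has the same Fourier transform as f.\<close>
  define d where "d = c / of_real ?\<sigma> / of_real (sqrt (4 * pi * t) ^ DIM('a))"
  have nz: "complex_of_real (sqrt (4 * pi * t) ^ DIM('a)) \<noteq> 0" using t by simp
  let ?g = "\<lambda>x::'a. complex_of_real (exp (- ((norm x)\<^sup>2) / (4 * t)))"
  have ig: "integrable lborel ?g"
    using integrable_gaussian[of "1 / (4 * t)", where 'a = 'a] t by (intro integrable_of_real) simp
  have "AE x in lborel. f x - d * ?g x = 0"
  proof (rule fourier_injective)
    show "integrable lborel (\<lambda>x. f x - d * ?g x)" using integrable_f ig by simp
    fix \<xi> :: 'a assume \<xi>: "\<xi> \<noteq> 0"
    have i1: "integrable lborel (\<lambda>x. f x * exp (- \<i> * of_real (x \<bullet> \<xi>)))"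
      by (rule Bochner_Integration.integrable_bound[OF integrable_f]) (auto simp: norm_mult)
    have "(LINT x|lborel. f x * exp (- \<i> * of_real (x \<bullet> \<xi>))) = Fh (norm \<xi>) (\<xi> /\<^sub>R norm \<xi>)"
    proof -
      have e: "complex_of_real (norm \<xi>) * of_real (x \<bullet> (\<xi> /\<^sub>R norm \<xi>)) = of_real (x \<bullet> \<xi>)" for x
        unfolding of_real_mult[symmetric] using \<xi> by simp
      show ?thesis unfolding Fh_def e by (rule refl)
    qed
    also have "\<dots> = c / of_real ?\<sigma> * exp (- of_real t * (of_real (norm \<xi>))\<^sup>2)"
      using \<xi> by (intro Fh) simp
    finally have 1: "(LINT x|lborel. f x * exp (- \<i> * of_real (x \<bullet> \<xi>))) = c / of_real ?\<sigma> * exp (- of_real t * (of_real (norm \<xi>))\<^sup>2)" .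
    have "(LINT x|lborel. (f x - d * ?g x) * exp (- \<i> * of_real (x \<bullet> \<xi>))) = (LINT x|lborel. f x * exp (- \<i> * of_real (x \<bullet> \<xi>)) - d * (?g x * exp (- \<i> * of_real (x \<bullet> \<xi>))))"
      by (intro Bochner_Integration.integral_cong) (auto simp: algebra_simps)
    also have "\<dots> = (LINT x|lborel. f x * exp (- \<i> * of_real (x \<bullet> \<xi>))) - d * (LINT x|lborel. ?g x * exp (- \<i> * of_real (x \<bullet> \<xi>)))"
      using i1 gaussian_fourier(2)[OF t, of \<xi>] by (subst Bochner_Integration.integral_diff) auto
    also have "\<dots> = 0"
      unfolding 1 gaussian_fourier(1)[OF t] using nz by (simp add: d_def exp_of_real[symmetric])
    finally show "(LINT x|lborel. (f x - d * ?g x) * exp (- \<i> * of_real (x \<bullet> \<xi>))) = 0" .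
  qed
  then have "AE x in lborel. f x = d / of_real ((4 * pi * t) powr (- real DIM('a) / 2)) * of_real (heat_kernel t x)"
    by eventually_elim (use t in \<open>simp add: heat_kernel_def\<close>)
  then show ?thesis by blast
qed

end

section \<open>Heat kernels\<close>

lemma ex_borel_eq_AE:
  fixes f :: "'a::euclidean_space \<Rightarrow> complex"
  assumes "f \<in> borel_measurable lebesgue"
  shows "\<exists>g. g \<in> borel_measurable borel \<and> (AE x in lebesgue. f x = g x)"
proof -
  have "(\<lambda>x. Re (f x)) \<in> borel_measurable lebesgue" "(\<lambda>x. Im (f x)) \<in> borel_measurable lebesgue"
    using assms by measurable
  then obtain u v where uv: "u \<in> borel_measurable lborel" "AE x in lborel. Re (f x) = u x"
      "v \<in> borel_measurable lborel" "AE x in lborel. Im (f x) = v x"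
    using completion_ex_borel_measurable_real by metis
  have "(\<lambda>x. Complex (u x) (v x)) \<in> borel_measurable borel"
    using uv by (auto simp: Complex_eq)
  moreover have "AE x in lborel. f x = Complex (u x) (v x)"
    using uv(2,4) by eventually_elim (simp add: complex_eq_iff)
  ultimately show ?thesis by (intro exI[of _ "\<lambda>x. Complex (u x) (v x)"] conjI AE_completion)
qed

lemma gaussian_decay_cong:
  assumes "AE x in lebesgue. f x = g x"
  shows "gaussian_decay p s k f \<longleftrightarrow> gaussian_decay p s k g"
proof -
  have "(\<integral>\<^sup>+x. ennreal (norm (f x) powr p * exp (p / (4 * s) * (norm x)\<^sup>2) / (1 + norm x) powr k) \<partial>lebesgue)
     = (\<integral>\<^sup>+x. ennreal (norm (g x) powr p * exp (p / (4 * s) * (norm x)\<^sup>2) / (1 + norm x) powr k) \<partial>lebesgue)"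
    by (rule nn_integral_cong_AE) (use assms in eventually_elim, simp)
  then show ?thesis by (simp add: gaussian_decay_def)
qed

lemma gaussian_decay_lborel:
  "gaussian_decay p s k f \<longleftrightarrow>
   (\<integral>\<^sup>+x. ennreal (norm (f x) powr p * exp (p / (4 * s) * (norm x)\<^sup>2) / (1 + norm x) powr k) \<partial>lborel) < \<infinity>"
  by (simp add: gaussian_decay_def nn_integral_completion)

lemma fourier_gaussian_decay_cong:
  assumes "f \<in> borel_measurable lebesgue" "g \<in> borel_measurable lebesgue" "AE x in lebesgue. f x = g x"
  shows "fourier_gaussian_decay q t l f \<longleftrightarrow> fourier_gaussian_decay q t l g"
proof -
  have e: "(\<lambda>x. exp (- \<i> * of_real (r * (x \<bullet> \<omega>)))) \<in> borel_measurable lebesgue" for r \<omega>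
    by (rule measurable_completion) measurable
  have "fourier_polar f r \<omega> = fourier_polar g r \<omega>" for r \<omega>
    unfolding fourier_polar_def
    by (intro arg_cong[where f = "\<lambda>x. _ * x"] integral_cong_AE borel_measurable_times assms(1,2) e)
       (use assms(3) in eventually_elim, simp)
  then show ?thesis by (simp add: fourier_gaussian_decay_def harmonic_coeff_def)
qed

theorem eq_heat_kernel_if_decay:
  fixes f :: "'a::euclidean_space \<Rightarrow> complex"
  assumes "1 \<le> p" "1 \<le> q" "0 < t" "0 \<le> k" "k \<le> real DIM('a) + p" "0 \<le> l"
    and f: "f \<in> borel_measurable lebesgue" "gaussian_decay p t k f" "fourier_gaussian_decay q t l f"
  shows "\<exists>c. AE x in lebesgue. f x = c * of_real (heat_kernel t x)"
proof -
  obtain g where g: "g \<in> borel_measurable borel" "AE x in lebesgue. f x = g x" using ex_borel_eq_AE[OF f(1)] by blast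
  interpret gaussian_decaying g p t k
    by standard (use assms g gaussian_decay_cong[OF g(2)] in \<open>auto simp: gaussian_decay_lborel\<close>)
  have "g \<in> borel_measurable lebesgue" using g(1) by (intro measurable_completion) simp
  then have "fourier_gaussian_decay q t l g" using fourier_gaussian_decay_cong[OF f(1) _ g(2)] f(3) by blast
  from eq_heat_kernel[OF assms(2) assms(6) assms(5) this]
  obtain c where "AE x in lborel. g x = c * of_real (heat_kernel t x)" by blast
  then have "AE x in lebesgue. g x = c * of_real (heat_kernel t x)" by (rule AE_completion)
  with g(2) have "AE x in lebesgue. f x = c * of_real (heat_kernel t x)" by eventually_elim simp
  then show ?thesis by blast
qed

text \<open>The Gaussian weight decreases as s grows. This brings the case s < t into the equality
  case with parameter t.\<close>

lemma gaussian_decay_mono: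
  assumes "gaussian_decay p s k f" "0 \<le> p" "0 < s" "s \<le> t"
  shows "gaussian_decay p t k f"
proof -
  have "(\<integral>\<^sup>+x. ennreal (norm (f x) powr p * exp (p / (4 * t) * (norm x)\<^sup>2) / (1 + norm x) powr k) \<partial>lebesgue)
     \<le> (\<integral>\<^sup>+x. ennreal (norm (f x) powr p * exp (p / (4 * s) * (norm x)\<^sup>2) / (1 + norm x) powr k) \<partial>lebesgue)"
  proof (intro nn_integral_mono ennreal_leI divide_right_mono mult_left_mono)
    fix x :: 'a
    have "p / (4 * t) \<le> p / (4 * s)" using assms by (intro divide_left_mono) auto
    then have "p / (4 * t) * (norm x)\<^sup>2 \<le> p / (4 * s) * (norm x)\<^sup>2" by (rule mult_right_mono) simp
    then show "exp (p / (4 * t) * (norm x)\<^sup>2) \<le> exp (p / (4 * s) * (norm x)\<^sup>2)" by simp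
  qed auto
  then show ?thesis using assms(1) by (auto simp: gaussian_decay_def elim: order.strict_trans1)
qed

section \<open>Heat kernels under conditions (i) and (ii)\<close>

lemma heat_kernel_meas [measurable]: "heat_kernel u \<in> borel_measurable borel"
  unfolding heat_kernel_def[abs_def] by measurable

lemma heat_kernel_pos: "0 < u \<Longrightarrow> 0 < heat_kernel u x"
  by (simp add: heat_kernel_def)

text \<open>The sign of 1/s - 1/u decides whether the kernel satisfies (i): the product grows for s
  < u and decays for s > u.\<close>

lemma heat_kernel_powr_exp:
  fixes x :: "'a::euclidean_space"
  assumes "0 < u"
  shows "heat_kernel u x powr p * exp (p / (4 * s) * (norm x)\<^sup>2) =
     (4 * pi * u) powr (- real DIM('a) / 2 * p) * exp (p / 4 * (1 / s - 1 / u) * (norm x)\<^sup>2)"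
proof -
  have "heat_kernel u x powr p = (4 * pi * u) powr (- real DIM('a) / 2 * p) * exp (- (norm x)\<^sup>2 / (4 * u) * p)"
    unfolding heat_kernel_def by (simp add: powr_mult powr_powr exp_powr_real)
  then show ?thesis by (simp add: mult.assoc exp_add[symmetric] algebra_simps)
qed

text \<open>For s < t the exponential growth beats the weight (1 + |x|)^k, so for c \<noteq> 0 the
  integrand stays above a positive constant on the whole space.\<close>

lemma gaussian_decay_heat_kernel_zero:
  fixes c :: complex
  assumes "0 < s" "s < t" "1 \<le> p" "0 \<le> k"
    and "gaussian_decay p s k (\<lambda>x::'a::euclidean_space. c * of_real (heat_kernel t x))"
  shows "c = 0"
proof (rule ccontr)
  assume c: "c \<noteq> 0"
  define a where "a = p / 4 * (1 / s - 1 / t)"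
  have a: "0 < a" using assms by (simp add: a_def divide_strict_left_mono)
  let ?K = "norm c powr p * (4 * pi * t) powr (- real DIM('a) / 2 * p)"
  have K: "0 < ?K" using c assms by simp
  let ?d = "?K / exp (k\<^sup>2 / (2 * a))"
  have low: "?d \<le> norm (c * of_real (heat_kernel t x)) powr p * exp (p / (4 * s) * (norm x)\<^sup>2) / (1 + norm x) powr k" for x :: 'a
  proof -
    have "(1 + norm x) powr k * exp (0 * norm x - a * (norm x)\<^sup>2) \<le> exp ((k + 0)\<^sup>2 / (2 * a)) * exp (- (a / 2) * (norm x)\<^sup>2)"
      using assms a by (intro powr_exp_gaussian_bound) auto
    also have "\<dots> \<le> exp (k\<^sup>2 / (2 * a)) * 1" using a by (intro mult_mono) auto
    finally have "(1 + norm x) powr k \<le> exp (k\<^sup>2 / (2 * a)) * exp (a * (norm x)\<^sup>2)"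
      by (simp add: exp_minus field_simps)
    moreover have "0 < 1 + norm x" by (simp add: add_pos_nonneg)
    then have "0 < (1 + norm x) powr k" by simp
    moreover have "K / E \<le> K * X / Y" if "0 < K" "0 < E" "0 < Y" "Y \<le> E * X" for K E X Y :: real
      using that mult_left_mono[OF that(4), of K] by (simp add: field_simps)
    ultimately have "?d \<le> ?K * exp (a * (norm x)\<^sup>2) / (1 + norm x) powr k"
      using K by (metis exp_gt_zero)
    also have "\<dots> = norm (c * of_real (heat_kernel t x)) powr p * exp (p / (4 * s) * (norm x)\<^sup>2) / (1 + norm x) powr k"
      using heat_kernel_powr_exp[of t x p s] heat_kernel_pos[of t x] assms
      by (simp add: norm_mult powr_mult a_def mult.assoc)
    finally show ?thesis .
  qed
  have "\<infinity> = (\<integral>\<^sup>+x. ennreal ?d \<partial>(lborel :: 'a measure))" using c assms by (simp add: ennreal_mult_top)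
  also have "\<dots> \<le> (\<integral>\<^sup>+x. ennreal (norm (c * of_real (heat_kernel t x)) powr p * exp (p / (4 * s) * (norm x)\<^sup>2) / (1 + norm x) powr k) \<partial>(lborel :: 'a measure))"
    by (intro nn_integral_mono ennreal_leI low)
  finally show False using assms(5) by (simp add: gaussian_decay_lborel top_unique)
qed

lemma gaussian_decay_heat_kernel:
  assumes "0 < u" "u < s" "1 \<le> p" "0 \<le> k"
  shows "gaussian_decay p s k (\<lambda>x::'a::euclidean_space. complex_of_real (heat_kernel u x))"
proof -
  define a where "a = p / 4 * (1 / u - 1 / s)"
  have a: "0 < a" using assms by (simp add: a_def divide_strict_left_mono)
  let ?K = "(4 * pi * u) powr (- real DIM('a) / 2 * p)"
  have le: "norm (complex_of_real (heat_kernel u x)) powr p * exp (p / (4 * s) * (norm x)\<^sup>2) / (1 + norm x) powr k \<le> ?K * exp (- a * (norm x)\<^sup>2)" for x :: 'a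
  proof -
    have "norm (complex_of_real (heat_kernel u x)) powr p * exp (p / (4 * s) * (norm x)\<^sup>2) = ?K * exp (- a * (norm x)\<^sup>2)"
      using heat_kernel_powr_exp[of u x p s] heat_kernel_pos[of u x] assms by (simp add: a_def algebra_simps)
    moreover have "1 \<le> (1 + norm x) powr k" using assms by (intro ge_one_powr_ge_zero) auto
    then have "y / (1 + norm x) powr k \<le> y" if "0 \<le> y" for y
      using that by (simp add: divide_le_eq mult_left_le_one_le mult_le_cancel_left1)
    ultimately show ?thesis by simp
  qed
  have "integrable lborel (\<lambda>x::'a. ?K * exp (- a * (norm x)\<^sup>2))"
    by (intro integrable_mult_right integrable_gaussian a)
  then have "(\<integral>\<^sup>+x. ennreal (?K * exp (- a * (norm x)\<^sup>2)) \<partial>(lborel :: 'a measure)) < \<infinity>"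
    by (subst nn_integral_eq_integral) auto
  then show ?thesis unfolding gaussian_decay_lborel
    by (rule order.strict_trans1[rotated]) (intro nn_integral_mono ennreal_leI le)
qed

lemma fourier_polar_heat_kernel:
  fixes \<omega> :: "'a::euclidean_space"
  assumes u: "0 < u" and \<omega>: "norm \<omega> = 1"
  shows "fourier_polar (\<lambda>x. complex_of_real (heat_kernel u x)) r \<omega> = of_real ((2 * pi) powr (- real DIM('a) / 2) * exp (- u * r\<^sup>2))"
proof -
  let ?A = "(4 * pi * u) powr (- real DIM('a) / 2)"
  have A: "?A * sqrt (4 * pi * u) ^ DIM('a) = 1"
    using u by (simp add: powr_half_sqrt[symmetric] powr_realpow[symmetric] powr_powr powr_add[symmetric] del: powr_half_sqrt)
  have "(LINT x|lborel. complex_of_real (heat_kernel u x) * exp (- \<i> * (of_real r * of_real (x \<bullet> \<omega>))))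
    = (LINT x|lborel. of_real ?A * (of_real (exp (- ((norm x)\<^sup>2) / (4 * u))) * exp (- \<i> * of_real (x \<bullet> (r *\<^sub>R \<omega>)))))"
    by (simp add: heat_kernel_def mult.assoc)
  also have "\<dots> = of_real ?A * complex_of_real (sqrt (4 * pi * u) ^ DIM('a) * exp (- u * (norm (r *\<^sub>R \<omega>))\<^sup>2))"
    unfolding integral_mult_right_zero gaussian_fourier(1)[OF u] ..
  also have "\<dots> = of_real ((?A * sqrt (4 * pi * u) ^ DIM('a)) * exp (- u * r\<^sup>2))"
    using \<omega> by (simp add: power_mult_distrib)
  also have "\<dots> = of_real (exp (- u * r\<^sup>2))" unfolding A by simp
  finally show ?thesis by (subst fourier_polar_lborel) auto
qed

text \<open>The Fourier transform is radial, so for m > 0 the coefficient vanishes because harmonics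
  have mean 0, and no singularity r^(-m) appears. For m = 0 the transform decays like exp (- u r^2)
  with u > t.\<close>

lemma fourier_gaussian_decay_heat_kernel:
  assumes "0 < t" "t < u" "1 \<le> q" "0 \<le> l"
  shows "fourier_gaussian_decay q t l (\<lambda>x::'a::euclidean_space. complex_of_real (heat_kernel u x))"
  unfolding fourier_gaussian_decay_def
proof (intro allI ballI)
  fix m and S :: "'a \<Rightarrow> complex" assume S: "S \<in> spherical_harmonics m"
  obtain P where P: "S = restrict P (sphere 0 1)" "continuous_on UNIV P"
    "homog m (\<lambda>x. Re (P x))" "homog m (\<lambda>x. Im (P x))" "\<And>x. lap (\<lambda>x. Re (P x)) x = 0" "\<And>x. lap (\<lambda>x. Im (P x)) x = 0"
    using spherical_harmonicE[OF S] by metis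
  let ?f = "\<lambda>x::'a. complex_of_real (heat_kernel u x)"
  define I where "I = (LINT \<omega>|sphere_measure. P \<omega>)"
  define A where "A = (2 * pi) powr (- real DIM('a) / 2) * norm I"
  have A: "0 \<le> A" by (simp add: A_def)
  have hc: "harmonic_coeff ?f m S r = of_real (r powi (- int m)) * (of_real ((2 * pi) powr (- real DIM('a) / 2) * exp (- u * r\<^sup>2)) * I)" for r
  proof -
    have "(LINT \<omega>|sphere_measure. fourier_polar ?f r \<omega> * S \<omega>) = (LINT \<omega>|sphere_measure. of_real ((2 * pi) powr (- real DIM('a) / 2) * exp (- u * r\<^sup>2)) * P \<omega>)"
      using assms by (intro Bochner_Integration.integral_cong) (auto simp: fourier_polar_heat_kernel P(1))
    then show ?thesis by (simp add: harmonic_coeff_def I_def)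
  qed
  have nh: "norm (harmonic_coeff ?f m S r) = A * exp (- u * r\<^sup>2)" if "0 < r" for r
  proof (cases "m = 0")
    case True
    then show ?thesis using hc[of r] by (simp add: A_def norm_mult)
  next
    case False
    then have "I = 0" unfolding I_def using P by (intro integral_sphere_spherical_harmonic_0) auto
    then show ?thesis by (simp add: hc A_def)
  qed
  have le: "norm (harmonic_coeff ?f m S r) powr q * exp (q * t * r\<^sup>2) / (1 + r) powr l \<le> A powr q * exp (- (q * (u - t)) * (norm r)\<^sup>2)" if r: "0 < r" for r
  proof -
    have "(A * exp (- u * r\<^sup>2)) powr q * exp (q * t * r\<^sup>2) = A powr q * exp (- (q * (u - t)) * r\<^sup>2)"
      by (simp add: powr_mult exp_powr_real mult.assoc exp_add[symmetric] algebra_simps)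
    moreover have "1 \<le> (1 + r) powr l" using r assms by (intro ge_one_powr_ge_zero) auto
    then have "y / (1 + r) powr l \<le> y" if "0 \<le> y" for y
      using that by (simp add: divide_le_eq mult_le_cancel_left1)
    ultimately show ?thesis by (simp add: nh[OF r])
  qed
  have "0 < q * (u - t)" using assms by simp
  then have "integrable lborel (\<lambda>r::real. A powr q * exp (- (q * (u - t)) * (norm r)\<^sup>2))"
    by (intro integrable_mult_right integrable_gaussian)
  then have "(\<integral>\<^sup>+r. ennreal (A powr q * exp (- (q * (u - t)) * (norm (r::real))\<^sup>2)) \<partial>lborel) < \<infinity>"
    by (subst nn_integral_eq_integral) auto
  then show "(\<integral>\<^sup>+r\<in>{0<..}. ennreal (norm (harmonic_coeff ?f m S r) powr q * exp (q * t * r\<^sup>2) / (1 + r) powr l) \<partial>lborel) < \<infinity>"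
  proof (rule order.strict_trans1[rotated], intro nn_integral_mono)
    fix r :: real
    show "ennreal (norm (harmonic_coeff ?f m S r) powr q * exp (q * t * r\<^sup>2) / (1 + r) powr l) * indicator {0<..} r \<le> ennreal (A powr q * exp (- (q * (u - t)) * (norm r)\<^sup>2))"
      using le[of r] by (cases "0 < r") (auto intro: ennreal_leI)
  qed
qed

text \<open>A combination that is 0 almost everywhere is 0 everywhere by continuity. Along a ray the
  widest kernel dominates, so multiplying by the inverse of its exponential and letting r grow
  isolates its coefficient; induction then proceeds to narrower kernels.\<close>

lemma heat_kernels_independent:
  fixes u :: "nat \<Rightarrow> real"
  assumes pos: "\<And>j. 0 < u j" and dec: "\<And>i j. i < j \<Longrightarrow> u j < u i"
  shows "ae_independent_seq (\<lambda>j x::'a::euclidean_space. complex_of_real (heat_kernel (u j) x))"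
  unfolding ae_independent_seq_def
proof (intro allI impI)
  fix N and c :: "nat \<Rightarrow> complex" and j
  assume ae: "AE x in (lebesgue :: 'a measure). (\<Sum>j<N. c j * complex_of_real (heat_kernel (u j) x)) = 0" and "j < N"
  let ?F = "\<lambda>x::'a. \<Sum>j<N. c j * complex_of_real (heat_kernel (u j) x)"
  have contF: "continuous_on UNIV ?F" unfolding heat_kernel_def by (intro continuous_intros) (use pos in \<open>auto simp: less_imp_neq[symmetric]\<close>)
  have F0: "?F x = 0" for x
  proof (rule ccontr)
    assume n: "?F x \<noteq> 0"
    let ?U = "{x. ?F x \<in> - {0}}"
    have "open (- {0::complex})" by auto
    from continuous_open_preimage[OF contF open_UNIV this] have "open ?U" by (simp add: vimage_def)
    moreover have "negligible ?U"
      using ae unfolding eventually_ae_filter_negligible by (auto intro: negligible_subset)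
    ultimately show False using n open_not_negligible by blast
  qed
  show "c j = 0" using \<open>j < N\<close>
  proof (induction j rule: less_induct)
    case (less i)
    obtain b :: 'a where b: "b \<in> Basis" using nonempty_Basis by blast
    let ?K = "\<lambda>j. complex_of_real ((4 * pi * u j) powr (- real DIM('a) / 2))"
    \<comment> \<open>Terms with j < i vanish by the induction hypothesis. Those with j > i have
      smaller \<open>u j\<close> and tend to 0, so only the i-th term survives.\<close>
    have "((\<lambda>r. \<Sum>j<N. c j * ?K j * of_real (exp (r\<^sup>2 / 4 * (1 / u i - 1 / u j)))) \<longlongrightarrow> (\<Sum>j<N. if j = i then c j * ?K j else 0)) at_top"
    proof (rule tendsto_sum)
      fix j assume "j \<in> {..<N}"
      consider "j < i" | "j = i" | "i < j" by linarith
      then show "((\<lambda>r. c j * ?K j * of_real (exp (r\<^sup>2 / 4 * (1 / u i - 1 / u j)))) \<longlongrightarrow> (if j = i then c j * ?K j else 0)) at_top"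
      proof cases
        case 1
        then have "c j = 0" using less by simp
        then show ?thesis using 1 by simp
      next
        case 3
        then have "u j < u i" by (rule dec)
        then have "1 / u i - 1 / u j < 0" using pos[of i] pos[of j] by (simp add: divide_strict_left_mono)
        then obtain d where d: "0 < d" "1 / u i - 1 / u j = - d" by (metis neg_0_less_iff_less minus_minus)
        have "((\<lambda>r::real. exp (r\<^sup>2 / 4 * - d)) \<longlongrightarrow> 0) at_top" using d(1) by real_asymp
        then have "((\<lambda>r. c j * ?K j * of_real (exp (r\<^sup>2 / 4 * (1 / u i - 1 / u j)))) \<longlongrightarrow> c j * ?K j * of_real 0) at_top"
          unfolding d(2) by (intro tendsto_intros)
        then show ?thesis using 3 by simp
      qed simp
    qed
    moreover have "(\<Sum>j<N. c j * ?K j * of_real (exp (r\<^sup>2 / 4 * (1 / u i - 1 / u j)))) = 0" for r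
    proof -
      have "(\<Sum>j<N. c j * ?K j * of_real (exp (r\<^sup>2 / 4 * (1 / u i - 1 / u j)))) = of_real (exp (r\<^sup>2 / (4 * u i))) * ?F (r *\<^sub>R b)"
        unfolding sum_distrib_left
      proof (rule sum.cong[OF refl])
        fix j
        have "exp (r\<^sup>2 / 4 * (1 / u i - 1 / u j)) = exp (r\<^sup>2 / (4 * u i)) * exp (- (norm (r *\<^sub>R b))\<^sup>2 / (4 * u j))"
        proof -
          have "r\<^sup>2 / 4 * (1 / u i - 1 / u j) = r\<^sup>2 / (4 * u i) + - (norm (r *\<^sub>R b))\<^sup>2 / (4 * u j)"
            using b by (simp add: right_diff_distrib)
          then show ?thesis by (simp only: exp_add)
        qed
        then show "c j * ?K j * of_real (exp (r\<^sup>2 / 4 * (1 / u i - 1 / u j))) = of_real (exp (r\<^sup>2 / (4 * u i))) * (c j * complex_of_real (heat_kernel (u j) (r *\<^sub>R b)))"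
          unfolding heat_kernel_def of_real_mult by (simp only: of_real_mult mult_ac)
      qed
      then show ?thesis using F0 by simp
    qed
    ultimately have "((\<lambda>r::real. 0) \<longlongrightarrow> (\<Sum>j<N. if j = i then c j * ?K j else 0)) at_top" by simp
    then have "(\<Sum>j<N. if j = i then c j * ?K j else 0) = 0" by (simp add: tendsto_const_iff)
    then have "c i * ?K i = 0" using less.prems by simp
    then show "c i = 0" using pos[of i] by simp
  qed
qed

theorem theorem3p3:
  fixes p q s t k l :: real
  assumes "CARD('n::finite) \<ge> 2"
    and "p \<ge> 1" and "q \<ge> 1" and "s > 0" and "t > 0"
    and "k \<in> {real CARD('n)<..real CARD('n) + p}"
    and "l \<in> {1<..1 + q}"
  shows
    "(s < t \<longrightarrow>
       (\<forall>f :: real ^ 'n \<Rightarrow> complex.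
          f \<in> borel_measurable lebesgue \<and> gaussian_decay p s k f \<and> fourier_gaussian_decay q t l f \<longrightarrow>
          (AE x in lebesgue. f x = 0))) \<and>
     (s = t \<longrightarrow>
       (\<forall>f :: real ^ 'n \<Rightarrow> complex.
          f \<in> borel_measurable lebesgue \<and> gaussian_decay p s k f \<and> fourier_gaussian_decay q t l f \<longrightarrow>
          (\<exists>c. AE x in lebesgue. f x = c * of_real (heat_kernel t x)))) \<and>
     (s > t \<longrightarrow>
       (\<exists>g :: nat \<Rightarrow> real ^ 'n \<Rightarrow> complex. ae_independent_seq g \<and>
          (\<forall>j. g j \<in> borel_measurable lebesgue \<and> gaussian_decay p s k (g j) \<and>
               fourier_gaussian_decay q t l (g j))))"
proof -
  have k: "0 \<le> k" "k \<le> real DIM(real ^ 'n) + p" and l: "0 \<le> l"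
    using assms(6,7) by auto
  note unique = eq_heat_kernel_if_decay[OF assms(2,3,5) k l]
  \<comment> \<open>After weakening s to t, f is a multiple c of the heat kernel; the original
    condition with s < t then forces c = 0.\<close>
  have zero: "AE x in lebesgue. f x = 0"
    if st: "s < t" and f: "f \<in> borel_measurable lebesgue" "gaussian_decay p s k f" "fourier_gaussian_decay q t l f"
    for f :: "real ^ 'n \<Rightarrow> complex"
  proof -
    have "gaussian_decay p t k f" by (rule gaussian_decay_mono[OF f(2)]) (use assms st in auto)
    from unique[OF f(1) this f(3)]
    obtain c where c: "AE x in lebesgue. f x = c * of_real (heat_kernel t x)" by blast
    have "gaussian_decay p s k (\<lambda>x::real ^ 'n. c * of_real (heat_kernel t x))"
      using gaussian_decay_cong[OF c] f(2) by simp
    then have "c = 0" by (rule gaussian_decay_heat_kernel_zero[OF assms(4) st assms(2) k(1)])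
    with c show ?thesis by simp
  qed
  have many: "\<exists>g :: nat \<Rightarrow> real ^ 'n \<Rightarrow> complex. ae_independent_seq g \<and>
      (\<forall>j. g j \<in> borel_measurable lebesgue \<and> gaussian_decay p s k (g j) \<and> fourier_gaussian_decay q t l (g j))"
    if st: "t < s"
  proof -
    \<comment> \<open>Strictly decreasing and strictly between t and s. The shift by 2 keeps already
      the first value below s.\<close>
    define u where "u j = t + (s - t) / (real j + 2)" for j :: nat
    have u: "t < u j" "u j < s" for j
    proof -
      show "t < u j" using st by (simp add: u_def)
      have "(s - t) / (real j + 2) < s - t" using st by (simp add: divide_less_eq mult_less_cancel_left1)
      then show "u j < s" by (simp add: u_def)
    qed
    have u0: "0 < u j" for j using u(1)[of j] assms(5) by simp
    have dec: "u j < u i" if "i < j" for i j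
      using that st by (simp add: u_def divide_strict_left_mono)
    let ?g = "\<lambda>j x::real ^ 'n. complex_of_real (heat_kernel (u j) x)"
    have "ae_independent_seq ?g" by (rule heat_kernels_independent[OF u0 dec])
    moreover have "?g j \<in> borel_measurable lebesgue" for j
      by (rule measurable_completion) measurable
    ultimately show ?thesis
      using gaussian_decay_heat_kernel[where 'a = "real ^ 'n", OF u0 u(2) assms(2) k(1)]
        fourier_gaussian_decay_heat_kernel[where 'a = "real ^ 'n", OF assms(5) u(1) assms(3) l]
      by (intro exI[of _ ?g]) simp
  qed
  show ?thesis
    using zero unique many by simp
qed

end
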